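(* Let $p\in(0,\infty)$ with $p\neq2$, let $\mathfrak N$ be a $\mathrm{II}_1$ factor with tracial state $\tau$, let $U\in\mathscr U(\mathfrak N)$ and $\theta\in(-\pi,\pi]$. Then $$\|U-2P+I\|_p^p=\tau(P)(2-2\cos\theta)^{p/2}+\tau(I-P)(2+2\cos\theta)^{p/2}$$ for every projection $P\in\mathfrak N$ if and only if $U$ equals either $e^{i\theta}I$ or $e^{-i\theta}I$.
   Context: $\mathscr U(\mathfrak N)$ is the unitary group of $\mathfrak N$ and $\|A\|_p:=\tau(|A|^p)^{1/p}$ for $A\in\mathfrak N$. *)

theory Defs
  imports "HOL-Analysis.Analysis" "HOL-Computational_Algebra.Polynomial"
begin

(* A complex Hilbert space is a complete real inner product space carrying a compatible complex
   structure: the real inner product is the real part of the complex one, so norm, topology and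
   completeness are those of the library. The complex inner product is linear on the left. *)
class complex_hilbert = real_inner + complete_space +
  fixes scaleC :: "complex \<Rightarrow> 'a \<Rightarrow> 'a" (infixr "*\<^sub>C" 75)
    and cinner :: "'a \<Rightarrow> 'a \<Rightarrow> complex"
  assumes scaleC_add_right: "c *\<^sub>C (x + y) = c *\<^sub>C x + c *\<^sub>C y"
    and scaleC_add_left: "(c + d) *\<^sub>C x = c *\<^sub>C x + d *\<^sub>C x"
    and scaleC_scaleC: "c *\<^sub>C (d *\<^sub>C x) = (c * d) *\<^sub>C x"
    and scaleC_of_real: "complex_of_real r *\<^sub>C x = r *\<^sub>R x"
    and cinner_add_left: "cinner (x + y) z = cinner x z + cinner y z"
    and cinner_scaleC_left: "cinner (c *\<^sub>C x) y = c * cinner x y"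
    and cinner_commute: "cinner y x = cnj (cinner x y)"
    and Re_cinner: "Re (cinner x y) = x \<bullet> y"

lemma norm_scaleC: "norm (c *\<^sub>C x) = cmod c * norm (x::'a::complex_hilbert)"
proof -
  have "cinner (c *\<^sub>C x) (c *\<^sub>C x) = c * cnj c * cinner x x"
    by (metis cinner_commute cinner_scaleC_left complex_cnj_mult mult.assoc)
  also have "c * cnj c = complex_of_real ((cmod c)\<^sup>2)"
    by (metis complex_norm_square of_real_power)
  finally have "Re (cinner (c *\<^sub>C x) (c *\<^sub>C x)) = (cmod c)\<^sup>2 * Re (cinner x x)"
    by simp
  then show ?thesis
    by (simp add: norm_eq_sqrt_inner Re_cinner real_sqrt_mult)
qed

lemma bounded_linear_scaleC: "bounded_linear (\<lambda>x::'a::complex_hilbert. c *\<^sub>C x)"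
proof (rule bounded_linear_intro[where K = "cmod c"])
  show "c *\<^sub>C (r *\<^sub>R x) = r *\<^sub>R (c *\<^sub>C x)" for r and x :: 'a
    by (metis mult.commute scaleC_of_real scaleC_scaleC)
qed (simp_all add: scaleC_add_right norm_scaleC mult.commute)


(* The library's bounded linear operators are only real-linear. *)
type_synonym 'h op = "'h \<Rightarrow>\<^sub>L 'h"

definition bounded_operators :: "('h::complex_hilbert) op set" where
  "bounded_operators = {A. \<forall>c x. blinfun_apply A (c *\<^sub>C x) = c *\<^sub>C blinfun_apply A x}"

abbreviation op_id :: "('h::complex_hilbert) op" ("\<I>") where
  "\<I> \<equiv> id_blinfun"

lift_definition op_scaleC :: "complex \<Rightarrow> ('h::complex_hilbert) op \<Rightarrow> 'h op" (infixr "\<cdot>\<^sub>C" 75)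
  is "\<lambda>c A x. c *\<^sub>C A x"
  by (rule bounded_linear_compose[OF bounded_linear_scaleC])

definition op_adjoint :: "('h::complex_hilbert) op \<Rightarrow> 'h op" ("_\<^sup>\<dagger>" [1000] 999) where
  "A\<^sup>\<dagger> = (THE B. \<forall>x y. cinner (blinfun_apply A x) y = cinner x (blinfun_apply B y))"


subsection \<open>Continuous functional calculus and the operator modulus\<close>

definition op_poly :: "real poly \<Rightarrow> ('h::complex_hilbert) op \<Rightarrow> 'h op" where
  "op_poly q A = (\<Sum>i\<le>degree q. coeff q i *\<^sub>R (((o\<^sub>L) A) ^^ i) \<I>)"

definition op_spectrum :: "('h::complex_hilbert) op \<Rightarrow> complex set" where
  "op_spectrum A = {z. \<not> (\<exists>B\<in>bounded_operators.
     B o\<^sub>L (z \<cdot>\<^sub>C \<I> - A) = \<I> \<and> (z \<cdot>\<^sub>C \<I> - A) o\<^sub>L B = \<I>)}"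

(* For self-adjoint A the spectrum is a compact set of reals, and for f continuous on it, f(A) is
   the common norm limit of q_n(A), for all sequences of polynomials q_n converging to f
   uniformly on the spectrum. *)
definition op_fun :: "(real \<Rightarrow> real) \<Rightarrow> ('h::complex_hilbert) op \<Rightarrow> 'h op" where
  "op_fun f A = (THE B. \<forall>q.
     uniform_limit {t. complex_of_real t \<in> op_spectrum A} (\<lambda>n. poly (q n)) f sequentially
     \<longrightarrow> (\<lambda>n. op_poly (q n) A) \<longlonglongrightarrow> B)"

definition op_abs :: "('h::complex_hilbert) op \<Rightarrow> 'h op" where
  "op_abs A = op_fun sqrt (A\<^sup>\<dagger> o\<^sub>L A)"

definition op_powr :: "('h::complex_hilbert) op \<Rightarrow> real \<Rightarrow> 'h op" where
  "op_powr A p = op_fun (\<lambda>t. t powr p) A"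


subsection \<open>Von Neumann algebras\<close>

definition commutant :: "('h::complex_hilbert) op set \<Rightarrow> 'h op set" where
  "commutant S = {B \<in> bounded_operators. \<forall>A\<in>S. A o\<^sub>L B = B o\<^sub>L A}"

definition von_neumann_algebra :: "('h::complex_hilbert) op set \<Rightarrow> bool" where
  "von_neumann_algebra N \<longleftrightarrow>
     N \<subseteq> bounded_operators \<and> (\<forall>A\<in>N. A\<^sup>\<dagger> \<in> N) \<and> commutant (commutant N) = N"

definition factor :: "('h::complex_hilbert) op set \<Rightarrow> bool" where
  "factor N \<longleftrightarrow> von_neumann_algebra N \<and> (\<I> :: 'h op) \<noteq> 0 \<and>
     N \<inter> commutant N = {c \<cdot>\<^sub>C \<I> | c. True}"

definition unitaries :: "('h::complex_hilbert) op set \<Rightarrow> 'h op set" where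
  "unitaries N = {U \<in> N. U\<^sup>\<dagger> o\<^sub>L U = \<I> \<and> U o\<^sub>L U\<^sup>\<dagger> = \<I>}"

definition projections :: "('h::complex_hilbert) op set \<Rightarrow> 'h op set" where
  "projections N = {P \<in> N. P\<^sup>\<dagger> = P \<and> P o\<^sub>L P = P}"

definition mvn_equivalent ::
    "('h::complex_hilbert) op set \<Rightarrow> 'h op \<Rightarrow> 'h op \<Rightarrow> bool" where
  "mvn_equivalent N P Q \<longleftrightarrow> (\<exists>V\<in>N. V\<^sup>\<dagger> o\<^sub>L V = P \<and> V o\<^sub>L V\<^sup>\<dagger> = Q)"

(* For projections, Q is a subprojection of P iff P Q = Q. *)
definition finite_projection :: "('h::complex_hilbert) op set \<Rightarrow> 'h op \<Rightarrow> bool" where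
  "finite_projection N P \<longleftrightarrow> P \<in> projections N \<and>
     (\<forall>Q\<in>projections N. P o\<^sub>L Q = Q \<and> mvn_equivalent N P Q \<longrightarrow> Q = P)"

definition abelian_projection :: "('h::complex_hilbert) op set \<Rightarrow> 'h op \<Rightarrow> bool" where
  "abelian_projection N P \<longleftrightarrow> P \<in> projections N \<and>
     (\<forall>A\<in>N. \<forall>B\<in>N. (P o\<^sub>L A o\<^sub>L P) o\<^sub>L (P o\<^sub>L B o\<^sub>L P) = (P o\<^sub>L B o\<^sub>L P) o\<^sub>L (P o\<^sub>L A o\<^sub>L P))"

definition II1_factor :: "('h::complex_hilbert) op set \<Rightarrow> bool" where
  "II1_factor N \<longleftrightarrow> factor N \<and> finite_projection N \<I> \<and>
     (\<forall>P. abelian_projection N P \<longrightarrow> P = 0)"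

(* Neither faithfulness nor normality is required: both are automatic on a factor of type II_1. *)
definition tracial_state ::
    "('h::complex_hilbert) op set \<Rightarrow> ('h op \<Rightarrow> complex) \<Rightarrow> bool" where
  "tracial_state N \<tau> \<longleftrightarrow>
     (\<forall>A\<in>N. \<forall>B\<in>N. \<tau> (A + B) = \<tau> A + \<tau> B) \<and>
     (\<forall>c. \<forall>A\<in>N. \<tau> (c \<cdot>\<^sub>C A) = c * \<tau> A) \<and>
     (\<forall>A\<in>N. \<tau> (A\<^sup>\<dagger> o\<^sub>L A) \<in> \<real>\<^sub>\<ge>\<^sub>0) \<and>
     \<tau> \<I> = 1 \<and>
     (\<forall>A\<in>N. \<forall>B\<in>N. \<tau> (A o\<^sub>L B) = \<tau> (B o\<^sub>L A))"

(* The trace of a positive operator is a nonnegative real, so taking Re only changes the type. *)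
definition pnorm ::
    "(('h::complex_hilbert) op \<Rightarrow> complex) \<Rightarrow> real \<Rightarrow> 'h op \<Rightarrow> real" where
  "pnorm \<tau> p A = Re (\<tau> (op_powr (op_abs A) p)) powr (1 / p)"

end

theory Submission
  imports Defs "HOL-Computational_Algebra.Fundamental_Theorem_Algebra"
begin

text \<open>
  Write \<open>T = Re U\<close>, \<open>c = cos \<theta>\<close> and \<open>A = U - 2P + I\<close>, so that the \<open>p\<close>-th power of the norm
  is \<open>\<tau>((A\<^sup>\<dagger>A)\<^bsup>p/2\<^esup>)\<close>. If \<open>P\<close> commutes with \<open>U\<close>, then \<open>A\<^sup>\<dagger>A = (2 - 2T)P + (2 + 2T)(I - P)\<close>. Taking for \<open>P\<close>
  the spectral projections of \<open>g(T) - g(c)\<close>, where \<open>g(t) = (2 - 2t)\<^bsup>p/2\<^esup> - (2 + 2t)\<^bsup>p/2\<^esup>\<close> is strictly decreasing,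
  faithfulness of \<open>\<tau>\<close> forces \<open>g(T) = g(c)\<close> and hence \<open>T = c\<close>. So \<open>U = c + i s W\<close> with a symmetry \<open>W\<close> and
  \<open>s = sin \<theta>\<close>. If \<open>s \<noteq> 0\<close> and \<open>W \<noteq> \<plusminus>I\<close>, factoriality provides a nonzero projection \<open>E\<close> that is orthogonal
  to \<open>W E W\<close>; for \<open>P = E\<close> the spectrum of \<open>A\<^sup>\<dagger>A\<close> is contained in \<open>{0, 4, 2 + 2c}\<close>, and comparing traces gives
  \<open>4\<^bsup>p/2\<^esup> = (2 - 2c)\<^bsup>p/2\<^esup> + (2 + 2c)\<^bsup>p/2\<^esup>\<close>, which is impossible for \<open>p \<noteq> 2\<close>.

  Faithfulness of \<open>\<tau>\<close>: a nonzero projection of trace \<open>0\<close> would have infinitely many orthogonal equivalent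
  copies, along which a shift is a non-unitary isometry, contradicting finiteness of \<open>I\<close>.
\<close>

lemma subspace_orthogonal_projection:
  fixes M :: "'a::{real_inner,complete_space} set"
  assumes cl: "closed M" and sub: "subspace M"
  obtains m where "m \<in> M" "\<And>y. y \<in> M \<Longrightarrow> (x - m) \<bullet> y = 0"
proof -
  define D where "D = (INF y\<in>M. (norm (x - y))\<^sup>2)"
  have M0: "0 \<in> M" using sub by (rule subspace_0)
  have bdd: "bdd_below ((\<lambda>y. (norm (x - y))\<^sup>2) ` M)"
    by (rule bdd_belowI2[where m = 0]) simp
  have lower: "D \<le> (norm (x - y))\<^sup>2" if "y \<in> M" for y
    unfolding D_def using bdd that by (rule cINF_lower)
  have "\<exists>y\<in>M. (norm (x - y))\<^sup>2 < D + 1 / (real n + 1)" for n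
    using cINF_less_iff[of M "\<lambda>y. (norm (x - y))\<^sup>2" "D + 1 / (real n + 1)"] M0 bdd
    unfolding D_def by auto
  then obtain s where sM: "\<And>n. s n \<in> M"
    and sD: "\<And>n. (norm (x - s n))\<^sup>2 < D + 1 / (real n + 1)" by metis
  have close: "(norm (s m - s n))\<^sup>2 \<le> 4 / (real k + 1)" if "k \<le> m" "k \<le> n" for m n k
  proof -
    have "(1/2) *\<^sub>R (s m + s n) \<in> M"
      using sM sub by (simp add: subspace_add subspace_scale)
    then have "D \<le> (norm (x - (1/2) *\<^sub>R (s m + s n)))\<^sup>2" by (rule lower)
    moreover have "(norm (s m - s n))\<^sup>2 = 2 * (norm (x - s m))\<^sup>2 + 2 * (norm (x - s n))\<^sup>2
        - 4 * (norm (x - (1/2) *\<^sub>R (s m + s n)))\<^sup>2"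
    proof -
      define u v where "u = x - s m" and "v = x - s n"
      have uv: "s m - s n = v - u" "x - (1/2) *\<^sub>R (s m + s n) = (1/2) *\<^sub>R (u + v)"
        using scaleR_half_double[of x] by (simp_all add: u_def v_def scaleR_right_distrib scaleR_right_diff_distrib)
      have "(norm (v - u))\<^sup>2 = 2 * (norm u)\<^sup>2 + 2 * (norm v)\<^sup>2 - (norm (u + v))\<^sup>2"
        unfolding power2_norm_eq_inner by (simp add: inner_simps inner_commute)
      then show ?thesis
        unfolding uv by (simp add: power_mult_distrib power_divide flip: u_def v_def)
    qed
    moreover have "1 / (real m + 1) \<le> 1 / (real k + 1)" "1 / (real n + 1) \<le> 1 / (real k + 1)"
      using that by (auto intro!: divide_left_mono)
    ultimately show ?thesis using sD[of m] sD[of n] by linarith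
  qed
  have "Cauchy s"
  proof (rule metric_CauchyI)
    fix e :: real assume "0 < e"
    then obtain k :: nat where k: "4 / e\<^sup>2 < real k" using reals_Archimedean2 by blast
    have "4 / (real k + 1) < e\<^sup>2"
    proof -
      have "4 < real k * e\<^sup>2" using k \<open>0 < e\<close> by (simp add: pos_divide_less_eq)
      moreover have "0 < e\<^sup>2" using \<open>0 < e\<close> by simp
      ultimately have "4 < (real k + 1) * e\<^sup>2" unfolding distrib_right by linarith
      then show ?thesis by (simp add: pos_divide_less_eq mult.commute)
    qed
    then have "norm (s m - s n) < e" if "k \<le> m" "k \<le> n" for m n
      using order.strict_trans1[OF close[OF that]] \<open>0 < e\<close> power2_less_imp_less less_imp_le by blast
    then show "\<exists>K. \<forall>m\<ge>K. \<forall>n\<ge>K. dist (s m) (s n) < e" by (auto simp: dist_norm)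
  qed
  then obtain m where m: "s \<longlonglongrightarrow> m" using convergent_eq_Cauchy by blast
  have mM: "m \<in> M" using cl sM m closed_sequentially by blast
  have "(norm (x - m))\<^sup>2 \<le> D"
  proof (rule LIMSEQ_le)
    show "(\<lambda>n. (norm (x - s n))\<^sup>2) \<longlonglongrightarrow> (norm (x - m))\<^sup>2" by (intro tendsto_intros m)
    show "(\<lambda>n. D + 1 / (real n + 1)) \<longlonglongrightarrow> D"
      using LIMSEQ_inverse_real_of_nat_add[of D] by (simp add: inverse_eq_divide add.commute)
    show "\<exists>N. \<forall>n\<ge>N. (norm (x - s n))\<^sup>2 \<le> D + 1 / (real n + 1)" using sD less_imp_le by blast
  qed
  then have min: "(norm (x - m))\<^sup>2 \<le> (norm (x - y))\<^sup>2" if "y \<in> M" for y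
    using lower[OF that] by linarith
  have "(x - m) \<bullet> y = 0" if "y \<in> M" for y
  proof (cases "y = 0")
    case False
    define t where "t = ((x - m) \<bullet> y) / (y \<bullet> y)"
    have yy: "0 < y \<bullet> y" using False by simp
    have "m + t *\<^sub>R y \<in> M" using mM that sub by (simp add: subspace_add subspace_scale)
    from min[OF this] have "0 \<le> t * (t * (y \<bullet> y)) - 2 * (t * ((x - m) \<bullet> y))"
      unfolding power2_norm_eq_inner by (simp add: inner_simps inner_commute algebra_simps)
    also have "\<dots> = - (((x - m) \<bullet> y)\<^sup>2 / (y \<bullet> y))"
      using yy by (simp add: t_def power2_eq_square)
    finally show ?thesis using yy by (smt (verit) divide_pos_pos zero_less_power2)
  qed simp
  with mM that show ?thesis by blast
qed

lemma riesz_representation: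
  fixes f :: "'a::{real_inner,complete_space} \<Rightarrow> real"
  assumes f: "bounded_linear f"
  obtains z where "\<And>x. f x = x \<bullet> z"
proof (cases "\<forall>x. f x = 0")
  case True
  then show ?thesis using that[of 0] by simp
next
  case False
  interpret bounded_linear f by (rule f)
  define M where "M = {x. f x = 0}"
  have "closed M"
    unfolding M_def by (intro closed_Collect_eq continuous_intros linear_continuous_on f)
  moreover have "subspace M" unfolding M_def by (auto simp: subspace_def add scaleR)
  moreover obtain x0 where x0: "f x0 \<noteq> 0" using False by blast
  ultimately obtain m where m: "m \<in> M" "\<And>y. y \<in> M \<Longrightarrow> (x0 - m) \<bullet> y = 0"
    using subspace_orthogonal_projection by metis
  define u where "u = x0 - m"
  have fu: "f u \<noteq> 0" using x0 m(1) by (simp add: u_def M_def diff)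
  then have uu: "u \<bullet> u \<noteq> 0" using zero by auto
  have "f x = x \<bullet> ((f u / (u \<bullet> u)) *\<^sub>R u)" for x
  proof -
    have "x - (f x / f u) *\<^sub>R u \<in> M" using fu by (simp add: M_def diff scaleR)
    from m(2)[OF this] have "u \<bullet> x = (f x / f u) * (u \<bullet> u)"
      by (simp add: u_def inner_diff_right)
    then show ?thesis using fu uu by (simp add: inner_commute)
  qed
  then show ?thesis using that by blast
qed

subsection \<open>Adjoints\<close>

lemma cinner_eq_inner: "cinner x y = Complex (x \<bullet> y) (- ((\<i> *\<^sub>C x) \<bullet> y))"
  for x y :: "'h::complex_hilbert"
  by (rule complex_eqI) (simp_all add: Re_cinner[symmetric] cinner_scaleC_left)

lemma bounded_operatorsD: "A \<in> bounded_operators \<Longrightarrow> A (c *\<^sub>C x) = c *\<^sub>C A x"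
  by (simp add: bounded_operators_def)

lemma bounded_operatorsI: "(\<And>c x. blinfun_apply A (c *\<^sub>C x) = c *\<^sub>C A x) \<Longrightarrow> A \<in> bounded_operators"
  by (simp add: bounded_operators_def)

lemma scaleC_scaleR_commute: "c *\<^sub>C (r *\<^sub>R x) = r *\<^sub>R (c *\<^sub>C (x::'h::complex_hilbert))"
  by (metis mult.commute scaleC_of_real scaleC_scaleC)

lemma scaleC_minus_right: "c *\<^sub>C (- x) = - (c *\<^sub>C (x::'h::complex_hilbert))"
  by (rule linear_simps(4)[OF bounded_linear_scaleC])

lemma scaleC_diff_right: "c *\<^sub>C (x - y) = c *\<^sub>C x - c *\<^sub>C (y::'h::complex_hilbert)"
  by (rule linear_simps(2)[OF bounded_linear_scaleC])

lemma scaleC_zero_right: "c *\<^sub>C 0 = (0::'h::complex_hilbert)"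
  by (rule linear_simps(3)[OF bounded_linear_scaleC])

lemma scaleC_diff_left: "(c - d) *\<^sub>C x = c *\<^sub>C x - d *\<^sub>C (x::'h::complex_hilbert)"
  by (metis add_diff_cancel_right' diff_add_cancel scaleC_add_left)

lemma scaleC_minus_left: "(- c) *\<^sub>C x = - (c *\<^sub>C (x::'h::complex_hilbert))"
  using scaleC_diff_left[of 0 c x] scaleC_of_real[of 0 x] by simp

lemma scaleC_one: "1 *\<^sub>C x = (x::'h::complex_hilbert)"
  using scaleC_of_real[of 1 x] by simp

lemma inner_scaleC_left: "(c *\<^sub>C x) \<bullet> y = x \<bullet> (cnj c *\<^sub>C (y::'h::complex_hilbert))"
proof -
  have "cinner (c *\<^sub>C x) y = cinner x (cnj c *\<^sub>C y)"
    by (metis cinner_commute cinner_scaleC_left complex_cnj_cnj complex_cnj_mult)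
  then show ?thesis by (metis Re_cinner)
qed

lemma cinner_adjoint_iff:
  fixes A B :: "('h::complex_hilbert) op"
  assumes "A \<in> bounded_operators"
  shows "(\<forall>x y. cinner (A x) y = cinner x (B y)) \<longleftrightarrow> (\<forall>x y. A x \<bullet> y = x \<bullet> B y)"
proof
  assume "\<forall>x y. cinner (A x) y = cinner x (B y)"
  then show "\<forall>x y. A x \<bullet> y = x \<bullet> B y" by (metis Re_cinner)
next
  assume *: "\<forall>x y. A x \<bullet> y = x \<bullet> B y"
  then have "(\<i> *\<^sub>C A x) \<bullet> y = (\<i> *\<^sub>C x) \<bullet> B y" for x y
    by (metis assms bounded_operatorsD)
  with * show "\<forall>x y. cinner (A x) y = cinner x (B y)" by (simp add: cinner_eq_inner)
qed

lemma vector_eqI: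
  fixes u v :: "'a::real_inner"
  assumes "\<And>x. x \<bullet> u = x \<bullet> v"
  shows "u = v"
  using assms[of "u - v"] by (metis inner_diff_right inner_eq_zero_iff right_minus_eq)

lemma real_adjoint_unique:
  fixes B B' :: "('a::real_inner) \<Rightarrow>\<^sub>L 'a"
  assumes "\<And>x y. x \<bullet> B y = x \<bullet> B' y"
  shows "B = B'"
  by (rule blinfun_eqI, rule vector_eqI) (rule assms)

lemma real_adjoint_exists:
  fixes A :: "('a::{real_inner,complete_space}) \<Rightarrow>\<^sub>L 'a"
  obtains B :: "'a \<Rightarrow>\<^sub>L 'a" where "\<And>x y. A x \<bullet> y = x \<bullet> B y"
proof -
  have "\<exists>z. \<forall>x. A x \<bullet> y = x \<bullet> z" for y
    by (rule riesz_representation[of "\<lambda>x. A x \<bullet> y"])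
      (auto intro!: bounded_linear_inner_left_comp blinfun.bounded_linear_right)
  then obtain g where g: "\<And>x y. A x \<bullet> y = x \<bullet> g y" by metis
  have "bounded_linear g"
  proof (rule bounded_linear_intro[where K = "norm A"])
    show "g (x + y) = g x + g y" for x y
      by (rule vector_eqI) (simp add: g[symmetric] inner_add_right)
    show "g (r *\<^sub>R x) = r *\<^sub>R g x" for r x
      by (rule vector_eqI) (simp add: g[symmetric])
    show "norm (g x) \<le> norm x * norm A" for x
    proof (cases "g x = 0")
      case False
      have "norm (g x) * norm (g x) = A (g x) \<bullet> x"
        by (simp add: g power2_norm_eq_inner[symmetric] power2_eq_square[symmetric])
      also have "\<dots> \<le> norm (A (g x)) * norm x" by (rule norm_cauchy_schwarz)
      also have "\<dots> \<le> norm A * norm (g x) * norm x"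
        by (intro mult_right_mono norm_blinfun) simp
      finally show ?thesis using False by (simp add: mult.assoc mult.commute mult.left_commute)
    qed simp
  qed
  then have "\<And>x y. A x \<bullet> y = x \<bullet> Blinfun g y" by (simp add: bounded_linear_Blinfun_apply g)
  then show ?thesis using that by blast
qed

lemma adjoint_eqI:
  fixes A B :: "('h::complex_hilbert) op"
  assumes A: "A \<in> bounded_operators" and B: "\<And>x y. A x \<bullet> y = x \<bullet> B y"
  shows "A\<^sup>\<dagger> = B"
  unfolding op_adjoint_def
proof (rule the_equality)
  show "\<forall>x y. cinner (A x) y = cinner x (B y)" using cinner_adjoint_iff[OF A] B by blast
  fix C :: "'h op" assume "\<forall>x y. cinner (A x) y = cinner x (C y)"
  then have "\<And>x y. A x \<bullet> y = x \<bullet> C y" using cinner_adjoint_iff[OF A] by blast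
  then show "C = B" by (intro real_adjoint_unique) (metis B)
qed

lemma adjoint_inner:
  fixes A :: "('h::complex_hilbert) op"
  assumes "A \<in> bounded_operators"
  shows "A x \<bullet> y = x \<bullet> (A\<^sup>\<dagger>) y"
  by (metis adjoint_eqI[OF assms] real_adjoint_exists)

lemma adjoint_inner':
  fixes A :: "('h::complex_hilbert) op"
  assumes "A \<in> bounded_operators"
  shows "(A\<^sup>\<dagger>) x \<bullet> y = x \<bullet> A y"
  by (metis adjoint_inner[OF assms] inner_commute)

lemma adjoint_bounded_operators:
  fixes A :: "('h::complex_hilbert) op"
  assumes "A \<in> bounded_operators"
  shows "A\<^sup>\<dagger> \<in> bounded_operators"
proof (rule bounded_operatorsI, rule vector_eqI)
  fix c :: complex and x z :: 'h
  have "z \<bullet> (A\<^sup>\<dagger>) (c *\<^sub>C x) = A (cnj c *\<^sub>C z) \<bullet> x"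
    by (simp add: adjoint_inner[OF assms, symmetric] bounded_operatorsD[OF assms] inner_scaleC_left)
  also have "\<dots> = z \<bullet> c *\<^sub>C (A\<^sup>\<dagger>) x"
    by (simp add: adjoint_inner[OF assms] inner_scaleC_left)
  finally show "z \<bullet> (A\<^sup>\<dagger>) (c *\<^sub>C x) = z \<bullet> c *\<^sub>C (A\<^sup>\<dagger>) x" .
qed

lemma bounded_operators_binary:
  fixes A B :: "('h::complex_hilbert) op"
  assumes A: "A \<in> bounded_operators" and B: "B \<in> bounded_operators"
  shows "A + B \<in> bounded_operators" "A - B \<in> bounded_operators" "A o\<^sub>L B \<in> bounded_operators"
proof -
  note d = bounded_operatorsD[OF A] bounded_operatorsD[OF B]
  show "A + B \<in> bounded_operators"
    by (rule bounded_operatorsI) (simp only: blinfun.add_left d scaleC_add_right)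
  show "A - B \<in> bounded_operators"
    by (rule bounded_operatorsI) (simp only: blinfun.diff_left d scaleC_diff_right)
  show "A o\<^sub>L B \<in> bounded_operators"
    by (rule bounded_operatorsI) (simp only: blinfun_apply_blinfun_compose d)
qed

lemma bounded_operators_unary:
  fixes A :: "('h::complex_hilbert) op"
  assumes A: "A \<in> bounded_operators"
  shows "- A \<in> bounded_operators" "c \<cdot>\<^sub>C A \<in> bounded_operators" "r *\<^sub>R A \<in> bounded_operators"
proof -
  note d = bounded_operatorsD[OF A]
  show "- A \<in> bounded_operators"
    by (rule bounded_operatorsI) (simp only: blinfun.minus_left d scaleC_minus_right)
  show "c \<cdot>\<^sub>C A \<in> bounded_operators"
    by (rule bounded_operatorsI) (simp only: op_scaleC.rep_eq d scaleC_scaleC mult.commute)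
  show "r *\<^sub>R A \<in> bounded_operators"
    by (rule bounded_operatorsI) (simp only: blinfun.scaleR_left d scaleC_scaleR_commute)
qed

lemma bounded_operators_id [simp]: "\<I> \<in> bounded_operators"
  and bounded_operators_zero [simp]: "0 \<in> bounded_operators"
  by (simp_all add: bounded_operators_def scaleC_zero_right)

lemma adjoint_binary:
  fixes A B :: "('h::complex_hilbert) op"
  assumes A: "A \<in> bounded_operators" and B: "B \<in> bounded_operators"
  shows "(A + B)\<^sup>\<dagger> = A\<^sup>\<dagger> + B\<^sup>\<dagger>" "(A - B)\<^sup>\<dagger> = A\<^sup>\<dagger> - B\<^sup>\<dagger>" "(A o\<^sub>L B)\<^sup>\<dagger> = B\<^sup>\<dagger> o\<^sub>L A\<^sup>\<dagger>"
proof -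
  note i = adjoint_inner[OF A] adjoint_inner[OF B]
  note m = bounded_operators_binary[OF A B]
  show "(A + B)\<^sup>\<dagger> = A\<^sup>\<dagger> + B\<^sup>\<dagger>"
    by (rule adjoint_eqI[OF m(1)]) (simp add: blinfun.add_left inner_add_left inner_add_right i)
  show "(A - B)\<^sup>\<dagger> = A\<^sup>\<dagger> - B\<^sup>\<dagger>"
    by (rule adjoint_eqI[OF m(2)]) (simp add: blinfun.diff_left inner_diff_left inner_diff_right i)
  show "(A o\<^sub>L B)\<^sup>\<dagger> = B\<^sup>\<dagger> o\<^sub>L A\<^sup>\<dagger>" by (rule adjoint_eqI[OF m(3)]) (simp add: i)
qed

lemma adjoint_unary:
  fixes A :: "('h::complex_hilbert) op"
  assumes A: "A \<in> bounded_operators"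
  shows "(- A)\<^sup>\<dagger> = - (A\<^sup>\<dagger>)" "(c \<cdot>\<^sub>C A)\<^sup>\<dagger> = cnj c \<cdot>\<^sub>C A\<^sup>\<dagger>" "(r *\<^sub>R A)\<^sup>\<dagger> = r *\<^sub>R A\<^sup>\<dagger>" "(A\<^sup>\<dagger>)\<^sup>\<dagger> = A"
proof -
  note i = adjoint_inner[OF A] adjoint_inner'[OF A]
  note m = bounded_operators_unary[OF A] adjoint_bounded_operators[OF A]
  show "(- A)\<^sup>\<dagger> = - (A\<^sup>\<dagger>)" by (rule adjoint_eqI[OF m(1)]) (simp add: blinfun.minus_left i)
  show "(c \<cdot>\<^sub>C A)\<^sup>\<dagger> = cnj c \<cdot>\<^sub>C A\<^sup>\<dagger>"
    by (rule adjoint_eqI[OF m(2)])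
      (simp add: op_scaleC.rep_eq inner_scaleC_left i bounded_operatorsD[OF m(4)])
  show "(r *\<^sub>R A)\<^sup>\<dagger> = r *\<^sub>R A\<^sup>\<dagger>" by (rule adjoint_eqI[OF m(3)]) (simp add: blinfun.scaleR_left i)
  show "(A\<^sup>\<dagger>)\<^sup>\<dagger> = A" by (rule adjoint_eqI[OF m(4)]) (simp add: i)
qed

lemma adjoint_id [simp]: "(\<I> :: ('h::complex_hilbert) op)\<^sup>\<dagger> = \<I>"
  and adjoint_zero [simp]: "(0 :: ('h::complex_hilbert) op)\<^sup>\<dagger> = 0"
  by (rule adjoint_eqI; simp)+

instance complex_hilbert \<subseteq> banach ..

subsection \<open>Polynomials in an operator\<close>

lemmas op_expand = blinfun.add_left blinfun.diff_left blinfun.minus_left blinfun.scaleR_left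
  blinfun.add_right blinfun.diff_right blinfun.minus_right blinfun.scaleR_right blinfun.zero_left
  blinfun.zero_right blinfun_apply_blinfun_compose blinfun_apply_id_blinfun op_scaleC.rep_eq

lemma op_poly_0 [simp]: "op_poly 0 A = 0"
  by (simp add: op_poly_def)

lemma op_poly_pCons: "op_poly (pCons a q) A = a *\<^sub>R \<I> + (A o\<^sub>L op_poly q A)"
proof (cases "q = 0")
  case True
  then show ?thesis by (simp add: op_poly_def coeff_pCons)
next
  case False
  have "op_poly (pCons a q) A = (\<Sum>i\<le>Suc (degree q). coeff (pCons a q) i *\<^sub>R (((o\<^sub>L) A) ^^ i) \<I>)"
    using False by (simp add: op_poly_def)
  also have "\<dots> = a *\<^sub>R \<I> + (\<Sum>i\<le>degree q. coeff q i *\<^sub>R (A o\<^sub>L (((o\<^sub>L) A) ^^ i) \<I>))"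
    by (simp add: sum.atMost_Suc_shift del: sum.atMost_Suc)
  also have "(\<Sum>i\<le>degree q. coeff q i *\<^sub>R (A o\<^sub>L (((o\<^sub>L) A) ^^ i) \<I>)) = A o\<^sub>L op_poly q A"
    unfolding op_poly_def
    by (simp only: bounded_bilinear.sum_right[OF bounded_bilinear_blinfun_compose]
        bounded_bilinear.scaleR_right[OF bounded_bilinear_blinfun_compose])
  finally show ?thesis .
qed

lemma op_poly_const [simp]: "op_poly [:c:] A = c *\<^sub>R \<I>"
  by (simp add: op_poly_pCons)

lemma op_poly_linear: "op_poly [:c, d:] A = c *\<^sub>R \<I> + d *\<^sub>R A"
  by (rule blinfun_eqI) (simp add: op_poly_pCons op_expand)

lemma op_poly_add: "op_poly (p + q) A = op_poly p A + op_poly q A"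
proof (induction p q rule: poly_induct2)
  case (pCons a p b q)
  show ?case by (rule blinfun_eqI) (simp add: op_poly_pCons pCons op_expand algebra_simps)
qed simp

lemma op_poly_smult: "op_poly (smult c q) A = c *\<^sub>R op_poly q A"
proof (induction q)
  case (pCons a q)
  show ?case by (rule blinfun_eqI) (simp add: op_poly_pCons pCons op_expand algebra_simps)
qed simp

lemma op_poly_diff: "op_poly (p - q) A = op_poly p A - op_poly q A"
  using op_poly_add[of "p - q" q A] by (simp add: algebra_simps)

lemma op_poly_mult: "op_poly (p * q) A = op_poly p A o\<^sub>L op_poly q A"
proof (induction p)
  case (pCons a p)
  show ?case
    by (rule blinfun_eqI) (simp add: op_poly_pCons op_poly_add op_poly_smult pCons op_expand)
qed simp

lemma op_poly_intertwine:
  assumes "A o\<^sub>L X = X o\<^sub>L B"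
  shows "op_poly q A o\<^sub>L X = X o\<^sub>L op_poly q B"
proof (induction q)
  case (pCons a q)
  have 1: "op_poly q A (X x) = X (op_poly q B x)" for x
    using arg_cong[OF pCons(2), of "\<lambda>T. blinfun_apply T x"] by simp
  have 2: "A (X x) = X (B x)" for x
    using arg_cong[OF assms, of "\<lambda>T. blinfun_apply T x"] by simp
  show ?case by (rule blinfun_eqI) (simp add: op_poly_pCons op_expand 1 2)
qed simp

lemma op_poly_bounded_operators:
  assumes "A \<in> bounded_operators"
  shows "op_poly q A \<in> bounded_operators"
proof (induction q)
  case (pCons a q)
  show ?case unfolding op_poly_pCons
    by (intro bounded_operators_binary(1,3) bounded_operators_unary(3) assms pCons bounded_operators_id)
qed simp

definition selfadj :: "('h::complex_hilbert) op \<Rightarrow> bool" where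
  "selfadj A \<longleftrightarrow> A \<in> bounded_operators \<and> A\<^sup>\<dagger> = A"

lemma selfadjI:
  assumes "A \<in> bounded_operators" "\<And>x y. A x \<bullet> y = x \<bullet> A y"
  shows "selfadj A"
  using assms by (simp add: selfadj_def adjoint_eqI)

lemma selfadj_bounded: "selfadj A \<Longrightarrow> A \<in> bounded_operators"
  by (simp add: selfadj_def)

lemma selfadj_inner: "selfadj A \<Longrightarrow> A x \<bullet> y = x \<bullet> A y"
  by (metis adjoint_inner selfadj_def)

lemma op_poly_selfadj:
  assumes A: "selfadj A"
  shows "selfadj (op_poly q A)"
proof (rule selfadjI)
  show "op_poly q A \<in> bounded_operators"
    using A by (intro op_poly_bounded_operators selfadj_bounded)
  show "op_poly q A x \<bullet> y = x \<bullet> op_poly q A y" for x y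
  proof (induction q arbitrary: x y)
    case (pCons a q)
    have "op_poly q A (A y) = A (op_poly q A y)"
      using arg_cong[OF op_poly_intertwine[of A A A q], of "\<lambda>T. blinfun_apply T y"] by simp
    then show ?case
      by (simp add: op_poly_pCons op_expand inner_add_left inner_add_right selfadj_inner[OF A] pCons)
  qed simp
qed

definition op_cpoly :: "complex poly \<Rightarrow> ('h::complex_hilbert) op \<Rightarrow> 'h op" where
  "op_cpoly q A = fold_coeffs (\<lambda>a B. a \<cdot>\<^sub>C \<I> + (A o\<^sub>L B)) q 0"

lemma op_cpoly_0 [simp]: "op_cpoly 0 A = 0"
  by (simp add: op_cpoly_def)

lemma op_scaleC_0 [simp]: "0 \<cdot>\<^sub>C A = 0"
  using scaleC_of_real[of 0] by (intro blinfun_eqI) (simp add: op_scaleC.rep_eq)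

lemma op_cpoly_pCons: "op_cpoly (pCons a q) A = a \<cdot>\<^sub>C \<I> + (A o\<^sub>L op_cpoly q A)"
  by (cases "a = 0 \<and> q = 0") (auto simp: op_cpoly_def)

lemma op_cpoly_add: "op_cpoly (p + q) A = op_cpoly p A + op_cpoly q A"
proof (induction p q rule: poly_induct2)
  case (pCons a p b q)
  show ?case
    by (rule blinfun_eqI) (simp add: op_cpoly_pCons pCons op_expand scaleC_add_left algebra_simps)
qed simp

lemma op_cpoly_smult:
  assumes A: "A \<in> bounded_operators"
  shows "op_cpoly (smult c q) A = c \<cdot>\<^sub>C op_cpoly q A"
proof (induction q)
  case 0
  show ?case by (rule blinfun_eqI) (simp add: op_expand scaleC_zero_right)
next
  case (pCons a q)
  show ?case
    by (rule blinfun_eqI)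
      (simp add: op_cpoly_pCons pCons op_expand scaleC_add_right scaleC_scaleC bounded_operatorsD[OF A])
qed

lemma op_cpoly_linear_mult:
  assumes A: "A \<in> bounded_operators"
  shows "op_cpoly ([:- z, 1:] * s) A = (A - z \<cdot>\<^sub>C \<I>) o\<^sub>L op_cpoly s A"
proof (rule blinfun_eqI)
  fix x
  have eq: "[:- z, 1:] * s = smult (- z) s + pCons 0 s" by simp
  show "op_cpoly ([:- z, 1:] * s) A x = ((A - z \<cdot>\<^sub>C \<I>) o\<^sub>L op_cpoly s A) x"
    unfolding eq by (simp only: op_cpoly_add op_cpoly_smult[OF A] op_cpoly_pCons) (simp add: op_expand scaleC_minus_left)
qed

lemma op_cpoly_of_real: "op_cpoly (map_poly complex_of_real q) A = op_poly q A"
proof (induction q)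
  case (pCons a q)
  show ?case
    by (rule blinfun_eqI) (simp add: map_poly_pCons op_cpoly_pCons op_poly_pCons pCons op_expand scaleC_of_real)
qed simp

lemma poly_map_of_real: "poly (map_poly complex_of_real q) (of_real x) = of_real (poly q x)"
  by (induction q) (auto simp: map_poly_pCons)

subsection \<open>The norm of a polynomial in a self-adjoint operator\<close>

definition bounded_below :: "('a::real_normed_vector \<Rightarrow>\<^sub>L 'a) \<Rightarrow> bool" where
  "bounded_below T \<longleftrightarrow> (\<exists>d>0. \<forall>x. d * norm x \<le> norm (T x))"

lemma bounded_below_compose:
  assumes "bounded_below S" "bounded_below T"
  shows "bounded_below (S o\<^sub>L T)"
proof -
  obtain c d where c: "c > 0" "\<And>x. c * norm x \<le> norm (S x)"
    and d: "d > 0" "\<And>x. d * norm x \<le> norm (T x)"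
    using assms unfolding bounded_below_def by blast
  have "(c * d) * norm x \<le> norm ((S o\<^sub>L T) x)" for x
    using order_trans[OF mult_left_mono[OF d(2)[of x]] c(2)[of "T x"]] c(1) by (simp add: mult.assoc)
  then show ?thesis using c(1) d(1) unfolding bounded_below_def by (meson mult_pos_pos)
qed

lemma op_cpoly_root_not_bounded_below:
  assumes A: "A \<in> bounded_operators" and "r \<noteq> 0" "\<not> bounded_below (op_cpoly r A)"
  shows "\<exists>z. poly r z = 0 \<and> \<not> bounded_below (A - z \<cdot>\<^sub>C \<I>)"
  using assms(2,3)
proof (induction "degree r" arbitrary: r rule: less_induct)
  case less
  show ?case
  proof (cases "constant (poly r)")
    case True
    then obtain c where c: "r = [:c:]" using constant_degree degree_eq_zeroE by metis
    then have "c \<noteq> 0" using less.prems by auto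
    moreover have "op_cpoly r A = c \<cdot>\<^sub>C \<I>" by (simp add: c op_cpoly_pCons)
    ultimately have "bounded_below (op_cpoly r A)"
      unfolding bounded_below_def by (intro exI[of _ "cmod c"]) (simp add: op_expand norm_scaleC)
    then show ?thesis using less.prems by blast
  next
    case False
    then obtain z where z: "poly r z = 0" using fundamental_theorem_of_algebra by blast
    then obtain s where s: "r = [:- z, 1:] * s" unfolding poly_eq_0_iff_dvd by (rule dvdE)
    then have s0: "s \<noteq> 0" using less.prems by auto
    then have deg: "degree s < degree r" unfolding s by (subst degree_mult_eq) auto
    show ?thesis
    proof (cases "bounded_below (A - z \<cdot>\<^sub>C \<I>)")
      case True
      have "\<not> bounded_below (op_cpoly s A)"
        using less.prems(2) bounded_below_compose[OF True] unfolding s op_cpoly_linear_mult[OF A] by blast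
      then obtain w where "poly s w = 0" "\<not> bounded_below (A - w \<cdot>\<^sub>C \<I>)"
        using less.hyps[OF deg s0] by blast
      then show ?thesis unfolding s by (intro exI[of _ w]) simp
    qed (use z in blast)
  qed
qed

lemma selfadj_nonreal_bounded_below:
  assumes A: "selfadj A" and z: "Im z \<noteq> 0"
  shows "bounded_below (A - z \<cdot>\<^sub>C \<I>)"
  unfolding bounded_below_def
proof (intro exI conjI allI)
  show "0 < \<bar>Im z\<bar>" using z by simp
  fix x
  define u where "u = A x - Re z *\<^sub>R x"
  define w where "w = (\<i> * Im z) *\<^sub>C x"
  have zx: "(A - z \<cdot>\<^sub>C \<I>) x = u - w"
  proof -
    have "z *\<^sub>C x = complex_of_real (Re z) *\<^sub>C x + w"
      unfolding w_def scaleC_add_left[symmetric] by (simp add: complex_eq[symmetric])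
    then show ?thesis by (simp add: op_expand u_def scaleC_of_real)
  qed
  have nw: "norm w = \<bar>Im z\<bar> * norm x" unfolding w_def norm_scaleC by (simp add: norm_mult)
  have Aw: "A w = (\<i> * Im z) *\<^sub>C A x"
    unfolding w_def by (rule bounded_operatorsD[OF selfadj_bounded[OF A]])
  have s: "((\<i> * Im z) *\<^sub>C y) \<bullet> y = 0" for y :: 'a
    using inner_scaleC_left[of "\<i> * Im z" y y] Re_cinner[of "(\<i> * Im z) *\<^sub>C y" y]
      cinner_scaleC_left[of "\<i> * Im z" y y] cinner_commute[of y y]
    by (simp add: complex_eq_iff)
  have "u \<bullet> w = 0"
  proof -
    have "A x \<bullet> w = x \<bullet> A w" by (rule selfadj_inner[OF A])
    also have "\<dots> = A w \<bullet> x" by (rule inner_commute)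
    also have "\<dots> = A x \<bullet> (cnj (\<i> * Im z) *\<^sub>C x)" unfolding Aw by (rule inner_scaleC_left)
    also have "cnj (\<i> * Im z) *\<^sub>C x = - w"
      unfolding w_def by (simp add: scaleC_minus_left)
    finally have "A x \<bullet> w = 0" by simp
    moreover have "x \<bullet> w = 0" using s[of x] by (simp add: w_def inner_commute)
    ultimately show ?thesis by (simp add: u_def inner_diff_left)
  qed
  then have "(norm (u - w))\<^sup>2 = (norm u)\<^sup>2 + (norm w)\<^sup>2"
    unfolding power2_norm_eq_inner by (simp add: inner_diff_left inner_diff_right inner_commute)
  then have "(norm w)\<^sup>2 \<le> (norm (u - w))\<^sup>2" by simp
  then have "norm w \<le> norm (u - w)" by (rule power2_le_imp_le) simp
  then show "\<bar>Im z\<bar> * norm x \<le> norm ((A - z \<cdot>\<^sub>C \<I>) x)" unfolding zx nw .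
qed

lemma invertible_bounded_below:
  assumes "B o\<^sub>L T = id_blinfun"
  shows "bounded_below T"
  unfolding bounded_below_def
proof (intro exI conjI allI)
  have p: "0 < norm B + 1" by (simp add: add_nonneg_pos)
  then show "0 < 1 / (norm B + 1)" by simp
  fix x
  have "norm x = norm (B (T x))"
    using arg_cong[OF assms, of "\<lambda>S. blinfun_apply S x"] by simp
  also have "\<dots> \<le> norm B * norm (T x)" by (rule norm_blinfun)
  also have "\<dots> \<le> (norm B + 1) * norm (T x)" by (simp add: mult_right_mono)
  finally show "1 / (norm B + 1) * norm x \<le> norm (T x)" using p by (simp add: field_simps)
qed

lemma not_bounded_below_spectrum:
  assumes "\<not> bounded_below (A - z \<cdot>\<^sub>C \<I>)"
  shows "z \<in> op_spectrum A"
proof -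
  have "bounded_below (A - z \<cdot>\<^sub>C \<I>)" if "B o\<^sub>L (z \<cdot>\<^sub>C \<I> - A) = \<I>" for B
  proof (rule invertible_bounded_below[of "- B"], rule blinfun_eqI)
    show "(- B o\<^sub>L (A - z \<cdot>\<^sub>C \<I>)) x = \<I> x" for x
      using arg_cong[OF that, of "\<lambda>S. blinfun_apply S x"] by (simp add: op_expand)
  qed
  then show ?thesis using assms unfolding op_spectrum_def by blast
qed

lemma selfadj_norm_square_not_bounded_below:
  assumes S: "selfadj S" and v: "(v :: 'h::complex_hilbert) \<noteq> 0"
  shows "\<not> bounded_below ((S o\<^sub>L S) - (norm S)\<^sup>2 *\<^sub>R (\<I> :: 'h op))"
proof
  define L where "L = norm S"
  assume "bounded_below ((S o\<^sub>L S) - (norm S)\<^sup>2 *\<^sub>R \<I>)"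
  then obtain d where d: "d > 0" "\<And>x. d * norm x \<le> norm (S (S x) - L\<^sup>2 *\<^sub>R x)"
    unfolding bounded_below_def L_def by (auto simp: op_expand)
  have L0: "0 < L"
  proof (rule ccontr)
    assume "\<not> 0 < L"
    then have "S = 0" by (simp add: L_def)
    then show False using d v d(2)[of v] by (simp add: L_def mult_le_0_iff)
  qed
  have bound: "d\<^sup>2 * (norm x)\<^sup>2 \<le> L\<^sup>2 * (L\<^sup>2 * (norm x)\<^sup>2 - (norm (S x))\<^sup>2)" for x
  proof -
    have e: "S (S x) \<bullet> x = S x \<bullet> S x" by (rule selfadj_inner[OF S])
    have "(norm (S (S x)))\<^sup>2 \<le> (L * norm (S x))\<^sup>2"
      unfolding L_def by (intro power_mono norm_blinfun norm_ge_zero)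
    moreover have "(norm (S (S x) - L\<^sup>2 *\<^sub>R x))\<^sup>2
        = (norm (S (S x)))\<^sup>2 - 2 * (L\<^sup>2 * (norm (S x))\<^sup>2) + L\<^sup>2 * L\<^sup>2 * (norm x)\<^sup>2"
      unfolding power2_norm_eq_inner using e
      by (simp add: inner_diff_left inner_diff_right inner_commute algebra_simps)
    moreover have "(d * norm x)\<^sup>2 \<le> (norm (S (S x) - L\<^sup>2 *\<^sub>R x))\<^sup>2"
      using d by (intro power_mono) auto
    ultimately show ?thesis by (simp add: power_mult_distrib algebra_simps)
  qed
  define c where "c = L\<^sup>2 - d\<^sup>2 / L\<^sup>2"
  have Sc: "(norm (S x))\<^sup>2 \<le> c * (norm x)\<^sup>2" for x
  proof -
    have "L\<^sup>2 * (norm (S x))\<^sup>2 \<le> L\<^sup>2 * (c * (norm x)\<^sup>2)"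
      using bound[of x] L0 by (simp add: c_def algebra_simps)
    then show ?thesis using L0 by simp
  qed
  have c0: "0 \<le> c"
  proof -
    have "0 \<le> c * (norm v)\<^sup>2" using Sc[of v] by (meson order_trans zero_le_power2)
    then show ?thesis using v by (simp add: zero_le_mult_iff)
  qed
  have "norm S \<le> sqrt c"
  proof (rule norm_blinfun_bound)
    show "norm (S x) \<le> sqrt c * norm x" for x
      using real_sqrt_le_mono[OF Sc[of x]] by (simp add: real_sqrt_mult)
  qed (use c0 in simp)
  then have "L\<^sup>2 \<le> c" using c0 L0 by (metis L_def norm_ge_zero power_mono real_sqrt_pow2)
  moreover have "0 < d\<^sup>2 / L\<^sup>2" using d(1) L0 by (intro divide_pos_pos zero_less_power)
  ultimately show False unfolding c_def by linarith
qed

lemma selfadj_op_poly_root_in_spectrum: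
  assumes A: "selfadj A" and r: "r \<noteq> 0" "\<not> bounded_below (op_poly r A)"
  obtains t where "complex_of_real t \<in> op_spectrum A" "poly r t = 0"
proof -
  have "map_poly complex_of_real r \<noteq> 0" using r(1) by (simp add: map_poly_eq_0_iff)
  then obtain z where z: "poly (map_poly complex_of_real r) z = 0" "\<not> bounded_below (A - z \<cdot>\<^sub>C \<I>)"
    using op_cpoly_root_not_bounded_below[OF selfadj_bounded[OF A]] r(2)
    by (metis op_cpoly_of_real)
  then have "Im z = 0" using selfadj_nonreal_bounded_below[OF A] by blast
  then have zr: "z = of_real (Re z)" by (simp add: complex_eq_iff)
  then have "poly r (Re z) = 0" using z(1) poly_map_of_real[of r "Re z"] by simp
  moreover have "complex_of_real (Re z) \<in> op_spectrum A"
    using not_bounded_below_spectrum[OF z(2)] zr by simp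
  ultimately show ?thesis using that by blast
qed

text \<open>Some value of \<open>q\<close> on the spectrum attains the norm, because \<open>q(A)\<^sup>2 - \<parallel>q(A)\<parallel>\<^sup>2\<close> is not bounded below.\<close>
lemma selfadj_op_poly_norm_le:
  fixes A :: "('h::complex_hilbert) op"
  assumes A: "selfadj A" and M: "0 \<le> M"
    and le: "\<And>t. complex_of_real t \<in> op_spectrum A \<Longrightarrow> \<bar>poly q t\<bar> \<le> M"
  shows "norm (op_poly q A) \<le> M"
proof (cases "norm (op_poly q A) = 0")
  case False
  define L where "L = norm (op_poly q A)"
  have L0: "0 < L" using False by (simp add: L_def)
  obtain v :: 'h where v: "v \<noteq> 0"
    using False by (metis blinfun_eqI blinfun.zero_right norm_zero)
  have "\<exists>t. complex_of_real t \<in> op_spectrum A \<and> (poly q t)\<^sup>2 = L\<^sup>2"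
  proof (cases "q * q - [:L\<^sup>2:] = 0")
    case True
    have "op_poly ([:0, 1:] * [:0, 1:] - [:(norm A)\<^sup>2:]) A = (A o\<^sub>L A) - (norm A)\<^sup>2 *\<^sub>R \<I>"
      by (simp only: op_poly_diff op_poly_mult op_poly_linear op_poly_const) simp
    moreover have "[:0, 1:] * [:0, 1:] - [:(norm A)\<^sup>2:] \<noteq> 0" by simp
    ultimately obtain t where "complex_of_real t \<in> op_spectrum A"
      using selfadj_op_poly_root_in_spectrum[OF A] selfadj_norm_square_not_bounded_below[OF A v] by metis
    moreover have "poly (q * q - [:L\<^sup>2:]) t = 0" using True by (metis poly_0)
    ultimately show ?thesis by (auto simp: power2_eq_square)
  next
    case False
    have "op_poly (q * q - [:L\<^sup>2:]) A = (op_poly q A o\<^sub>L op_poly q A) - L\<^sup>2 *\<^sub>R \<I>"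
      by (simp add: op_poly_diff op_poly_mult)
    then have "\<not> bounded_below (op_poly (q * q - [:L\<^sup>2:]) A)"
      using selfadj_norm_square_not_bounded_below[OF op_poly_selfadj[OF A] v] by (simp add: L_def)
    then obtain t where "complex_of_real t \<in> op_spectrum A" "poly (q * q - [:L\<^sup>2:]) t = 0"
      using selfadj_op_poly_root_in_spectrum[OF A False] by metis
    then show ?thesis by (auto simp: power2_eq_square)
  qed
  then obtain t where "complex_of_real t \<in> op_spectrum A" "\<bar>poly q t\<bar> = L"
    using L0 by (metis abs_of_pos power2_eq_iff abs_minus_cancel)
  then show ?thesis using le L_def by metis
qed (use M in simp)

subsection \<open>The spectrum of a self-adjoint operator\<close>

lemma coercive_invertible:
  fixes G :: "('h::complex_hilbert) op"
  assumes G: "G \<in> bounded_operators" and \<delta>: "0 < \<delta>" and co: "\<And>x. \<delta> * (x \<bullet> x) \<le> G x \<bullet> x"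
  obtains B where "B \<in> bounded_operators" "B o\<^sub>L G = \<I>" "G o\<^sub>L B = \<I>"
proof -
  define M where "M = norm G + 1"
  have M0: "0 < M" by (simp add: M_def add_nonneg_pos)
  define s where "s = \<delta> / M\<^sup>2"
  have s0: "0 < s" using \<delta> M0 by (simp add: s_def)
  define k where "k = max 0 (1 - \<delta>\<^sup>2 / M\<^sup>2)"
  have k: "0 \<le> k" "k < 1" using \<delta> M0 by (simp_all add: k_def)
  have contr: "norm (x - s *\<^sub>R G x) \<le> sqrt k * norm x" for x
  proof -
    have "(norm (G x))\<^sup>2 \<le> (M * norm x)\<^sup>2"
    proof (intro power_mono norm_ge_zero)
      show "norm (G x) \<le> M * norm x"
        using norm_blinfun[of G x] by (simp add: M_def distrib_right add_increasing2)
    qed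
    then have "s\<^sup>2 * (norm (G x))\<^sup>2 \<le> s\<^sup>2 * (M * norm x)\<^sup>2" by (intro mult_left_mono) auto
    moreover have "s * (\<delta> * (x \<bullet> x)) \<le> s * (G x \<bullet> x)" using co s0 by simp
    moreover have "(norm (x - s *\<^sub>R G x))\<^sup>2 = (norm x)\<^sup>2 - 2 * (s * (G x \<bullet> x)) + s\<^sup>2 * (norm (G x))\<^sup>2"
      unfolding power2_norm_eq_inner
      by (simp add: inner_diff_left inner_diff_right inner_commute power2_eq_square)
    moreover have "s\<^sup>2 * (M * norm x)\<^sup>2 = s * (\<delta> * (x \<bullet> x))"
      using M0 by (simp add: s_def power2_eq_square dot_square_norm)
    moreover have "s * (\<delta> * (x \<bullet> x)) = \<delta>\<^sup>2 / M\<^sup>2 * (norm x)\<^sup>2"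
      by (simp add: s_def power2_eq_square dot_square_norm)
    ultimately have "(norm (x - s *\<^sub>R G x))\<^sup>2 \<le> (1 - \<delta>\<^sup>2 / M\<^sup>2) * (norm x)\<^sup>2"
      unfolding left_diff_distrib by linarith
    also have "\<dots> \<le> k * (norm x)\<^sup>2" by (intro mult_right_mono) (auto simp: k_def)
    finally show ?thesis
      using real_sqrt_le_mono by (fastforce simp: real_sqrt_mult)
  qed
  have "\<exists>x. G x = y" for y
  proof -
    have "\<exists>!x. x - s *\<^sub>R (G x - y) = x"
    proof (rule banach_fix_type)
      show "0 \<le> sqrt k" "sqrt k < 1" using k by auto
      show "\<forall>x z. dist (x - s *\<^sub>R (G x - y)) (z - s *\<^sub>R (G z - y)) \<le> sqrt k * dist x z"
      proof (intro allI)
        fix x z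
        have eq: "x - s *\<^sub>R (G x - y) - (z - s *\<^sub>R (G z - y)) = (x - z) - s *\<^sub>R G (x - z)"
          by (simp add: blinfun.diff_right scaleR_diff_right)
        show "dist (x - s *\<^sub>R (G x - y)) (z - s *\<^sub>R (G z - y)) \<le> sqrt k * dist x z"
          unfolding dist_norm eq by (rule contr)
      qed
    qed
    then obtain x where "x - s *\<^sub>R (G x - y) = x" by blast
    then have "s *\<^sub>R (G x - y) = 0" by (metis diff_zero diff_left_imp_eq)
    then have "G x - y = 0" using s0 by (simp only: scaleR_eq_0_iff) simp
    then show ?thesis by (intro exI) (rule eq_iff_diff_eq_0[THEN iffD2])
  qed
  then obtain g where g: "\<And>y. G (g y) = y" by metis
  have lower: "\<delta> * norm x \<le> norm (G x)" for x
  proof (cases "x = 0")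
    case False
    have "\<delta> * norm x * norm x \<le> norm (G x) * norm x"
      using co[of x] norm_cauchy_schwarz[of "G x" x]
      by (simp add: dot_square_norm power2_eq_square mult.assoc)
    then show ?thesis using False by simp
  qed simp
  have inj: "x = z" if "G x = G z" for x z
  proof -
    have "\<delta> * norm (x - z) \<le> 0" using lower[of "x - z"] that by (simp add: blinfun.diff_right)
    then show ?thesis using \<delta> by (simp add: mult_le_0_iff)
  qed
  have gb: "bounded_linear g"
  proof (rule bounded_linear_intro[where K = "1 / \<delta>"])
    show "g (x + y) = g x + g y" for x y by (rule inj) (simp add: g blinfun.add_right)
    show "g (r *\<^sub>R x) = r *\<^sub>R g x" for r x by (rule inj) (simp add: g blinfun.scaleR_right)
    show "norm (g x) \<le> norm x * (1 / \<delta>)" for x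
      using lower[of "g x"] \<delta> by (simp add: g field_simps)
  qed
  show ?thesis
  proof (rule that[of "Blinfun g"])
    show "Blinfun g \<in> bounded_operators"
    proof (rule bounded_operatorsI)
      show "Blinfun g (c *\<^sub>C x) = c *\<^sub>C Blinfun g x" for c x
        unfolding bounded_linear_Blinfun_apply[OF gb]
        by (rule inj) (simp add: g bounded_operatorsD[OF G])
    qed
    show "Blinfun g o\<^sub>L G = \<I>" "G o\<^sub>L Blinfun g = \<I>"
      by (rule blinfun_eqI; simp add: bounded_linear_Blinfun_apply[OF gb] g inj)+
  qed
qed

definition op_between :: "real \<Rightarrow> real \<Rightarrow> ('h::complex_hilbert) op \<Rightarrow> bool" where
  "op_between a b A \<longleftrightarrow> selfadj A \<and> a \<le> b \<and> (\<forall>x. a * (x \<bullet> x) \<le> A x \<bullet> x \<and> A x \<bullet> x \<le> b * (x \<bullet> x))"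

lemma op_between_spectrum:
  assumes A: "op_between a b A" and t: "complex_of_real t \<in> op_spectrum A"
  shows "a \<le> t \<and> t \<le> b"
proof -
  have Ab: "A \<in> bounded_operators" using A by (simp add: op_between_def selfadj_def)
  have tI: "(complex_of_real t \<cdot>\<^sub>C \<I>) x = t *\<^sub>R x" for x :: 'a
    by (simp add: op_expand scaleC_of_real)
  have no: False if "B \<in> bounded_operators" "B o\<^sub>L (of_real t \<cdot>\<^sub>C \<I> - A) = \<I>"
      "(of_real t \<cdot>\<^sub>C \<I> - A) o\<^sub>L B = \<I>" for B
    using t that unfolding op_spectrum_def by blast
  have "t \<le> b"
  proof (rule ccontr)
    assume "\<not> t \<le> b"
    moreover have "(t - b) * (x \<bullet> x) \<le> (of_real t \<cdot>\<^sub>C \<I> - A) x \<bullet> x" for x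
      using A unfolding op_between_def blinfun.diff_left tI inner_diff_left
      by (simp add: left_diff_distrib)
    moreover have "of_real t \<cdot>\<^sub>C \<I> - A \<in> bounded_operators"
      by (intro bounded_operators_binary(2) bounded_operators_unary(2) Ab bounded_operators_id)
    ultimately show False
      using coercive_invertible[of "of_real t \<cdot>\<^sub>C \<I> - A" "t - b"] no by (metis diff_gt_0_iff_gt not_le)
  qed
  moreover have "a \<le> t"
  proof (rule ccontr)
    assume "\<not> a \<le> t"
    moreover have "(a - t) * (x \<bullet> x) \<le> (A - of_real t \<cdot>\<^sub>C \<I>) x \<bullet> x" for x
      using A unfolding op_between_def blinfun.diff_left tI inner_diff_left
      by (simp add: left_diff_distrib)
    moreover have "A - of_real t \<cdot>\<^sub>C \<I> \<in> bounded_operators"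
      by (intro bounded_operators_binary(2) bounded_operators_unary(2) Ab bounded_operators_id)
    ultimately obtain B where B: "B \<in> bounded_operators" "B o\<^sub>L (A - of_real t \<cdot>\<^sub>C \<I>) = \<I>"
      "(A - of_real t \<cdot>\<^sub>C \<I>) o\<^sub>L B = \<I>"
      using coercive_invertible[of "A - of_real t \<cdot>\<^sub>C \<I>" "a - t"] by (metis diff_gt_0_iff_gt not_le)
    have "- B o\<^sub>L (of_real t \<cdot>\<^sub>C \<I> - A) = \<I>" "(of_real t \<cdot>\<^sub>C \<I> - A) o\<^sub>L - B = \<I>"
    proof -
      show "- B o\<^sub>L (of_real t \<cdot>\<^sub>C \<I> - A) = \<I>"
      proof (rule blinfun_eqI)
        show "(- B o\<^sub>L (of_real t \<cdot>\<^sub>C \<I> - A)) x = \<I> x" for x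
          using arg_cong[OF B(2), of "\<lambda>S. blinfun_apply S x"] by (simp add: op_expand)
      qed
      show "(of_real t \<cdot>\<^sub>C \<I> - A) o\<^sub>L - B = \<I>"
      proof (rule blinfun_eqI)
        show "((of_real t \<cdot>\<^sub>C \<I> - A) o\<^sub>L - B) x = \<I> x" for x
          using arg_cong[OF B(3), of "\<lambda>S. blinfun_apply S x"]
          by (simp add: op_expand scaleC_minus_right)
      qed
    qed
    then show False using no[of "- B"] bounded_operators_unary(1)[OF B(1)] by blast
  qed
  ultimately show ?thesis by blast
qed

subsection \<open>Continuous functional calculus\<close>

lemma op_between_selfadj: "op_between a b A \<Longrightarrow> selfadj A"
  and op_between_le: "op_between a b A \<Longrightarrow> a \<le> b"
  by (simp_all add: op_between_def)

lemma op_poly_norm_le_between: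
  assumes A: "op_between a b A" and le: "\<And>t. t \<in> {a..b} \<Longrightarrow> \<bar>poly q t\<bar> \<le> M"
  shows "norm (op_poly q A) \<le> M"
proof (rule selfadj_op_poly_norm_le[OF op_between_selfadj[OF A]])
  show "0 \<le> M" using le[of a] op_between_le[OF A] by (meson abs_ge_zero atLeastAtMost_iff order_refl order_trans)
  show "\<bar>poly q t\<bar> \<le> M" if "complex_of_real t \<in> op_spectrum A" for t
    using op_between_spectrum[OF A that] by (intro le) simp
qed

lemma poly_uniform_approximation:
  fixes f :: "real \<Rightarrow> real"
  assumes f: "continuous_on {a..b} f"
  obtains q :: "nat \<Rightarrow> real poly" where "uniform_limit {a..b} (\<lambda>n. poly (q n)) f sequentially"
proof -
  have "\<exists>q. \<forall>x\<in>{a..b}. \<bar>f x - poly q x\<bar> < 1 / (real n + 1)" for n :: nat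
  proof -
    obtain g where g: "real_polynomial_function g" "\<And>x. x \<in> {a..b} \<Longrightarrow> \<bar>f x - g x\<bar> < 1 / (real n + 1)"
      by (rule Stone_Weierstrass_real_polynomial_function[OF compact_Icc f, of "1 / (real n + 1)"]) auto
    obtain c m where c: "g = (\<lambda>x. \<Sum>i\<le>(m::nat). c i * x ^ i)"
      using real_polynomial_function_imp_sum[OF g(1)] by blast
    have "poly (\<Sum>i\<le>m. monom (c i) i) x = g x" for x by (simp add: c poly_sum poly_monom)
    then show ?thesis using g(2) by metis
  qed
  then obtain q where q: "\<And>n x. x \<in> {a..b} \<Longrightarrow> \<bar>f x - poly (q n) x\<bar> < 1 / (real n + 1)" by metis
  have "uniform_limit {a..b} (\<lambda>n. poly (q n)) f sequentially"
  proof (rule uniform_limitI)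
    fix e :: real assume "0 < e"
    have "(\<lambda>n. 1 / (real n + 1)) \<longlonglongrightarrow> 0"
      using LIMSEQ_inverse_real_of_nat by (simp add: inverse_eq_divide add.commute)
    then have "\<forall>\<^sub>F n in sequentially. 1 / (real n + 1) < e" using \<open>0 < e\<close> by (rule order_tendstoD(2))
    then show "\<forall>\<^sub>F n in sequentially. \<forall>x\<in>{a..b}. dist (poly (q n) x) (f x) < e"
    proof (rule eventually_mono)
      fix n assume "1 / (real n + 1) < e"
      then show "\<forall>x\<in>{a..b}. dist (poly (q n) x) (f x) < e"
        unfolding dist_real_def using q by (metis abs_minus_commute order_less_trans)
    qed
  qed
  then show ?thesis using that by blast
qed

lemma op_poly_difference_tendsto_0:
  assumes A: "selfadj A"
    and q: "uniform_limit {t. complex_of_real t \<in> op_spectrum A} (\<lambda>n. poly (q n)) f sequentially"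
    and r: "uniform_limit {t. complex_of_real t \<in> op_spectrum A} (\<lambda>n. poly (r n)) f sequentially"
  shows "(\<lambda>n. op_poly (q n) A - op_poly (r n) A) \<longlonglongrightarrow> 0"
proof (rule tendstoI)
  fix e :: real assume e: "0 < e"
  have "\<forall>\<^sub>F n in sequentially. \<forall>t\<in>{t. complex_of_real t \<in> op_spectrum A}. dist (poly (q n) t) (f t) < e / 4"
    using e by (intro uniform_limitD[OF q]) simp
  moreover have "\<forall>\<^sub>F n in sequentially. \<forall>t\<in>{t. complex_of_real t \<in> op_spectrum A}. dist (poly (r n) t) (f t) < e / 4"
    using e by (intro uniform_limitD[OF r]) simp
  ultimately show "\<forall>\<^sub>F n in sequentially. dist (op_poly (q n) A - op_poly (r n) A) 0 < e"
  proof eventually_elim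
    case (elim n)
    have "norm (op_poly (q n - r n) A) \<le> e / 2"
    proof (rule selfadj_op_poly_norm_le[OF A])
      fix t assume "complex_of_real t \<in> op_spectrum A"
      then have "dist (poly (q n) t) (f t) < e / 4" "dist (poly (r n) t) (f t) < e / 4"
        using elim by auto
      then show "\<bar>poly (q n - r n) t\<bar> \<le> e / 2" unfolding dist_real_def poly_diff by linarith
    qed (use e in simp)
    then show ?case using e by (simp add: op_poly_diff)
  qed
qed

lemma op_fun_tendsto:
  assumes A: "op_between a b A"
    and q: "uniform_limit {a..b} (\<lambda>n. poly (q n)) f sequentially"
  shows "(\<lambda>n. op_poly (q n) A) \<longlonglongrightarrow> op_fun f A"
proof -
  have sub: "{t. complex_of_real t \<in> op_spectrum A} \<subseteq> {a..b}"
    using op_between_spectrum[OF A] by auto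
  note qs = uniform_limit_on_subset[OF q sub]
  have "Cauchy (\<lambda>n. op_poly (q n) A)"
  proof (rule metric_CauchyI)
    fix e :: real assume e: "0 < e"
    then have "\<forall>\<^sub>F n in sequentially. \<forall>t\<in>{a..b}. dist (poly (q n) t) (f t) < e / 4"
      by (intro uniform_limitD[OF q]) simp
    then obtain K where K: "\<And>n t. K \<le> n \<Longrightarrow> t \<in> {a..b} \<Longrightarrow> dist (poly (q n) t) (f t) < e / 4"
      unfolding eventually_sequentially by blast
    have "dist (op_poly (q m) A) (op_poly (q n) A) < e" if "K \<le> m" "K \<le> n" for m n
    proof -
      have "norm (op_poly (q m - q n) A) \<le> e / 2"
      proof (rule op_poly_norm_le_between[OF A])
        show "\<bar>poly (q m - q n) t\<bar> \<le> e / 2" if "t \<in> {a..b}" for t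
          using K[OF \<open>K \<le> m\<close> that] K[OF \<open>K \<le> n\<close> that] unfolding dist_real_def poly_diff by linarith
      qed
      then show ?thesis using e by (simp add: op_poly_diff dist_norm)
    qed
    then show "\<exists>K. \<forall>m\<ge>K. \<forall>n\<ge>K. dist (op_poly (q m) A) (op_poly (q n) A) < e" by blast
  qed
  then obtain B where B: "(\<lambda>n. op_poly (q n) A) \<longlonglongrightarrow> B"
    using convergent_eq_Cauchy by blast
  have all: "(\<lambda>n. op_poly (r n) A) \<longlonglongrightarrow> B"
    if r: "uniform_limit {t. complex_of_real t \<in> op_spectrum A} (\<lambda>n. poly (r n)) f sequentially" for r
    using tendsto_add[OF op_poly_difference_tendsto_0[OF op_between_selfadj[OF A] r qs] B] by simp
  have "op_fun f A = B"
    unfolding op_fun_def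
  proof (rule the_equality)
    show "\<forall>q. uniform_limit {t. complex_of_real t \<in> op_spectrum A} (\<lambda>n. poly (q n)) f sequentially
        \<longrightarrow> (\<lambda>n. op_poly (q n) A) \<longlonglongrightarrow> B" using all by blast
    fix C assume "\<forall>q. uniform_limit {t. complex_of_real t \<in> op_spectrum A} (\<lambda>n. poly (q n)) f sequentially
        \<longrightarrow> (\<lambda>n. op_poly (q n) A) \<longlonglongrightarrow> C"
    then have "(\<lambda>n. op_poly (q n) A) \<longlonglongrightarrow> C" using qs by blast
    then show "C = B" using B by (rule LIMSEQ_unique)
  qed
  with B show ?thesis by simp
qed

lemma op_fun_poly:
  assumes A: "op_between a b A" and f: "\<And>t. t \<in> {a..b} \<Longrightarrow> f t = poly q t"
  shows "op_fun f A = op_poly q A"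
proof -
  have "uniform_limit {a..b} (\<lambda>n::nat. poly q) f sequentially"
    using f by (intro uniform_limitI always_eventually) simp
  from op_fun_tendsto[OF A this] show ?thesis by (rule LIMSEQ_unique) simp
qed

lemma op_fun_cong:
  assumes A: "op_between a b A" and f: "continuous_on {a..b} f" and eq: "\<And>t. t \<in> {a..b} \<Longrightarrow> f t = g t"
  shows "op_fun f A = op_fun g A"
proof -
  obtain q where q: "uniform_limit {a..b} (\<lambda>n. poly (q n)) f sequentially"
    using poly_uniform_approximation[OF f] by blast
  then have "uniform_limit {a..b} (\<lambda>n. poly (q n)) g sequentially"
    using uniform_limit_cong'[of "{a..b}" "\<lambda>n. poly (q n)" "\<lambda>n. poly (q n)" f g sequentially] eq by simp
  from LIMSEQ_unique[OF op_fun_tendsto[OF A q] op_fun_tendsto[OF A this]] show ?thesis .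
qed

lemma bounded_linear_compose_left: "bounded_linear (\<lambda>B. B o\<^sub>L X)"
  and bounded_linear_compose_right: "bounded_linear (\<lambda>B. X o\<^sub>L B)"
  by (rule bounded_bilinear.bounded_linear_left[OF bounded_bilinear_blinfun_compose]
      bounded_bilinear.bounded_linear_right[OF bounded_bilinear_blinfun_compose])+

lemma op_fun_intertwine:
  assumes A: "op_between a b A" and B: "op_between a b B" and f: "continuous_on {a..b} f"
    and eq: "A o\<^sub>L X = X o\<^sub>L B"
  shows "op_fun f A o\<^sub>L X = X o\<^sub>L op_fun f B"
proof -
  obtain q where q: "uniform_limit {a..b} (\<lambda>n. poly (q n)) f sequentially"
    using poly_uniform_approximation[OF f] by blast
  have "(\<lambda>n. op_poly (q n) A o\<^sub>L X) \<longlonglongrightarrow> (op_fun f A o\<^sub>L X)"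
    by (intro bounded_linear.tendsto[OF bounded_linear_compose_left] op_fun_tendsto[OF A q])
  moreover have "(\<lambda>n. X o\<^sub>L op_poly (q n) B) \<longlonglongrightarrow> (X o\<^sub>L op_fun f B)"
    by (intro bounded_linear.tendsto[OF bounded_linear_compose_right] op_fun_tendsto[OF B q])
  ultimately show ?thesis unfolding op_poly_intertwine[OF eq] by (rule LIMSEQ_unique)
qed

lemma op_fun_commute:
  assumes A: "op_between a b A" and f: "continuous_on {a..b} f" and eq: "A o\<^sub>L X = X o\<^sub>L A"
  shows "op_fun f A o\<^sub>L X = X o\<^sub>L op_fun f A"
  using op_fun_intertwine[OF A A f eq] .

lemma op_fun_add:
  assumes A: "op_between a b A" and f: "continuous_on {a..b} f" and g: "continuous_on {a..b} g"
  shows "op_fun (\<lambda>t. f t + g t) A = op_fun f A + op_fun g A"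
proof -
  obtain q where q: "uniform_limit {a..b} (\<lambda>n. poly (q n)) f sequentially"
    using poly_uniform_approximation[OF f] by blast
  obtain r where r: "uniform_limit {a..b} (\<lambda>n. poly (r n)) g sequentially"
    using poly_uniform_approximation[OF g] by blast
  have "uniform_limit {a..b} (\<lambda>n. poly (q n + r n)) (\<lambda>t. f t + g t) sequentially"
    unfolding poly_add by (intro uniform_limit_add q r)
  from op_fun_tendsto[OF A this] show ?thesis
    unfolding op_poly_add by (rule LIMSEQ_unique) (intro tendsto_add op_fun_tendsto[OF A] q r)
qed

lemma op_fun_mult:
  assumes A: "op_between a b A" and f: "continuous_on {a..b} f" and g: "continuous_on {a..b} g"
  shows "op_fun (\<lambda>t. f t * g t) A = op_fun f A o\<^sub>L op_fun g A"
proof -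
  obtain q where q: "uniform_limit {a..b} (\<lambda>n. poly (q n)) f sequentially"
    using poly_uniform_approximation[OF f] by blast
  obtain r where r: "uniform_limit {a..b} (\<lambda>n. poly (r n)) g sequentially"
    using poly_uniform_approximation[OF g] by blast
  have "uniform_limit {a..b} (\<lambda>n t. poly (q n) t * poly (r n) t) (\<lambda>t. f t * g t) sequentially"
    by (intro uniform_lim_mult q r compact_imp_bounded compact_continuous_image f g compact_Icc)
  then have "uniform_limit {a..b} (\<lambda>n. poly (q n * r n)) (\<lambda>t. f t * g t) sequentially"
    by (simp add: poly_mult[abs_def])
  from op_fun_tendsto[OF A this] show ?thesis
    unfolding op_poly_mult
    by (rule LIMSEQ_unique)
      (intro bounded_bilinear.tendsto[OF bounded_bilinear_blinfun_compose] op_fun_tendsto[OF A] q r)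
qed

lemma op_fun_const:
  assumes A: "op_between a b A"
  shows "op_fun (\<lambda>t. c) A = c *\<^sub>R \<I>"
  using op_fun_poly[OF A, of "\<lambda>t. c" "[:c:]"] by simp

lemma op_fun_affine:
  assumes A: "op_between a b A"
  shows "op_fun (\<lambda>t. c + d * t) A = c *\<^sub>R \<I> + d *\<^sub>R A"
  using op_fun_poly[OF A, of "\<lambda>t. c + d * t" "[:c, d:]"] by (simp add: op_poly_linear)

lemma op_fun_id:
  assumes A: "op_between a b A"
  shows "op_fun (\<lambda>t. t) A = A"
  using op_fun_affine[OF A, of 0 1] by simp

lemma op_fun_scaleR:
  assumes A: "op_between a b A" and f: "continuous_on {a..b} f"
  shows "op_fun (\<lambda>t. c * f t) A = c *\<^sub>R op_fun f A"
proof -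
  have "op_fun (\<lambda>t. c * f t) A = c *\<^sub>R \<I> o\<^sub>L op_fun f A"
    unfolding op_fun_mult[OF A continuous_on_const f] op_fun_const[OF A] ..
  also have "\<dots> = c *\<^sub>R op_fun f A" by (rule blinfun_eqI) (simp add: op_expand)
  finally show ?thesis .
qed

lemma op_fun_diff:
  assumes A: "op_between a b A" and f: "continuous_on {a..b} f" and g: "continuous_on {a..b} g"
  shows "op_fun (\<lambda>t. f t - g t) A = op_fun f A - op_fun g A"
proof -
  have "op_fun (\<lambda>t. (f t - g t) + g t) A = op_fun (\<lambda>t. f t - g t) A + op_fun g A"
    by (rule op_fun_add[OF A continuous_on_diff[OF f g] g])
  then show ?thesis by simp
qed

lemma bounded_operators_closed: "closed (bounded_operators :: ('h::complex_hilbert) op set)"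
proof -
  have "closed {A :: 'h op. A (c *\<^sub>C x) = c *\<^sub>C A x}" for c x
    by (intro closed_Collect_eq linear_continuous_on blinfun.bounded_linear_left
        bounded_linear_compose[OF bounded_linear_scaleC blinfun.bounded_linear_left])
  then have "closed (\<Inter>c. \<Inter>x. {A :: 'h op. A (c *\<^sub>C x) = c *\<^sub>C A x})" by blast
  also have "(\<Inter>c. \<Inter>x. {A :: 'h op. A (c *\<^sub>C x) = c *\<^sub>C A x}) = bounded_operators"
    unfolding bounded_operators_def by blast
  finally show ?thesis .
qed

lemma op_fun_in_closed:
  assumes A: "op_between a b A" and f: "continuous_on {a..b} f"
    and S: "closed S" "\<And>q. op_poly q A \<in> S"
  shows "op_fun f A \<in> S"
proof -
  obtain q where q: "uniform_limit {a..b} (\<lambda>n. poly (q n)) f sequentially"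
    using poly_uniform_approximation[OF f] by blast
  show ?thesis using closed_sequentially[OF S(1) _ op_fun_tendsto[OF A q]] S(2) by blast
qed

lemma op_fun_selfadj:
  assumes A: "op_between a b A" and f: "continuous_on {a..b} f"
  shows "selfadj (op_fun f A)"
proof (rule selfadjI)
  note sa = op_between_selfadj[OF A]
  show "op_fun f A \<in> bounded_operators"
    by (rule op_fun_in_closed[OF A f bounded_operators_closed op_poly_bounded_operators[OF selfadj_bounded[OF sa]]])
  fix x y
  obtain q where q: "uniform_limit {a..b} (\<lambda>n. poly (q n)) f sequentially"
    using poly_uniform_approximation[OF f] by blast
  note t = op_fun_tendsto[OF A q]
  have "(\<lambda>n. op_poly (q n) A x \<bullet> y) \<longlonglongrightarrow> op_fun f A x \<bullet> y"
    by (intro tendsto_intros blinfun.tendsto t)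
  moreover have "(\<lambda>n. x \<bullet> op_poly (q n) A y) \<longlonglongrightarrow> x \<bullet> op_fun f A y"
    by (intro tendsto_intros blinfun.tendsto t)
  ultimately show "op_fun f A x \<bullet> y = x \<bullet> op_fun f A y"
    unfolding selfadj_inner[OF op_poly_selfadj[OF sa]] by (rule LIMSEQ_unique)
qed

lemma op_fun_norm_le:
  assumes A: "op_between a b A" and f: "continuous_on {a..b} f"
    and M: "\<And>t. t \<in> {a..b} \<Longrightarrow> \<bar>f t\<bar> \<le> M"
  shows "norm (op_fun f A) \<le> M"
proof (rule field_le_epsilon)
  fix e :: real assume e: "0 < e"
  obtain q where q: "uniform_limit {a..b} (\<lambda>n. poly (q n)) f sequentially"
    using poly_uniform_approximation[OF f] by blast
  have ev: "\<forall>\<^sub>F n in sequentially. norm (op_poly (q n) A) \<le> M + e"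
    using uniform_limitD[OF q e]
  proof eventually_elim
    case (elim n)
    show ?case
    proof (rule op_poly_norm_le_between[OF A])
      fix t assume "t \<in> {a..b}"
      then show "\<bar>poly (q n) t\<bar> \<le> M + e" using elim M[of t] unfolding dist_real_def by fastforce
    qed
  qed
  show "norm (op_fun f A) \<le> M + e"
    by (rule tendsto_upperbound[OF tendsto_norm[OF op_fun_tendsto[OF A q]] ev]) simp
qed

lemma op_fun_between:
  assumes A: "op_between a b A" and f: "continuous_on {a..b} f"
    and M: "\<And>t. t \<in> {a..b} \<Longrightarrow> c \<le> f t \<and> f t \<le> d"
  shows "op_between c d (op_fun f A)"
  unfolding op_between_def
proof (intro conjI allI)
  show "selfadj (op_fun f A)" by (rule op_fun_selfadj[OF A f])
  have "a \<in> {a..b}" using op_between_le[OF A] by simp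
  from M[OF this] show "c \<le> d" by simp
  have eq: "op_fun (\<lambda>t. f t - (c + d) / 2) A = op_fun f A - ((c + d) / 2) *\<^sub>R \<I>"
    unfolding op_fun_diff[OF A f continuous_on_const] op_fun_const[OF A] ..
  have "norm (op_fun (\<lambda>t. f t - (c + d) / 2) A) \<le> (d - c) / 2"
  proof (rule op_fun_norm_le[OF A])
    show "continuous_on {a..b} (\<lambda>t. f t - (c + d) / 2)" by (intro continuous_intros f)
    show "\<bar>f t - (c + d) / 2\<bar> \<le> (d - c) / 2" if "t \<in> {a..b}" for t
      using M[OF that] unfolding abs_le_iff by (auto simp: field_simps)
  qed
  then have n: "norm (op_fun f A - ((c + d) / 2) *\<^sub>R \<I>) \<le> (d - c) / 2" unfolding eq .
  fix x
  have "\<bar>(op_fun f A - ((c + d) / 2) *\<^sub>R \<I>) x \<bullet> x\<bar> \<le> norm ((op_fun f A - ((c + d) / 2) *\<^sub>R \<I>) x) * norm x"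
    by (rule Cauchy_Schwarz_ineq2)
  also have "\<dots> \<le> ((d - c) / 2 * norm x) * norm x"
    by (intro mult_right_mono order_trans[OF norm_blinfun] n norm_ge_zero)
  also have "\<dots> = (d - c) / 2 * (x \<bullet> x)" by (simp add: dot_square_norm power2_eq_square)
  finally have "\<bar>op_fun f A x \<bullet> x - (c + d) / 2 * (x \<bullet> x)\<bar> \<le> (d - c) / 2 * (x \<bullet> x)"
    by (simp only: op_expand inner_diff_left inner_scaleR_left)
  then show "c * (x \<bullet> x) \<le> op_fun f A x \<bullet> x" "op_fun f A x \<bullet> x \<le> d * (x \<bullet> x)"
    unfolding abs_le_iff by (simp_all add: field_simps)
qed

lemma op_fun_compose:
  assumes A: "op_between a b A" and g: "continuous_on {a..b} g"
    and gM: "\<And>t. t \<in> {a..b} \<Longrightarrow> c \<le> g t \<and> g t \<le> d" and f: "continuous_on {c..d} f"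
  shows "op_fun f (op_fun g A) = op_fun (\<lambda>t. f (g t)) A"
proof -
  have gc: "g ` {a..b} \<subseteq> {c..d}" using gM by auto
  have fg: "continuous_on {a..b} (\<lambda>t. f (g t))" by (rule continuous_on_compose2[OF f g gc])
  have P: "op_poly q (op_fun g A) = op_fun (\<lambda>t. poly q (g t)) A" for q
  proof (induction q)
    case 0
    show ?case using op_fun_const[OF A, of 0] by simp
  next
    case (pCons e q)
    have c1: "continuous_on {a..b} (\<lambda>t. poly q (g t))" by (intro continuous_intros g)
    have "op_fun (\<lambda>t. poly (pCons e q) (g t)) A = e *\<^sub>R \<I> + (op_fun g A o\<^sub>L op_fun (\<lambda>t. poly q (g t)) A)"
      unfolding poly_pCons
      using op_fun_add[OF A continuous_on_const continuous_on_mult[OF g c1], of e]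
        op_fun_mult[OF A g c1] op_fun_const[OF A, of e] by simp
    then show ?case by (simp add: op_poly_pCons pCons)
  qed
  obtain q where q: "uniform_limit {c..d} (\<lambda>n. poly (q n)) f sequentially"
    using poly_uniform_approximation[OF f] by blast
  have t: "(\<lambda>n. op_fun (\<lambda>t. poly (q n) (g t)) A) \<longlonglongrightarrow> op_fun f (op_fun g A)"
    using op_fun_tendsto[OF op_fun_between[OF A g gM] q] unfolding P .
  have "(\<lambda>n. op_fun (\<lambda>t. poly (q n) (g t)) A) \<longlonglongrightarrow> op_fun (\<lambda>t. f (g t)) A"
  proof (rule tendstoI)
    fix e :: real assume e: "0 < e"
    then have "\<forall>\<^sub>F n in sequentially. \<forall>x\<in>{c..d}. dist (poly (q n) x) (f x) < e / 2"
      by (intro uniform_limitD[OF q]) simp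
    then show "\<forall>\<^sub>F n in sequentially. dist (op_fun (\<lambda>t. poly (q n) (g t)) A) (op_fun (\<lambda>t. f (g t)) A) < e"
    proof eventually_elim
      case (elim n)
      have c1: "continuous_on {a..b} (\<lambda>t. poly (q n) (g t))" by (intro continuous_intros g)
      have "norm (op_fun (\<lambda>t. poly (q n) (g t) - f (g t)) A) \<le> e / 2"
      proof (rule op_fun_norm_le[OF A continuous_on_diff[OF c1 fg]])
        show "\<bar>poly (q n) (g t) - f (g t)\<bar> \<le> e / 2" if "t \<in> {a..b}" for t
        proof -
          have "g t \<in> {c..d}" using gM[OF that] by simp
          with elim show ?thesis unfolding dist_real_def by (intro less_imp_le) blast
        qed
      qed
      then show ?case unfolding op_fun_diff[OF A c1 fg] dist_norm using e by simp
    qed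
  qed
  with t show ?thesis by (rule LIMSEQ_unique)
qed

lemma op_between_scaleR_id:
  assumes "a \<le> c" "c \<le> b"
  shows "op_between a b (c *\<^sub>R \<I>)"
  unfolding op_between_def
proof (intro conjI allI selfadjI)
  show "c *\<^sub>R \<I> \<in> bounded_operators" by (intro bounded_operators_unary bounded_operators_id)
  show "a \<le> b" using assms by simp
qed (use assms in \<open>simp_all add: op_expand mult_right_mono\<close>)

lemma op_fun_scaleR_id:
  assumes c: "a \<le> c" "c \<le> b" and f: "continuous_on {a..b} f"
  shows "op_fun f (c *\<^sub>R \<I>) = f c *\<^sub>R \<I>"
proof -
  have A: "op_between c c (c *\<^sub>R \<I>)" by (rule op_between_scaleR_id) auto
  show ?thesis using op_fun_poly[OF A, of f "[:f c:]"] by simp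
qed

lemma selfadj_op_between_norm:
  assumes A: "selfadj A"
  shows "op_between (- norm A) (norm A) A"
  unfolding op_between_def
proof (intro conjI allI A)
  fix x
  have "\<bar>A x \<bullet> x\<bar> \<le> norm (A x) * norm x" by (rule Cauchy_Schwarz_ineq2)
  also have "\<dots> \<le> (norm A * norm x) * norm x" by (intro mult_right_mono norm_blinfun norm_ge_zero)
  also have "\<dots> = norm A * (x \<bullet> x)" by (simp add: dot_square_norm power2_eq_square)
  finally show "- norm A * (x \<bullet> x) \<le> A x \<bullet> x" "A x \<bullet> x \<le> norm A * (x \<bullet> x)"
    unfolding abs_le_iff by simp_all
  have "0 \<le> norm A" by simp
  then show "- norm A \<le> norm A" by linarith
qed

lemma op_between_norm_le:
  assumes A: "op_between (- M) M A"
  shows "norm A \<le> M"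
  using op_fun_norm_le[OF A continuous_on_id] op_fun_id[OF A] by (simp add: id_def abs_le_iff)

lemma selfadj_adjoint_compose:
  assumes A: "A \<in> bounded_operators"
  shows "op_between 0 ((norm A)\<^sup>2) (A\<^sup>\<dagger> o\<^sub>L A)"
  unfolding op_between_def
proof (intro conjI allI selfadjI)
  show "A\<^sup>\<dagger> o\<^sub>L A \<in> bounded_operators"
    by (intro bounded_operators_binary adjoint_bounded_operators A)
  show "(A\<^sup>\<dagger> o\<^sub>L A) x \<bullet> y = x \<bullet> (A\<^sup>\<dagger> o\<^sub>L A) y" for x y
    by (simp add: adjoint_inner'[OF A] adjoint_inner[OF A, symmetric])
  fix x
  have e: "(A\<^sup>\<dagger> o\<^sub>L A) x \<bullet> x = (norm (A x))\<^sup>2" by (simp add: adjoint_inner'[OF A] dot_square_norm)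
  show "0 * (x \<bullet> x) \<le> (A\<^sup>\<dagger> o\<^sub>L A) x \<bullet> x" unfolding e by simp
  have "(norm (A x))\<^sup>2 \<le> (norm A * norm x)\<^sup>2" by (intro power_mono norm_blinfun norm_ge_zero)
  then show "(A\<^sup>\<dagger> o\<^sub>L A) x \<bullet> x \<le> (norm A)\<^sup>2 * (x \<bullet> x)"
    unfolding e by (simp add: power_mult_distrib dot_square_norm)
qed simp

lemma continuous_on_powr_const: "0 < p \<Longrightarrow> continuous_on {0..b} (\<lambda>t::real. t powr p)"
  by (intro continuous_on_powr' continuous_intros) auto

lemma op_powr_op_abs:
  assumes A: "A \<in> bounded_operators" and p: "0 < p"
  shows "op_powr (op_abs A) p = op_fun (\<lambda>t. t powr (p / 2)) (A\<^sup>\<dagger> o\<^sub>L A)"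
proof -
  note H = selfadj_adjoint_compose[OF A]
  have "op_powr (op_abs A) p = op_fun (\<lambda>t. sqrt t powr p) (A\<^sup>\<dagger> o\<^sub>L A)"
    unfolding op_powr_def op_abs_def
  proof (rule op_fun_compose[OF H])
    show "continuous_on {0..(norm A)\<^sup>2} sqrt" by (intro continuous_intros)
    show "0 \<le> sqrt t \<and> sqrt t \<le> norm A" if "t \<in> {0..(norm A)\<^sup>2}" for t
      using that real_sqrt_le_mono[of t "(norm A)\<^sup>2"] by simp
    show "continuous_on {0..norm A} (\<lambda>t. t powr p)" by (rule continuous_on_powr_const[OF p])
  qed
  also have "\<dots> = op_fun (\<lambda>t. t powr (p / 2)) (A\<^sup>\<dagger> o\<^sub>L A)"
  proof (rule op_fun_cong[OF H])
    show "continuous_on {0..(norm A)\<^sup>2} (\<lambda>t. sqrt t powr p)"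
      using p by (intro continuous_on_powr' continuous_intros) auto
    show "sqrt t powr p = t powr (p / 2)" if "t \<in> {0..(norm A)\<^sup>2}" for t
      using that by (simp add: powr_half_sqrt[symmetric] powr_powr)
  qed
  finally show ?thesis .
qed

subsection \<open>Orthogonal projections\<close>

lemma closed_complex_subspace_projection:
  fixes M :: "'h::complex_hilbert set"
  assumes cl: "closed M" and sub: "subspace M" and sc: "\<And>c x. x \<in> M \<Longrightarrow> c *\<^sub>C x \<in> M"
  obtains F :: "'h op" where "selfadj F" "F o\<^sub>L F = F" "\<And>x. F x \<in> M" "\<And>x. x \<in> M \<Longrightarrow> F x = x"
    "\<And>B. B \<in> bounded_operators \<Longrightarrow> (\<And>x. x \<in> M \<Longrightarrow> B x \<in> M) \<Longrightarrow> (\<And>x. x \<in> M \<Longrightarrow> (B\<^sup>\<dagger>) x \<in> M)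
      \<Longrightarrow> B o\<^sub>L F = F o\<^sub>L B"
proof -
  have "\<exists>m. m \<in> M \<and> (\<forall>y\<in>M. (x - m) \<bullet> y = 0)" for x
    using subspace_orthogonal_projection[OF cl sub, of x] by metis
  then obtain f where fM: "\<And>x. f x \<in> M" and fo: "\<And>x y. y \<in> M \<Longrightarrow> (x - f x) \<bullet> y = 0" by metis
  have uniq: "f x = m" if "m \<in> M" "\<And>y. y \<in> M \<Longrightarrow> (x - m) \<bullet> y = 0" for x m
  proof -
    have d: "f x - m \<in> M" using fM that(1) sub by (rule subspace_diff[rotated])
    have "(f x - m) \<bullet> (f x - m) = (x - m) \<bullet> (f x - m) - (x - f x) \<bullet> (f x - m)"
      by (simp add: inner_diff_left)
    also have "\<dots> = 0" using that(2)[OF d] fo[OF d] by simp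
    finally show ?thesis by simp
  qed
  have id: "f x = x" if "x \<in> M" for x by (rule uniq[OF that]) simp
  have sym: "f x \<bullet> y = x \<bullet> f y" for x y
  proof -
    have "f x \<bullet> y = f x \<bullet> f y" using fo[OF fM[of x], of y] by (simp add: inner_diff_left inner_commute[of y] inner_commute[of "f y"])
    also have "\<dots> = x \<bullet> f y" using fo[OF fM[of y], of x] by (simp add: inner_diff_left)
    finally show ?thesis .
  qed
  have bl: "bounded_linear f"
  proof (rule bounded_linear_intro[where K = 1])
    show "f (x + y) = f x + f y" for x y
    proof (rule uniq)
      show "f x + f y \<in> M" by (intro subspace_add sub fM)
      show "(x + y - (f x + f y)) \<bullet> z = 0" if "z \<in> M" for z
        using fo[OF that, of x] fo[OF that, of y] by (simp add: inner_diff_left inner_add_left)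
    qed
    show "f (r *\<^sub>R x) = r *\<^sub>R f x" for r x
    proof (rule uniq)
      show "r *\<^sub>R f x \<in> M" by (intro subspace_scale sub fM)
      show "(r *\<^sub>R x - r *\<^sub>R f x) \<bullet> z = 0" if "z \<in> M" for z
        using fo[OF that, of x] by (simp add: inner_diff_left)
    qed
    show "norm (f x) \<le> norm x * 1" for x
    proof (cases "f x = 0")
      case False
      have "norm (f x) * norm (f x) = x \<bullet> f x"
        using sym[of x "f x"] id[OF fM] by (simp add: dot_square_norm power2_eq_square)
      also have "\<dots> \<le> norm x * norm (f x)" by (rule norm_cauchy_schwarz)
      finally show ?thesis using False by simp
    qed simp
  qed
  define F where "F = Blinfun f"
  have Ff: "F x = f x" for x unfolding F_def bounded_linear_Blinfun_apply[OF bl] ..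
  show ?thesis
  proof (rule that[of F])
    show "selfadj F"
    proof (rule selfadjI)
      show "F \<in> bounded_operators"
      proof (rule bounded_operatorsI)
        show "F (c *\<^sub>C x) = c *\<^sub>C F x" for c x
          unfolding Ff
        proof (rule uniq[OF sc[OF fM]])
          show "(c *\<^sub>C x - c *\<^sub>C f x) \<bullet> y = 0" if "y \<in> M" for y
            unfolding scaleC_diff_right[symmetric] inner_scaleC_left by (rule fo[OF sc[OF that]])
        qed
      qed
    qed (simp add: Ff sym)
    show "F o\<^sub>L F = F" by (rule blinfun_eqI) (simp add: Ff id fM)
    show "F x \<in> M" for x by (simp add: Ff fM)
    show "F x = x" if "x \<in> M" for x by (simp add: Ff id that)
    fix B :: "'h op"
    assume B: "B \<in> bounded_operators" and BM: "\<And>x. x \<in> M \<Longrightarrow> B x \<in> M"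
      and BM': "\<And>x. x \<in> M \<Longrightarrow> (B\<^sup>\<dagger>) x \<in> M"
    show "B o\<^sub>L F = F o\<^sub>L B"
    proof (rule blinfun_eqI)
      fix x
      have "f (B x) = B (f x)"
      proof (rule uniq[OF BM[OF fM]])
        show "(B x - B (f x)) \<bullet> y = 0" if "y \<in> M" for y
          unfolding blinfun.diff_right[symmetric] adjoint_inner[OF B] by (rule fo[OF BM'[OF that]])
      qed
      then show "(B o\<^sub>L F) x = (F o\<^sub>L B) x" by (simp add: Ff)
    qed
  qed
qed

lemma projectionsD:
  assumes "P \<in> projections N"
  shows "P \<in> N" "P\<^sup>\<dagger> = P" "P (P x) = P x"
proof -
  show "P \<in> N" "P\<^sup>\<dagger> = P" using assms by (simp_all add: projections_def)
  have "P o\<^sub>L P = P" using assms by (simp add: projections_def)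
  from arg_cong[OF this, of "\<lambda>T. blinfun_apply T x"] show "P (P x) = P x" by simp
qed

lemma op_eqD: "A = B \<Longrightarrow> blinfun_apply A x = blinfun_apply B x" by simp

subsection \<open>Von Neumann algebras\<close>

lemma commutantD: "A \<in> S \<Longrightarrow> B \<in> commutant S \<Longrightarrow> blinfun_apply A (blinfun_apply B x) = B (A x)"
proof -
  assume "A \<in> S" "B \<in> commutant S"
  then have "A o\<^sub>L B = B o\<^sub>L A" unfolding commutant_def by blast
  from arg_cong[OF this, of "\<lambda>T. blinfun_apply T x"] show ?thesis by simp
qed

lemma commutantI:
  assumes "B \<in> bounded_operators" "\<And>A x. A \<in> S \<Longrightarrow> blinfun_apply A (blinfun_apply B x) = B (A x)"
  shows "B \<in> commutant S"
  unfolding commutant_def using assms by (auto intro: blinfun_eqI)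

lemma commutant_bounded: "B \<in> commutant S \<Longrightarrow> B \<in> bounded_operators"
  by (simp add: commutant_def)

lemma commutant_closed: "closed (commutant S)"
proof -
  have "closed {B. A o\<^sub>L B = B o\<^sub>L A}" for A :: "'a op"
    by (intro closed_Collect_eq linear_continuous_on bounded_linear_compose_left bounded_linear_compose_right)
  then have "closed (bounded_operators \<inter> (\<Inter>A\<in>S. {B. A o\<^sub>L B = B o\<^sub>L A}))"
    by (intro closed_Int bounded_operators_closed closed_INT ballI)
  also have "bounded_operators \<inter> (\<Inter>A\<in>S. {B. A o\<^sub>L B = B o\<^sub>L A}) = commutant S"
    unfolding commutant_def by blast
  finally show ?thesis .
qed

locale vn_algebra =
  fixes N :: "('h::complex_hilbert) op set"
  assumes vna: "von_neumann_algebra N"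
begin

lemma bounded: "A \<in> N \<Longrightarrow> A \<in> bounded_operators"
  and adjoint_in: "A \<in> N \<Longrightarrow> A\<^sup>\<dagger> \<in> N"
  and bicommutant: "commutant (commutant N) = N"
  using vna unfolding von_neumann_algebra_def by auto

lemma memI:
  assumes "B \<in> bounded_operators" "\<And>A x. A \<in> commutant N \<Longrightarrow> blinfun_apply A (blinfun_apply B x) = B (A x)"
  shows "B \<in> N"
proof -
  have "B \<in> commutant (commutant N)" by (rule commutantI) (use assms in auto)
  then show ?thesis unfolding bicommutant .
qed

lemma commute: "A \<in> N \<Longrightarrow> B \<in> commutant N \<Longrightarrow> A (B x) = B (A x)"
  by (rule commutantD)

lemma mem_add: "A \<in> N \<Longrightarrow> B \<in> N \<Longrightarrow> A + B \<in> N"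
  by (rule memI) (simp_all add: bounded_operators_binary bounded op_expand commute)

lemma mem_diff: "A \<in> N \<Longrightarrow> B \<in> N \<Longrightarrow> A - B \<in> N"
  by (rule memI) (simp_all add: bounded_operators_binary bounded op_expand commute)

lemma mem_compose: "A \<in> N \<Longrightarrow> B \<in> N \<Longrightarrow> A o\<^sub>L B \<in> N"
  by (rule memI) (simp_all add: bounded_operators_binary bounded commute)

lemma mem_scaleR: "A \<in> N \<Longrightarrow> r *\<^sub>R A \<in> N"
  by (rule memI) (simp_all add: bounded_operators_unary bounded op_expand commute)

lemma mem_minus: "A \<in> N \<Longrightarrow> - A \<in> N"
  by (rule memI) (simp_all add: bounded_operators_unary bounded op_expand commute)

lemma mem_scaleC: "A \<in> N \<Longrightarrow> c \<cdot>\<^sub>C A \<in> N"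
  by (rule memI)
    (simp_all add: bounded_operators_unary bounded op_expand commute bounded_operatorsD commutant_bounded)

lemma mem_id: "\<I> \<in> N"
  by (rule memI) simp_all

lemma mem_zero: "0 \<in> N"
  by (rule memI) simp_all

lemmas mem_intros = mem_add mem_diff mem_compose mem_scaleR mem_minus mem_scaleC mem_id mem_zero adjoint_in

lemma mem_op_poly: "A \<in> N \<Longrightarrow> op_poly q A \<in> N"
  by (induction q) (auto simp: op_poly_pCons intro: mem_intros)

lemma closed_N: "closed N"
  using commutant_closed[of "commutant N"] bicommutant by simp

lemma mem_op_fun:
  assumes "op_between a b A" "continuous_on {a..b} f" "A \<in> N"
  shows "op_fun f A \<in> N"
  using op_fun_in_closed[OF assms(1,2) closed_N] mem_op_poly[OF assms(3)] by blast

lemma commutant_adjoint: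
  assumes B: "B \<in> commutant N"
  shows "B\<^sup>\<dagger> \<in> commutant N"
proof (rule commutantI)
  note Bb = commutant_bounded[OF B]
  show "B\<^sup>\<dagger> \<in> bounded_operators" by (rule adjoint_bounded_operators[OF Bb])
  fix A x assume A: "A \<in> N"
  note Ab = bounded[OF A]
  show "A ((B\<^sup>\<dagger>) x) = (B\<^sup>\<dagger>) (A x)"
  proof (rule vector_eqI)
    fix y
    have "y \<bullet> A ((B\<^sup>\<dagger>) x) = B ((A\<^sup>\<dagger>) y) \<bullet> x"
      by (simp only: adjoint_inner'[OF Ab, symmetric] adjoint_inner[OF Bb])
    also have "B ((A\<^sup>\<dagger>) y) = (A\<^sup>\<dagger>) (B y)" by (rule commute[OF adjoint_in[OF A] B, symmetric])
    also have "(A\<^sup>\<dagger>) (B y) \<bullet> x = y \<bullet> (B\<^sup>\<dagger>) (A x)"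
      by (simp only: adjoint_inner'[OF Ab] adjoint_inner[OF Bb])
    finally show "y \<bullet> A ((B\<^sup>\<dagger>) x) = y \<bullet> (B\<^sup>\<dagger>) (A x)" .
  qed
qed

lemma projection_selfadj: "P \<in> projections N \<Longrightarrow> selfadj P"
  unfolding projections_def selfadj_def using bounded by blast

lemma projectionI: "P \<in> N \<Longrightarrow> selfadj P \<Longrightarrow> (\<And>x. P (P x) = P x) \<Longrightarrow> P \<in> projections N"
  unfolding projections_def selfadj_def by (auto intro: blinfun_eqI)

lemma range_projection:
  assumes K: "K \<in> N" and sa: "selfadj K"
  obtains E where "E \<in> projections N" "\<And>x. K (E x) = K x" "\<And>x. E (K x) = K x"
    "\<And>Y :: 'h op. K o\<^sub>L Y = 0 \<Longrightarrow> E o\<^sub>L Y = 0"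
proof -
  define M where "M = {x. K x = 0}"
  have "closed M" unfolding M_def by (intro closed_Collect_eq continuous_intros linear_continuous_on blinfun.bounded_linear_right)
  moreover have "subspace M" unfolding M_def by (auto simp: subspace_def blinfun.bilinear_simps)
  moreover have "c *\<^sub>C x \<in> M" if "x \<in> M" for c x
    using that unfolding M_def by (simp add: bounded_operatorsD[OF bounded[OF K]] scaleC_zero_right)
  ultimately obtain F where F: "selfadj F" "F o\<^sub>L F = F" "\<And>x. F x \<in> M" "\<And>x. x \<in> M \<Longrightarrow> F x = x"
    "\<And>B. B \<in> bounded_operators \<Longrightarrow> (\<And>x. x \<in> M \<Longrightarrow> B x \<in> M) \<Longrightarrow> (\<And>x. x \<in> M \<Longrightarrow> (B\<^sup>\<dagger>) x \<in> M)
      \<Longrightarrow> B o\<^sub>L F = F o\<^sub>L B"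
    using closed_complex_subspace_projection by metis
  have inv: "B x \<in> M" if "B \<in> commutant N" "x \<in> M" for B x
    using commute[OF K that(1), of x] that(2) by (simp add: M_def blinfun.zero_right)
  have FN: "F \<in> N"
  proof (rule memI[OF selfadj_bounded[OF F(1)]])
    fix B x assume B: "B \<in> commutant N"
    have "B o\<^sub>L F = F o\<^sub>L B"
      by (rule F(5)[OF commutant_bounded[OF B] inv[OF B] inv[OF commutant_adjoint[OF B]]])
    from op_eqD[OF this, of x] show "B (F x) = F (B x)" by simp
  qed
  have FF: "F (F x) = F x" for x using op_eqD[OF F(2), of x] by simp
  have KF: "K (F x) = 0" for x using F(3)[of x] by (simp add: M_def)
  have FK: "F (K x) = 0" for x
  proof -
    have "F (K x) \<bullet> F (K x) = K x \<bullet> F (F (K x))" by (rule selfadj_inner[OF F(1)])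
    also have "\<dots> = x \<bullet> K (F (F (K x)))" by (rule selfadj_inner[OF sa])
    finally show ?thesis by (simp add: KF)
  qed
  show ?thesis
  proof (rule that[of "\<I> - F"])
    show "\<I> - F \<in> projections N"
    proof (rule projectionI)
      show "\<I> - F \<in> N" by (intro mem_intros FN)
      show "selfadj (\<I> - F)"
        by (rule selfadjI[OF bounded[OF \<open>\<I> - F \<in> N\<close>]])
          (simp add: op_expand inner_diff_left inner_diff_right selfadj_inner[OF F(1)])
    qed (simp add: op_expand FF)
    show "K ((\<I> - F) x) = K x" "(\<I> - F) (K x) = K x" for x by (simp_all add: op_expand KF FK)
    fix Y :: "'h op" assume Y: "K o\<^sub>L Y = 0"
    show "(\<I> - F) o\<^sub>L Y = 0"
    proof (rule blinfun_eqI)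
      fix x
      have "Y x \<in> M" using op_eqD[OF Y, of x] by (simp add: M_def)
      then show "((\<I> - F) o\<^sub>L Y) x = blinfun_apply 0 x" by (simp add: op_expand F(4))
    qed
  qed
qed

end

subsection \<open>Tracial states\<close>

locale tracial_vn_algebra = vn_algebra N for N :: "('h::complex_hilbert) op set" +
  fixes \<tau> :: "'h op \<Rightarrow> complex"
  assumes trace: "tracial_state N \<tau>"
begin

definition tr :: "'h op \<Rightarrow> real" where "tr A = Re (\<tau> A)"

lemma tr_add: "A \<in> N \<Longrightarrow> B \<in> N \<Longrightarrow> tr (A + B) = tr A + tr B"
  using trace unfolding tracial_state_def tr_def by simp

lemma tr_id: "tr \<I> = 1"
  using trace unfolding tracial_state_def tr_def by simp

lemma tr_commute: "A \<in> N \<Longrightarrow> B \<in> N \<Longrightarrow> tr (A o\<^sub>L B) = tr (B o\<^sub>L A)"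
  using trace unfolding tracial_state_def tr_def by metis

lemma tr_adjoint_compose: "A \<in> N \<Longrightarrow> 0 \<le> tr (A\<^sup>\<dagger> o\<^sub>L A)"
  using trace unfolding tracial_state_def tr_def by (auto simp: complex_nonneg_Reals_iff)

lemma tr_scaleR: "A \<in> N \<Longrightarrow> tr (r *\<^sub>R A) = r * tr A"
proof -
  assume A: "A \<in> N"
  have "r *\<^sub>R A = complex_of_real r \<cdot>\<^sub>C A"
    by (rule blinfun_eqI) (simp add: op_expand scaleC_of_real)
  then show ?thesis using trace A unfolding tracial_state_def tr_def by simp
qed

lemma tr_diff: "A \<in> N \<Longrightarrow> B \<in> N \<Longrightarrow> tr (A - B) = tr A - tr B"
  using tr_add[of "A - B" B] mem_diff[of A B] by simp

lemma tr_nonneg: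
  assumes A: "A \<in> N" "selfadj A" and pos: "\<And>x. 0 \<le> A x \<bullet> x"
  shows "0 \<le> tr A"
proof -
  have b: "op_between 0 (norm A) A"
    using selfadj_op_between_norm[OF A(2)] pos unfolding op_between_def by simp
  define C where "C = op_fun sqrt A"
  have c: "continuous_on {0..norm A} sqrt" by (intro continuous_intros)
  have "C\<^sup>\<dagger> o\<^sub>L C = op_fun (\<lambda>t. sqrt t * sqrt t) A"
    using op_fun_selfadj[OF b c] unfolding C_def selfadj_def op_fun_mult[OF b c c] by simp
  also have "\<dots> = op_fun (\<lambda>t. t) A"
    by (rule op_fun_cong[OF b]) (auto intro!: continuous_intros)
  also have "\<dots> = A" by (rule op_fun_id[OF b])
  finally show ?thesis using tr_adjoint_compose[OF mem_op_fun[OF b c A(1)]] by (simp add: C_def)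
qed

lemma tr_projection_nonneg: "P \<in> projections N \<Longrightarrow> 0 \<le> tr P"
  using tr_adjoint_compose[of P] by (simp add: projections_def)

lemma tr_op_between_nonneg: "op_between 0 b A \<Longrightarrow> A \<in> N \<Longrightarrow> 0 \<le> tr A"
  by (rule tr_nonneg) (simp_all add: op_between_def)

end

lemma selfadj_mult_zero_commute:
  assumes A: "selfadj A" and B: "selfadj B" and 0: "\<And>x. A (blinfun_apply B x) = 0"
  shows "B (blinfun_apply A x) = 0"
proof -
  have "B (A x) \<bullet> B (A x) = x \<bullet> A (B (B (A x)))"
    by (simp only: selfadj_inner[OF A] selfadj_inner[OF B])
  then show ?thesis by (simp add: 0)
qed

subsection \<open>Partial isometries between projections of a factor\<close>

locale factor_algebra = vn_algebra N for N :: "('h::complex_hilbert) op set" +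
  assumes center: "N \<inter> commutant N = {c \<cdot>\<^sub>C \<I> | c. True}"
begin

lemma nonzero_corner:
  assumes P: "P \<in> projections N" "P \<noteq> 0" and R: "R \<in> projections N" "R \<noteq> 0"
  obtains A where "A \<in> N" "R o\<^sub>L (A o\<^sub>L P) \<noteq> 0"
proof (rule ccontr)
  note found = that
  note Pd = projectionsD[OF P(1)] and Rd = projectionsD[OF R(1)]
  assume "\<not> thesis"
  then have all0: "R (A (P x)) = 0" if "A \<in> N" for A x
  proof -
    have "R o\<^sub>L (A o\<^sub>L P) = 0" using found[OF \<open>A \<in> N\<close>] \<open>\<not> thesis\<close> by blast
    from op_eqD[OF this, of x] show ?thesis by simp
  qed
  define M where "M = {y. \<forall>B\<in>N. R (blinfun_apply B y) = 0}"
  have "M = (\<Inter>B\<in>N. {y. R (blinfun_apply B y) = 0})" unfolding M_def by blast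
  moreover have "closed {y. R (B y) = 0}" for B :: "'h op"
    by (intro closed_Collect_eq linear_continuous_on bounded_linear_compose[OF blinfun.bounded_linear_right]
        blinfun.bounded_linear_right bounded_linear_zero)
  ultimately have cl: "closed M" by auto
  have sub: "subspace M" unfolding M_def
    by (auto simp: subspace_def blinfun.zero_right blinfun.add_right blinfun.scaleR_right)
  have sc: "c *\<^sub>C x \<in> M" if "x \<in> M" for c x
    using that unfolding M_def by (simp add: bounded_operatorsD bounded Rd(1) scaleC_zero_right)
  obtain F where F: "selfadj F" "F o\<^sub>L F = F" "\<And>x. F x \<in> M" "\<And>x. x \<in> M \<Longrightarrow> F x = x"
    "\<And>B. B \<in> bounded_operators \<Longrightarrow> (\<And>x. x \<in> M \<Longrightarrow> B x \<in> M) \<Longrightarrow> (\<And>x. x \<in> M \<Longrightarrow> (B\<^sup>\<dagger>) x \<in> M)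
      \<Longrightarrow> B o\<^sub>L F = F o\<^sub>L B"
    using closed_complex_subspace_projection[OF cl sub sc] by metis
  have invN: "B x \<in> M" if "B \<in> N" "x \<in> M" for B x
    using that mem_compose[OF _ that(1)] unfolding M_def by fastforce
  have invC: "B x \<in> M" if B: "B \<in> commutant N" and x: "x \<in> M" for B x
    unfolding M_def
  proof (intro CollectI ballI)
    fix A assume A: "A \<in> N"
    have "R (A (B x)) = B (R (A x))" by (simp add: commute[OF A B] commute[OF Rd(1) B])
    then show "R (A (B x)) = 0" using x A by (simp add: M_def blinfun.zero_right)
  qed
  have "F \<in> N"
  proof (rule memI[OF selfadj_bounded[OF F(1)]])
    fix B x assume B: "B \<in> commutant N"
    show "B (F x) = F (B x)"
      using op_eqD[OF F(5)[OF commutant_bounded[OF B] invC[OF B] invC[OF commutant_adjoint[OF B]]], of x]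
      by simp
  qed
  moreover have "F \<in> commutant N"
  proof (rule commutantI[OF selfadj_bounded[OF F(1)]])
    fix B x assume B: "B \<in> N"
    show "B (F x) = F (B x)"
      using op_eqD[OF F(5)[OF bounded[OF B] invN[OF B] invN[OF adjoint_in[OF B]]], of x] by simp
  qed
  ultimately obtain c where c: "F = c \<cdot>\<^sub>C \<I>" using center by blast
  have Fc: "F x = c *\<^sub>C x" for x by (simp add: c op_expand)
  obtain x where x: "P x \<noteq> 0" using P(2) by (metis blinfun_eqI blinfun.zero_left)
  obtain y where y: "R y \<noteq> 0" using R(2) by (metis blinfun_eqI blinfun.zero_left)
  have "P x \<in> M" unfolding M_def using all0 by blast
  then have Px: "c *\<^sub>C P x = P x" using F(4)[of "P x"] by (simp add: Fc)
  have "R (F (R y)) = 0" using F(3)[of "R y"] mem_id unfolding M_def by force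
  then have "c *\<^sub>C R y = 0" by (simp add: Fc bounded_operatorsD[OF bounded[OF Rd(1)]] Rd(3))
  then have "cmod c * norm (R y) = 0" by (metis norm_scaleC norm_zero)
  then have "c = 0" using y by simp
  with Px x show False using norm_scaleC[of 0 "P x"] by simp
qed

text \<open>\<open>E\<close> and \<open>F\<close> are the range projections of the positive and negative parts of a self-adjoint
  off-diagonal element, which the symmetry \<open>I - 2R\<close> interchanges.\<close>
lemma swapped_projections:
  assumes P: "P \<in> projections N" "P \<noteq> 0" and R: "R \<in> projections N" "R \<noteq> 0"
    and PR: "\<And>x. P (R x) = 0"
  obtains E F where "E \<in> projections N" "F \<in> projections N" "E \<noteq> 0"
    "\<And>x. E (F x) = 0" "\<And>x. F (E x) = 0"
    "\<And>x. E (x - 2 *\<^sub>R R x) = F x - 2 *\<^sub>R R (F x)" "\<And>x. F (x - 2 *\<^sub>R R x) = E x - 2 *\<^sub>R R (E x)"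
    "\<And>x. E (P x + R x) = E x" "\<And>x. F (P x + R x) = F x"
proof -
  note Pd = projectionsD[OF P(1)] and Rd = projectionsD[OF R(1)]
  note Psa = projection_selfadj[OF P(1)] and Rsa = projection_selfadj[OF R(1)]
  have RP: "R (P x) = 0" for x by (rule selfadj_mult_zero_commute[OF Psa Rsa PR])
  obtain A where A: "A \<in> N" "R o\<^sub>L (A o\<^sub>L P) \<noteq> 0"
    using nonzero_corner[OF P R] by blast
  define B where "B = (R o\<^sub>L (A o\<^sub>L P)) + (P o\<^sub>L (A\<^sup>\<dagger> o\<^sub>L R))"
  have Bx: "B x = R (A (P x)) + P ((A\<^sup>\<dagger>) (R x))" for x by (simp add: B_def op_expand)
  have BN: "B \<in> N" unfolding B_def by (intro mem_intros A Pd Rd)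
  have Bsa: "selfadj B"
    by (rule selfadjI[OF bounded[OF BN]])
      (simp add: Bx inner_add_left inner_add_right selfadj_inner[OF Psa] selfadj_inner[OF Rsa]
        adjoint_inner[OF bounded[OF A(1)]] adjoint_inner'[OF bounded[OF A(1)]])
  define b where "b = norm B"
  have b: "op_between (- b) b B" unfolding b_def by (rule selfadj_op_between_norm[OF Bsa])
  define W where "W = \<I> - 2 *\<^sub>R R"
  have Wx: "W x = x - 2 *\<^sub>R R x" for x by (simp add: W_def op_expand)
  have WW: "W (W x) = x" for x 
  proof -
    have "4 *\<^sub>R R x = 2 *\<^sub>R R x + 2 *\<^sub>R R x" by (simp flip: scaleR_add_left)
    then show ?thesis by (simp add: Wx op_expand Rd(3) scaleR_diff_right algebra_simps)
  qed
  have WB: "W (B x) = - B (W x)" for x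
    by (simp add: Wx Bx op_expand Rd(3) Pd(3) PR RP algebra_simps scaleR_2)
  define fp fm :: "real \<Rightarrow> real" where "fp t = max 0 t" and "fm t = max 0 (- t)" for t
  have cont: "continuous_on S fp" "continuous_on S fm" for S
    unfolding fp_def fm_def by (intro continuous_intros)+
  define Bp Bm where "Bp = op_fun fp B" and "Bm = op_fun fm B"
  have Bpm: "Bp \<in> N" "Bm \<in> N" "selfadj Bp" "selfadj Bm"
    unfolding Bp_def Bm_def by (rule mem_op_fun[OF b cont(1) BN] mem_op_fun[OF b cont(2) BN]
        op_fun_selfadj[OF b cont(1)] op_fun_selfadj[OF b cont(2)])+
  have "B = op_fun (\<lambda>t. fp t - fm t) B"
    using op_fun_id[OF b] op_fun_cong[OF b continuous_on_id, of "\<lambda>t. fp t - fm t"]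
    by (simp add: fp_def fm_def)
  then have B_diff: "B = Bp - Bm" unfolding op_fun_diff[OF b cont] Bp_def Bm_def .
  have "Bp o\<^sub>L Bm = op_fun (\<lambda>t. 0) B"
    unfolding Bp_def Bm_def op_fun_mult[OF b cont, symmetric]
    by (rule op_fun_cong[OF b continuous_on_mult[OF cont]]) (auto simp: fp_def fm_def max_def)
  then have BpBm: "Bp o\<^sub>L Bm = 0" by (simp add: op_fun_const[OF b])
  have neg: "op_fun (\<lambda>t. 0 + (- 1) * t) B = - B" unfolding op_fun_affine[OF b] by simp
  have neg_between: "op_between (- b) b (- B)"
    unfolding neg[symmetric] by (rule op_fun_between[OF b]) (auto intro!: continuous_intros)
  have neg_p: "op_fun fp (- B) = Bm"
  proof -
    have "op_fun fp (op_fun (\<lambda>t. 0 + (- 1) * t) B) = op_fun (\<lambda>t. fp (0 + (- 1) * t)) B"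
      by (rule op_fun_compose[OF b, where c = "- b" and d = b]) (auto intro!: continuous_intros cont)
    then show ?thesis unfolding neg Bm_def fp_def fm_def by simp
  qed
  have "B o\<^sub>L W = W o\<^sub>L - B" by (rule blinfun_eqI) (simp add: op_expand WB)
  then have BpW': "Bp o\<^sub>L W = W o\<^sub>L Bm"
    using op_fun_intertwine[OF b neg_between cont(1)] unfolding neg_p Bp_def by blast
  have BpW: "Bp (W x) = W (Bm x)" for x using op_eqD[OF BpW', of x] by simp
  have BmW: "Bm (W x) = W (Bp x)" for x
    using arg_cong[OF BpW[of "W x"], of "blinfun_apply W"] by (simp add: WW)
  obtain E where E: "E \<in> projections N" "\<And>x. Bp (E x) = Bp x" "\<And>x. E (Bp x) = Bp x"
    "\<And>Y :: 'h op. Bp o\<^sub>L Y = 0 \<Longrightarrow> E o\<^sub>L Y = 0"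
    using range_projection[OF Bpm(1,3)] by blast
  obtain F where F: "F \<in> projections N" "\<And>x. Bm (F x) = Bm x" "\<And>x. F (Bm x) = Bm x"
    "\<And>Y :: 'h op. Bm o\<^sub>L Y = 0 \<Longrightarrow> F o\<^sub>L Y = 0"
    using range_projection[OF Bpm(2,4)] by blast
  note Esa = projection_selfadj[OF E(1)] and Fsa = projection_selfadj[OF F(1)]
  have "E (Bm x) = 0" for x using op_eqD[OF E(4)[OF BpBm], of x] by simp
  then have "Bm (E x) = 0" for x by (rule selfadj_mult_zero_commute[OF Esa Bpm(4)])
  then have "Bm o\<^sub>L E = 0" by (intro blinfun_eqI) simp
  then have FE: "F (E x) = 0" for x using op_eqD[OF F(4), of E x] by simp
  then have EF: "E (F x) = 0" for x by (rule selfadj_mult_zero_commute[OF Fsa Esa])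
  have Wsa: "W x \<bullet> y = x \<bullet> W y" for x y
    by (simp add: Wx inner_diff_left inner_diff_right selfadj_inner[OF Rsa])
  have "Bp o\<^sub>L (W o\<^sub>L (\<I> - F)) = 0"
    by (rule blinfun_eqI) (simp add: op_expand BpW F(2))
  then have EWF: "E (W x) = E (W (F x))" for x
    using op_eqD[OF E(4), of "W o\<^sub>L (\<I> - F)" x] by (simp add: op_expand)
  have "Bm o\<^sub>L (W o\<^sub>L (\<I> - E)) = 0"
    by (rule blinfun_eqI) (simp add: op_expand BmW E(2))
  then have FWE: "F (W x) = F (W (E x))" for x
    using op_eqD[OF F(4), of "W o\<^sub>L (\<I> - E)" x] by (simp add: op_expand)
  have "W (F x) = E (W (F x))" for x
  proof (rule vector_eqI)
    fix y
    have "y \<bullet> W (F x) = F (W y) \<bullet> x" by (simp only: Wsa selfadj_inner[OF Fsa])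
    also have "\<dots> = F (W (E y)) \<bullet> x" by (simp only: FWE[of y])
    also have "\<dots> = y \<bullet> E (W (F x))" by (simp only: Wsa selfadj_inner[OF Fsa] selfadj_inner[OF Esa])
    finally show "y \<bullet> W (F x) = y \<bullet> E (W (F x))" .
  qed
  then have EW: "E (W x) = W (F x)" for x using EWF[of x] by simp
  have FW: "F (W x) = W (E x)" for x using arg_cong[OF EW[of "W x"], of "blinfun_apply W"] by (simp add: WW)
  define Y where "Y = \<I> - P - R"
  have BY: "B o\<^sub>L Y = Y o\<^sub>L (0 *\<^sub>R \<I>)"
    by (rule blinfun_eqI) (simp add: Y_def Bx op_expand Pd(3) Rd(3) PR RP)
  have b0: "0 \<le> b" by (simp add: b_def)
  have zb: "op_between (- b) b (0 *\<^sub>R \<I> :: 'h op)" by (rule op_between_scaleR_id) (use b0 in auto)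
  have z: "op_fun fp (0 *\<^sub>R \<I>) = fp 0 *\<^sub>R (\<I> :: 'h op)" "op_fun fm (0 *\<^sub>R \<I>) = fm 0 *\<^sub>R (\<I> :: 'h op)"
    by (rule op_fun_scaleR_id[OF _ _ cont(1)] op_fun_scaleR_id[OF _ _ cont(2)]; use b0 in auto)+
  have "Bp o\<^sub>L Y = 0" "Bm o\<^sub>L Y = 0"
    using op_fun_intertwine[OF b zb cont(1) BY] op_fun_intertwine[OF b zb cont(2) BY]
    unfolding z Bp_def Bm_def fp_def fm_def by simp_all
  then have EY: "E o\<^sub>L Y = 0" "F o\<^sub>L Y = 0" using E(4) F(4) by blast+
  have E0: "E \<noteq> 0"
  proof
    assume "E = 0"
    then have "Bp x = 0" for x using E(3)[of x] by simp
    then have "Bm x = 0" for x using BmW[of "W x"] by (simp add: WW blinfun.zero_right)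
    then have "B x = 0" for x using \<open>\<And>x. Bp x = 0\<close> by (simp add: B_diff op_expand)
    then have "R (A (P x)) + P ((A\<^sup>\<dagger>) (R x)) = 0" for x by (simp add: Bx[symmetric])
    then have "R (R (A (P x)) + P ((A\<^sup>\<dagger>) (R x))) = 0" for x by (simp add: blinfun.zero_right)
    then have "R (A (P x)) = 0" for x by (simp add: blinfun.add_right RP Rd(3))
    then have "R o\<^sub>L (A o\<^sub>L P) = 0" by (intro blinfun_eqI) simp
    with A(2) show False by simp
  qed
  show ?thesis
  proof (rule that[OF E(1) F(1) E0 EF FE])
    show "E (x - 2 *\<^sub>R R x) = F x - 2 *\<^sub>R R (F x)" "F (x - 2 *\<^sub>R R x) = E x - 2 *\<^sub>R R (E x)" for x
      using EW[of x] FW[of x] by (simp_all only: Wx)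
    show "E (P x + R x) = E x" "F (P x + R x) = F x" for x
      using op_eqD[OF EY(1), of x] op_eqD[OF EY(2), of x] by (simp_all add: Y_def op_expand algebra_simps)
  qed
qed

end

context vn_algebra
begin

definition partial_isometry :: "'h op \<Rightarrow> bool" where
  "partial_isometry V \<longleftrightarrow> V \<in> N \<and> (\<forall>x. V ((V\<^sup>\<dagger>) (V x)) = V x)"

definition extends :: "'h op \<Rightarrow> 'h op \<Rightarrow> bool" where
  "extends V W \<longleftrightarrow> (\<forall>x. W ((V\<^sup>\<dagger>) (V x)) = V x)"

lemma partial_isometryD:
  assumes V: "partial_isometry V"
  shows "V \<in> N" "V ((V\<^sup>\<dagger>) (V x)) = V x" "(V\<^sup>\<dagger>) (V ((V\<^sup>\<dagger>) x)) = (V\<^sup>\<dagger>) x"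
proof -
  show VN: "V \<in> N" and VV: "V ((V\<^sup>\<dagger>) (V x)) = V x" for x
    using V by (auto simp: partial_isometry_def)
  note i = adjoint_inner[OF bounded[OF VN]] adjoint_inner'[OF bounded[OF VN]]
  show "(V\<^sup>\<dagger>) (V ((V\<^sup>\<dagger>) x)) = (V\<^sup>\<dagger>) x"
    by (rule vector_eqI) (simp only: i[symmetric] VV)
qed

lemma partial_isometry_final:
  assumes V: "partial_isometry V"
  shows "V o\<^sub>L V\<^sup>\<dagger> \<in> projections N"
proof (rule projectionI)
  note VN = partial_isometryD(1)[OF V] and i = adjoint_inner[OF bounded[OF partial_isometryD(1)[OF V]]]
    adjoint_inner'[OF bounded[OF partial_isometryD(1)[OF V]]]
  show "V o\<^sub>L V\<^sup>\<dagger> \<in> N" by (intro mem_intros VN)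
  then show "selfadj (V o\<^sub>L V\<^sup>\<dagger>)" by (intro selfadjI bounded) (simp_all add: i)
qed (simp add: partial_isometryD[OF V])

lemma partial_isometry_norm_le:
  assumes V: "partial_isometry V"
  shows "norm (V x) \<le> norm x"
proof (cases "V x = 0")
  case False
  note i = adjoint_inner[OF bounded[OF partial_isometryD(1)[OF V]]]
  let ?p = "(V\<^sup>\<dagger>) (V x)"
  have pp: "?p \<bullet> ?p = V x \<bullet> V x"
    using i[of ?p "V x"] i[of x "V x"] by (simp add: partial_isometryD[OF V])
  then have np: "norm ?p = norm (V x)" by (simp add: norm_eq_sqrt_inner)
  have "norm (V x) * norm (V x) = x \<bullet> ?p"
    using i[of x "V x"] by (simp add: dot_square_norm power2_eq_square)
  also have "\<dots> \<le> norm x * norm (V x)" using norm_cauchy_schwarz[of x ?p] unfolding np .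
  finally show ?thesis using False by simp
qed simp

lemma extends_initial:
  assumes V: "partial_isometry V" and W: "partial_isometry W" and e: "extends V W"
  shows "(W\<^sup>\<dagger>) (W ((V\<^sup>\<dagger>) (V x))) = (V\<^sup>\<dagger>) (V x)" "(W\<^sup>\<dagger>) (V x) = (V\<^sup>\<dagger>) (V x)"
proof -
  note i = adjoint_inner[OF bounded[OF partial_isometryD(1)[OF V]]]
    adjoint_inner[OF bounded[OF partial_isometryD(1)[OF W]]]
  have e': "W ((V\<^sup>\<dagger>) (V x)) = V x" for x using e by (simp add: extends_def)
  define px where "px = (V\<^sup>\<dagger>) (V x)"
  have Wp: "W px = V x" unfolding px_def by (rule e')
  have nn: "px \<bullet> px = V x \<bullet> V x"
    using i(1)[of px "V x"] i(1)[of x "V x"] by (simp add: px_def partial_isometryD[OF V])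
  have qq: "(W\<^sup>\<dagger>) (W px) \<bullet> (W\<^sup>\<dagger>) (W px) = W px \<bullet> W px"
    using i(2)[of "(W\<^sup>\<dagger>) (W px)" "W px"] i(2)[of px "W px"] by (simp add: partial_isometryD[OF W])
  have qp: "px \<bullet> (W\<^sup>\<dagger>) (W px) = W px \<bullet> W px" by (rule i(2)[symmetric])
  have "((W\<^sup>\<dagger>) (W px) - px) \<bullet> ((W\<^sup>\<dagger>) (W px) - px) = 0"
    using qq qp nn unfolding Wp by (simp add: inner_diff_left inner_diff_right inner_commute)
  then show 1: "(W\<^sup>\<dagger>) (W ((V\<^sup>\<dagger>) (V x))) = (V\<^sup>\<dagger>) (V x)" by (simp add: px_def)
  then show "(W\<^sup>\<dagger>) (V x) = (V\<^sup>\<dagger>) (V x)" by (simp add: e')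
qed

lemma extends_trans:
  assumes "partial_isometry V" "partial_isometry W" "extends V W" "extends W X"
  shows "extends V X"
  using extends_initial(1)[OF assms(1-3)] assms(3,4) unfolding extends_def by metis

lemma extends_norm_diff:
  assumes V: "partial_isometry V" and W: "partial_isometry W" and e: "extends V W"
  shows "(norm (W x - V x))\<^sup>2 = (norm (W x))\<^sup>2 - (norm (V x))\<^sup>2"
proof -
  have "W x \<bullet> V x = x \<bullet> (W\<^sup>\<dagger>) (V x)" by (rule adjoint_inner[OF bounded[OF partial_isometryD(1)[OF W]]])
  also have "\<dots> = x \<bullet> (V\<^sup>\<dagger>) (V x)" unfolding extends_initial(2)[OF V W e] ..
  also have "\<dots> = V x \<bullet> V x" by (rule adjoint_inner[OF bounded[OF partial_isometryD(1)[OF V]], symmetric])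
  finally have "W x \<bullet> V x = V x \<bullet> V x" .
  then show ?thesis
    unfolding power2_norm_eq_inner by (simp add: inner_diff_left inner_diff_right inner_commute)
qed

lemma extends_antisym:
  assumes V: "partial_isometry V" and W: "partial_isometry W" and "extends V W" "extends W V"
  shows "V = W"
proof (rule blinfun_eqI)
  fix x
  have "(norm (W x - V x))\<^sup>2 = 0"
    using extends_norm_diff[OF V W assms(3), of x] extends_norm_diff[OF W V assms(4), of x]
    unfolding norm_minus_commute[of "V x"] by linarith
  then show "V x = W x" by simp
qed

lemma extends_refl: "partial_isometry V \<Longrightarrow> extends V V"
  by (simp add: extends_def partial_isometry_def)

text \<open>The limit is taken in the strong operator topology.\<close>
lemma partial_isometry_chain_limit:
  assumes C0: "C \<noteq> {}" and pC: "\<And>V. V \<in> C \<Longrightarrow> partial_isometry V"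
    and chain: "\<And>V W. V \<in> C \<Longrightarrow> W \<in> C \<Longrightarrow> extends V W \<or> extends W V"
  obtains S where "partial_isometry S" "\<And>V. V \<in> C \<Longrightarrow> extends V S"
    "\<And>x. S x \<in> closure ((\<lambda>V. blinfun_apply V x) ` C)"
proof -
  define F where "F = (INF V\<in>C. principal {W \<in> C. extends V W})"
  have ev: "eventually Q F \<longleftrightarrow> (\<exists>V\<in>C. \<forall>W\<in>C. extends V W \<longrightarrow> Q W)" for Q
    unfolding F_def
  proof (subst eventually_INF_base[OF C0])
    fix V W assume V: "V \<in> C" and W: "W \<in> C"
    show "\<exists>X\<in>C. principal {Y \<in> C. extends X Y}
        \<le> inf (principal {Y \<in> C. extends V Y}) (principal {Y \<in> C. extends W Y})"
      using chain[OF V W]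
    proof
      assume "extends V W"
      then show ?thesis using V W extends_trans[OF pC[OF V] pC[OF W]] by (intro bexI[of _ W]) auto
    next
      assume "extends W V"
      then show ?thesis using V W extends_trans[OF pC[OF W] pC[OF V]] by (intro bexI[of _ V]) auto
    qed
  qed (auto simp: eventually_principal)
  have Fbot: "F \<noteq> bot"
    unfolding trivial_limit_def ev using extends_refl pC by blast
  have evC: "eventually (\<lambda>W. W \<in> C) F" unfolding ev using C0 by blast
  have evV: "eventually (\<lambda>W. W \<in> C \<and> extends V W) F" if "V \<in> C" for V unfolding ev using that by blast
  have "\<exists>y. ((\<lambda>V. blinfun_apply V x) \<longlongrightarrow> y) F" for x
  proof -
    define s where "s = (SUP V\<in>C. (norm (blinfun_apply V x))\<^sup>2)"
    have bdd: "bdd_above ((\<lambda>V. (norm (blinfun_apply V x))\<^sup>2) ` C)"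
      by (rule bdd_aboveI2[of _ _ "(norm x)\<^sup>2"]) (intro power_mono partial_isometry_norm_le pC norm_ge_zero)
    have up: "(norm (V x))\<^sup>2 \<le> s" if "V \<in> C" for V
      unfolding s_def by (rule cSUP_upper[OF that bdd])
    have "\<exists>V\<in>C. s - 1 / (real n + 1) < (norm (blinfun_apply V x))\<^sup>2" for n :: nat
      using less_cSUP_iff[OF C0 bdd, of "s - 1 / (real n + 1)"] unfolding s_def by simp
    then obtain T where TC: "\<And>n. T n \<in> C" and T: "\<And>n. s - 1 / (real n + 1) < (norm (T n x))\<^sup>2" by metis
    have close: "(norm (W x - T n x))\<^sup>2 \<le> 1 / (real n + 1)" if "W \<in> C" "extends (T n) W" for W n
      using extends_norm_diff[OF pC[OF TC] pC[OF that(1)] that(2), of x] up[OF that(1)] T[of n] by linarith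
    have small: "\<exists>k::nat. 1 / (real k + 1) < e\<^sup>2" if "0 < e" for e :: real
      using reals_Archimedean[of "e\<^sup>2"] that by (auto simp: inverse_eq_divide add.commute)
    have close': "norm (W x - T n x) < e"
      if "W \<in> C" "extends (T n) W" "1 / (real k + 1) < e\<^sup>2" "k \<le> n" "0 < e" for W n k e
    proof (rule power2_less_imp_less)
      have "1 / (real n + 1) \<le> 1 / (real k + 1)" using that(4) by (intro divide_left_mono) auto
      then show "(norm (W x - T n x))\<^sup>2 < e\<^sup>2" using close[OF that(1,2)] that(3) by linarith
    qed (use that in simp)
    have "Cauchy (\<lambda>n. T n x)"
    proof (rule metric_CauchyI)
      fix e :: real assume "0 < e"
      then obtain k :: nat where k: "1 / (real k + 1) < e\<^sup>2" using small by blast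
      have "dist (T m x) (T n x) < e" if "k \<le> m" "k \<le> n" for m n
        using chain[OF TC[of m] TC[of n]]
      proof
        assume "extends (T m) (T n)"
        from close'[OF TC this k that(1) \<open>0 < e\<close>] show ?thesis by (simp add: dist_norm norm_minus_commute)
      next
        assume "extends (T n) (T m)"
        from close'[OF TC this k that(2) \<open>0 < e\<close>] show ?thesis by (simp add: dist_norm)
      qed
      then show "\<exists>K. \<forall>m\<ge>K. \<forall>n\<ge>K. dist (T m x) (T n x) < e" by blast
    qed
    then obtain y where y: "(\<lambda>n. T n x) \<longlonglongrightarrow> y" using convergent_eq_Cauchy by blast
    have "((\<lambda>V. blinfun_apply V x) \<longlongrightarrow> y) F"
    proof (rule tendstoI)
      fix e :: real assume "0 < e"
      then have e2: "0 < e / 2" by simp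
      obtain k :: nat where k: "1 / (real k + 1) < (e / 2)\<^sup>2" using small[OF e2] by blast
      obtain m where m: "\<And>n. m \<le> n \<Longrightarrow> dist (T n x) y < e / 2"
        using tendstoD[OF y e2] unfolding eventually_sequentially by blast
      define n where "n = max k m"
      have "dist (W x) y < e" if "W \<in> C" "extends (T n) W" for W
      proof -
        have "k \<le> n" "m \<le> n" by (simp_all add: n_def)
        then have "dist (W x) (T n x) < e / 2" "dist (T n x) y < e / 2"
          using close'[OF that k _ e2] m by (simp_all add: dist_norm)
        then show ?thesis using dist_triangle[of "W x" y "T n x"] by linarith
      qed
      then show "eventually (\<lambda>W. dist (blinfun_apply W x) y < e) F" unfolding ev using TC by blast
    qed
    then show ?thesis by blast
  qed
  then obtain s where s: "\<And>x. ((\<lambda>V. blinfun_apply V x) \<longlongrightarrow> s x) F" by metis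
  have uniq: "s x = y" if "((\<lambda>V. blinfun_apply V x) \<longlongrightarrow> y) F" for x y
    by (rule tendsto_unique[OF Fbot s that])
  have bl: "bounded_linear s"
  proof (rule bounded_linear_intro[where K = 1])
    show "s (x + y) = s x + s y" for x y
      by (rule uniq) (simp only: blinfun.add_right, intro tendsto_add s)
    show "s (r *\<^sub>R x) = r *\<^sub>R s x" for r x
      by (rule uniq) (simp only: blinfun.scaleR_right, intro tendsto_scaleR tendsto_const s)
    show "norm (s x) \<le> norm x * 1" for x
      using tendsto_upperbound[OF tendsto_norm[OF s] _ Fbot, of x "norm x"]
        eventually_mono[OF evC] partial_isometry_norm_le[OF pC] by simp
  qed
  define S where "S = Blinfun s"
  have Ss: "S x = s x" for x unfolding S_def bounded_linear_Blinfun_apply[OF bl] ..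
  have SN: "S \<in> N"
  proof (rule memI)
    show "S \<in> bounded_operators"
    proof (rule bounded_operatorsI, unfold Ss, rule uniq)
      fix c x
      have "((\<lambda>V. c *\<^sub>C blinfun_apply V x) \<longlongrightarrow> c *\<^sub>C s x) F"
        by (rule bounded_linear.tendsto[OF bounded_linear_scaleC s])
      moreover have "eventually (\<lambda>V. c *\<^sub>C blinfun_apply V x = blinfun_apply V (c *\<^sub>C x)) F"
        using evC by eventually_elim (simp add: bounded_operatorsD[OF bounded[OF partial_isometryD(1)[OF pC]]])
      ultimately show "((\<lambda>V. blinfun_apply V (c *\<^sub>C x)) \<longlongrightarrow> c *\<^sub>C s x) F" by (rule Lim_transform_eventually)
    qed
    fix A x assume A: "A \<in> commutant N"
    have "((\<lambda>V. A (blinfun_apply V x)) \<longlongrightarrow> A (s x)) F"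
      by (rule bounded_linear.tendsto[OF blinfun.bounded_linear_right s])
    moreover have "eventually (\<lambda>V. A (blinfun_apply V x) = blinfun_apply V (A x)) F"
      using evC by eventually_elim (simp add: commute[OF partial_isometryD(1)[OF pC] A])
    ultimately have "((\<lambda>V. blinfun_apply V (A x)) \<longlongrightarrow> A (s x)) F" by (rule Lim_transform_eventually)
    then show "A (S x) = S (A x)" unfolding Ss by (rule uniq[symmetric])
  qed
  note iS = adjoint_inner[OF bounded[OF SN]] adjoint_inner'[OF bounded[OF SN]]
  have ext: "S ((V\<^sup>\<dagger>) (V x)) = V x" if V: "V \<in> C" for V x
    unfolding Ss
  proof (rule uniq, rule Lim_transform_eventually[OF tendsto_const])
    show "eventually (\<lambda>W. V x = blinfun_apply W ((V\<^sup>\<dagger>) (V x))) F"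
      using evV[OF V] by eventually_elim (simp add: extends_def)
  qed
  have SV: "(S\<^sup>\<dagger>) (V x) = (V\<^sup>\<dagger>) (V x)" if V: "V \<in> C" for V x
  proof (rule vector_eqI)
    fix y
    have "((\<lambda>W. blinfun_apply W y \<bullet> V x) \<longlongrightarrow> s y \<bullet> V x) F" by (intro tendsto_inner s tendsto_const)
    moreover have "((\<lambda>W. blinfun_apply W y \<bullet> V x) \<longlongrightarrow> y \<bullet> (V\<^sup>\<dagger>) (V x)) F"
    proof (rule Lim_transform_eventually[OF tendsto_const])
      show "eventually (\<lambda>W. y \<bullet> (V\<^sup>\<dagger>) (V x) = blinfun_apply W y \<bullet> V x) F"
        using evV[OF V]
      proof eventually_elim
        case (elim W)
        then have W: "partial_isometry W" using pC by blast
        show ?case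
          unfolding adjoint_inner[OF bounded[OF partial_isometryD(1)[OF W]]]
          using extends_initial(2)[OF pC[OF V] W] elim by simp
      qed
    qed
    ultimately have "s y \<bullet> V x = y \<bullet> (V\<^sup>\<dagger>) (V x)" by (rule tendsto_unique[OF Fbot])
    then show "y \<bullet> (S\<^sup>\<dagger>) (V x) = y \<bullet> (V\<^sup>\<dagger>) (V x)" by (simp add: iS(1)[symmetric] Ss)
  qed
  have VSS: "V ((S\<^sup>\<dagger>) (S x)) = V x" if V: "V \<in> C" for V x
  proof (rule vector_eqI)
    fix y
    note iV = adjoint_inner'[OF bounded[OF partial_isometryD(1)[OF pC[OF V]]]]
    have "S ((V\<^sup>\<dagger>) y) = V ((V\<^sup>\<dagger>) y)"
      using ext[OF V, of "(V\<^sup>\<dagger>) y"] partial_isometryD(3)[OF pC[OF V], of y] by simp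
    then have "(S\<^sup>\<dagger>) (S ((V\<^sup>\<dagger>) y)) = (V\<^sup>\<dagger>) y"
      using SV[OF V, of "(V\<^sup>\<dagger>) y"] partial_isometryD(3)[OF pC[OF V], of y] by simp
    then show "y \<bullet> V ((S\<^sup>\<dagger>) (S x)) = y \<bullet> V x"
      by (simp only: iV[symmetric] iS[symmetric])
  qed
  have "S ((S\<^sup>\<dagger>) (S x)) = S x" for x
  proof -
    have "s ((S\<^sup>\<dagger>) (S x)) = s x"
    proof (rule uniq, rule Lim_transform_eventually[OF s])
      show "eventually (\<lambda>V. blinfun_apply V x = blinfun_apply V ((S\<^sup>\<dagger>) (S x))) F"
        using evC by eventually_elim (simp add: VSS)
    qed
    then show ?thesis by (simp add: Ss)
  qed
  then have pS: "partial_isometry S" using SN by (simp add: partial_isometry_def)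
  have cl: "S x \<in> closure ((\<lambda>V. blinfun_apply V x) ` C)" for x
  proof (rule Lim_in_closed_set[OF closed_closure _ Fbot])
    show "((\<lambda>V. blinfun_apply V x) \<longlongrightarrow> S x) F" using s by (simp add: Ss)
    show "eventually (\<lambda>V. blinfun_apply V x \<in> closure ((\<lambda>V. blinfun_apply V x) ` C)) F"
      using evC by (rule eventually_mono) (rule subsetD[OF closure_subset], rule imageI)
  qed
  show ?thesis by (rule that[OF pS _ cl]) (simp add: extends_def ext)
qed

end

context factor_algebra
begin

lemma connecting_partial_isometry:
  assumes P: "P \<in> projections N" "P \<noteq> 0" and R: "R \<in> projections N" "R \<noteq> 0"
    and PR: "\<And>x. P (R x) = 0"
  obtains V where "partial_isometry V" "V \<noteq> 0" "\<And>x. V (P x) = V x" "\<And>x. R (V x) = V x"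
proof -
  note Pd = projectionsD[OF P(1)] and Rd = projectionsD[OF R(1)]
  note Rsa = projection_selfadj[OF R(1)]
  obtain E F where EN: "E \<in> projections N" and FN: "F \<in> projections N" and E0: "E \<noteq> 0"
    and EF: "\<And>x. E (F x) = 0" and FE: "\<And>x. F (E x) = 0"
    and EW: "\<And>x. E (x - 2 *\<^sub>R R x) = F x - 2 *\<^sub>R R (F x)"
    and FW: "\<And>x. F (x - 2 *\<^sub>R R x) = E x - 2 *\<^sub>R R (E x)"
    and e: "\<And>x. E (P x + R x) = E x" "\<And>x. F (P x + R x) = F x"
    using swapped_projections[OF P R PR] by blast
  note Ed = projectionsD[OF EN] and Fd = projectionsD[OF FN]
  note Esa = projection_selfadj[OF EN] and Fsa = projection_selfadj[OF FN]
  define X where "X = E - F"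
  have Xx: "X x = E x - F x" for x by (simp add: X_def op_expand)
  have XN: "X \<in> N" unfolding X_def by (intro mem_intros Ed Fd)
  have Xsa: "selfadj X"
    by (rule selfadjI[OF bounded[OF XN]])
      (simp add: Xx inner_diff_left inner_diff_right selfadj_inner[OF Esa] selfadj_inner[OF Fsa])
  have X3: "X (X (X x)) = X x" for x
    by (simp add: Xx op_expand Ed(3) Fd(3) EF FE)
  have anti: "X (R x) + R (X x) = X x" for x
  proof -
    have "X (x - 2 *\<^sub>R R x) = 2 *\<^sub>R R (X x) - X x"
      unfolding Xx EW FW by (simp add: op_expand algebra_simps)
    then have "2 *\<^sub>R (X (R x) + R (X x)) = 2 *\<^sub>R X x"
      by (simp add: op_expand algebra_simps scaleR_2)
    then show ?thesis by (simp only: scaleR_cancel_left) simp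
  qed
  have XP: "X (P x) = R (X x)" for x
  proof -
    have "X (P x + R x) = X x" unfolding Xx e ..
    then have "X (P x) = X x - X (R x)" by (simp add: op_expand algebra_simps)
    also have "\<dots> = X (R x) + R (X x) - X (R x)" unfolding anti ..
    finally show ?thesis by simp
  qed
  define V where "V = R o\<^sub>L X"
  have Vx: "V x = R (X x)" for x by (simp add: V_def)
  have VN: "V \<in> N" unfolding V_def by (intro mem_intros Rd XN)
  have Vadj: "(V\<^sup>\<dagger>) x = X (R x)" for x
  proof -
    have "V\<^sup>\<dagger> = X o\<^sub>L R"
      by (rule adjoint_eqI[OF bounded[OF VN]]) (simp add: Vx selfadj_inner[OF Rsa] selfadj_inner[OF Xsa])
    then show ?thesis by simp
  qed
  have "V ((V\<^sup>\<dagger>) (V x)) = V x" for x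
  proof -
    have "V ((V\<^sup>\<dagger>) (V x)) = R (X (X (X (P x))))" by (simp add: Vadj Vx Rd(3) Pd(3) XP[symmetric])
    also have "\<dots> = R (X (P x))" by (simp only: X3)
    also have "\<dots> = V x" by (simp add: XP Vx Rd(3))
    finally show ?thesis .
  qed
  then have pV: "partial_isometry V" using VN by (simp add: partial_isometry_def)
  show ?thesis
  proof (rule that[OF pV])
    show "V (P x) = V x" for x by (simp add: Vx XP Rd(3))
    show "R (V x) = V x" for x by (simp add: Vx Rd(3))
    show "V \<noteq> 0"
    proof
      assume "V = 0"
      then have RX: "R (X x) = 0" for x using Vx[of x] by simp
      then have "X (R x) = 0" for x by (rule selfadj_mult_zero_commute[OF Rsa Xsa])
      then have "X x = 0" for x using anti[of x] RX[of x] by simp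
      then have "E (X x) = 0" for x by (simp add: blinfun.zero_right)
      then have "E x = 0" for x by (simp add: Xx op_expand Ed(3) EF)
      then have "E = 0" by (intro blinfun_eqI) simp
      with E0 show False by simp
    qed
  qed
qed

lemma comparison:
  assumes D: "D \<in> projections N" and G: "G \<in> projections N" and DG: "\<And>x. D (G x) = 0"
  obtains V where "partial_isometry V" "\<And>x. V (D x) = V x" "\<And>x. G (V x) = V x"
    "(\<forall>x. (V\<^sup>\<dagger>) (V x) = D x) \<or> (\<forall>x. V ((V\<^sup>\<dagger>) x) = G x)"
proof -
  define X where "X = {V. partial_isometry V \<and> (\<forall>x. V (D x) = V x) \<and> (\<forall>x. G (V x) = V x)}"
  have XD: "partial_isometry V" "V (D x) = V x" "G (V x) = V x" if "V \<in> X" for V x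
    using that by (auto simp: X_def)
  have po: "partial_order_on X (relation_of extends X)"
    by (rule partial_order_on_relation_ofI)
      (blast intro: extends_refl extends_trans extends_antisym XD(1))+
  have chains: "\<exists>S\<in>X. \<forall>V\<in>C. extends V S" if C: "C \<in> Chains (relation_of extends X)" for C
  proof (cases "C = {}")
    case True
    have "0 \<in> X" unfolding X_def by (simp add: partial_isometry_def mem_zero blinfun.zero_right)
    then show ?thesis using True by blast
  next
    case False
    have CX: "V \<in> X" if "V \<in> C" for V using C that by (auto simp: Chains_def relation_of_def)
    have ch: "extends V W \<or> extends W V" if "V \<in> C" "W \<in> C" for V W
      using C that by (auto simp: Chains_def relation_of_def)
    obtain S where S: "partial_isometry S" "\<And>V. V \<in> C \<Longrightarrow> extends V S"
      "\<And>x. S x \<in> closure ((\<lambda>V. blinfun_apply V x) ` C)"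
      by (rule partial_isometry_chain_limit[OF False XD(1)[OF CX] ch]) blast+
    have "S (D x) = S x" for x
    proof -
      have "S (D x - x) \<in> closure {0}"
        by (rule subsetD[OF closure_mono S(3)]) (auto simp: blinfun.diff_right XD(2)[OF CX])
      then show ?thesis by (simp add: blinfun.diff_right)
    qed
    moreover have "G (S x) = S x" for x
    proof -
      have "closed {y. G y = y}"
        by (intro closed_Collect_eq linear_continuous_on blinfun.bounded_linear_right continuous_on_id)
      then have "closure ((\<lambda>V. blinfun_apply V x) ` C) \<subseteq> {y. G y = y}"
        by (rule closure_minimal[rotated]) (auto simp: XD(3)[OF CX])
      then show ?thesis using S(3)[of x] by blast
    qed
    ultimately show ?thesis using S(1,2) unfolding X_def by blast
  qed
  obtain V where VX: "V \<in> X" and max: "\<And>W. W \<in> X \<Longrightarrow> extends V W \<Longrightarrow> W = V"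
    using predicate_Zorn[OF po chains] by blast
  note V = XD[OF VX]
  note Vd = partial_isometryD[OF V(1)]
  note iV = adjoint_inner[OF bounded[OF Vd(1)]] adjoint_inner'[OF bounded[OF Vd(1)]]
  note Dd = projectionsD[OF D] and Gd = projectionsD[OF G]
  note Dsa = projection_selfadj[OF D] and Gsa = projection_selfadj[OF G]
  have DV: "D ((V\<^sup>\<dagger>) x) = (V\<^sup>\<dagger>) x" for x
    by (rule vector_eqI) (simp only: selfadj_inner[OF Dsa, symmetric] iV(1)[symmetric] V(2))
  have VG: "(V\<^sup>\<dagger>) (G x) = (V\<^sup>\<dagger>) x" for x
    by (rule vector_eqI) (simp only: selfadj_inner[OF Gsa, symmetric] iV(1)[symmetric] V(3))
  have "(\<forall>x. (V\<^sup>\<dagger>) (V x) = D x) \<or> (\<forall>x. V ((V\<^sup>\<dagger>) x) = G x)"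
  proof (rule ccontr)
    assume no: "\<not> ?thesis"
    define P R where "P = D - (V\<^sup>\<dagger> o\<^sub>L V)" and "R = G - (V o\<^sub>L V\<^sup>\<dagger>)"
    have Px: "P x = D x - (V\<^sup>\<dagger>) (V x)" and Rx: "R x = G x - V ((V\<^sup>\<dagger>) x)" for x
      by (simp_all add: P_def R_def op_expand)
    have PN: "P \<in> N" and RN: "R \<in> N" unfolding P_def R_def by (intro mem_intros Dd Gd Vd)+
    have Pp: "P \<in> projections N"
    proof (rule projectionI[OF PN])
      show "selfadj P"
        by (rule selfadjI[OF bounded[OF PN]])
          (simp add: Px inner_diff_left inner_diff_right selfadj_inner[OF Dsa] iV)
      show "P (P x) = P x" for x by (simp add: Px op_expand Dd(3) V(2) DV Vd)
    qed
    have Rp: "R \<in> projections N"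
    proof (rule projectionI[OF RN])
      show "selfadj R"
        by (rule selfadjI[OF bounded[OF RN]])
          (simp add: Rx inner_diff_left inner_diff_right selfadj_inner[OF Gsa] iV)
      show "R (R x) = R x" for x by (simp add: Rx op_expand Gd(3) V(3) VG Vd)
    qed
    have DVx: "D (V x) = 0" for x using DG[of "V x"] by (simp add: V(3))
    have VV: "V (V x) = 0" for x using V(2)[of "V x"] by (simp add: DVx blinfun.zero_right)
    have VGx: "V (G x) = 0" for x using V(2)[of "G x"] by (simp add: DG blinfun.zero_right)
    have PR: "P (R x) = 0" for x
      by (simp add: Px Rx op_expand DG DVx VGx VV blinfun.zero_right)
    have "P \<noteq> 0" "R \<noteq> 0" using no Px Rx by auto
    then obtain T where T: "partial_isometry T" "T \<noteq> 0" "\<And>x. T (P x) = T x" "\<And>x. R (T x) = T x"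
      using connecting_partial_isometry[OF Pp _ Rp _ PR] by blast
    note Td = partial_isometryD[OF T(1)]
    note iT = adjoint_inner[OF bounded[OF Td(1)]] adjoint_inner'[OF bounded[OF Td(1)]]
    have VT: "(V\<^sup>\<dagger>) (T x) = 0" for x
    proof -
      have "(V\<^sup>\<dagger>) (R (T x)) = 0" unfolding Rx by (simp add: op_expand VG Vd)
      then show ?thesis by (simp add: T(4))
    qed
    have TV': "T ((V\<^sup>\<dagger>) x) = 0" for x
    proof -
      have "T (P ((V\<^sup>\<dagger>) x)) = 0" unfolding Px by (simp add: DV Vd blinfun.zero_right)
      then show ?thesis by (simp add: T(3))
    qed
    have TV: "(T\<^sup>\<dagger>) (V x) = 0" for x
    proof (rule vector_eqI)
      show "y \<bullet> (T\<^sup>\<dagger>) (V x) = y \<bullet> 0" for y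
        using iV(1)[of x "T y"] by (simp add: iT(1)[symmetric] VT inner_commute)
    qed
    have VT': "V ((T\<^sup>\<dagger>) x) = 0" for x
      by (rule vector_eqI) (simp add: iV(2)[symmetric] iT(1)[symmetric] TV')
    define W where "W = V + T"
    have Wx: "W x = V x + T x" for x by (simp add: W_def op_expand)
    have Wadj: "(W\<^sup>\<dagger>) x = (V\<^sup>\<dagger>) x + (T\<^sup>\<dagger>) x" for x
      unfolding W_def adjoint_binary(1)[OF bounded[OF Vd(1)] bounded[OF Td(1)]] by (simp add: op_expand)
    have WN: "W \<in> N" unfolding W_def by (intro mem_intros Vd Td)
    have pW: "partial_isometry W"
      unfolding partial_isometry_def
      by (intro conjI allI WN) (simp add: Wx Wadj op_expand Vd Td VT TV VT' TV')
    have TD: "T (D x) = T x" for x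
    proof -
      have "T (P (D x)) = T (P x)" by (simp add: Px Dd(3) V(2))
      then show ?thesis by (simp add: T(3))
    qed
    have GT: "G (T x) = T x" for x
    proof -
      have "G (R (T x)) = R (T x)" by (simp add: Rx op_expand Gd(3) V(3))
      then show ?thesis by (simp add: T(4))
    qed
    have "W \<in> X" unfolding X_def using pW by (simp add: Wx op_expand V(2,3) TD GT)
    moreover have "extends V W" unfolding extends_def by (simp add: Wx Vd TV')
    ultimately have "W = V" by (rule max)
    then have "T = 0" by (simp add: W_def)
    with T(2) show False ..
  qed
  with that[OF V] show ?thesis by blast
qed

end

subsection \<open>Faithfulness of the trace\<close>

locale tracial_II1_factor = tracial_vn_algebra N \<tau> + factor_algebra N
  for N :: "('h::complex_hilbert) op set" and \<tau> +
  assumes finite: "finite_projection N \<I>"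
begin

text \<open>Finite stages of the shift that violates finiteness: the initial projection of \<open>S\<close> is dominated by \<open>P\<close> plus
  the final projection, which is orthogonal to \<open>P\<close>.\<close>
definition shift_stage :: "'h op \<Rightarrow> 'h op \<Rightarrow> bool" where
  "shift_stage P S \<longleftrightarrow> partial_isometry S \<and> (\<forall>x. P (S x) = 0) \<and>
     (\<forall>x. P ((S\<^sup>\<dagger>) (S x)) + S ((S\<^sup>\<dagger>) ((S\<^sup>\<dagger>) (S x))) = (S\<^sup>\<dagger>) (S x)) \<and> tr (S o\<^sub>L S\<^sup>\<dagger>) = 0"

lemma shift_stage_step:
  assumes P: "P \<in> projections N" and P0: "tr P = 0" and S: "shift_stage P S"
  shows "\<exists>S'. shift_stage P S' \<and> extends S S' \<and> (\<forall>x. (S'\<^sup>\<dagger>) (S' x) = P x + S ((S\<^sup>\<dagger>) x))"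
proof -
  note Pd = projectionsD[OF P] and Psa = projection_selfadj[OF P]
  have pS: "partial_isometry S" and PS: "\<And>x. P (S x) = 0"
    and q: "\<And>x. P ((S\<^sup>\<dagger>) (S x)) + S ((S\<^sup>\<dagger>) ((S\<^sup>\<dagger>) (S x))) = (S\<^sup>\<dagger>) (S x)"
    and trS: "tr (S o\<^sub>L S\<^sup>\<dagger>) = 0"
    using S by (auto simp: shift_stage_def)
  note Sd = partial_isometryD[OF pS]
  note iS = adjoint_inner[OF bounded[OF Sd(1)]] adjoint_inner'[OF bounded[OF Sd(1)]]
  have SP: "(S\<^sup>\<dagger>) (P x) = 0" for x
    by (rule vector_eqI) (simp add: iS(1)[symmetric] selfadj_inner[OF Psa, symmetric] PS)
  have q': "P ((S\<^sup>\<dagger>) y) + S ((S\<^sup>\<dagger>) ((S\<^sup>\<dagger>) y)) = (S\<^sup>\<dagger>) y" for y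
    using q[of "(S\<^sup>\<dagger>) y"] by (simp add: Sd)
  have Sq: "S (P x) + S (S ((S\<^sup>\<dagger>) x)) = S x" for x
  proof (rule vector_eqI)
    fix y
    have "y \<bullet> (S (P x) + S (S ((S\<^sup>\<dagger>) x))) = (P ((S\<^sup>\<dagger>) y) + S ((S\<^sup>\<dagger>) ((S\<^sup>\<dagger>) y))) \<bullet> x"
      by (simp add: inner_add_left inner_add_right iS(2)[symmetric] selfadj_inner[OF Psa] iS(1))
    also have "\<dots> = y \<bullet> S x" unfolding q' by (rule iS(2))
    finally show "y \<bullet> (S (P x) + S (S ((S\<^sup>\<dagger>) x))) = y \<bullet> S x" .
  qed
  define D where "D = P + (S o\<^sub>L S\<^sup>\<dagger>) - (S\<^sup>\<dagger> o\<^sub>L S)"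
  define G where "G = \<I> - P - (S o\<^sub>L S\<^sup>\<dagger>)"
  have Dx: "D x = P x + S ((S\<^sup>\<dagger>) x) - (S\<^sup>\<dagger>) (S x)" for x by (simp add: D_def op_expand)
  have Gx: "G x = x - P x - S ((S\<^sup>\<dagger>) x)" for x by (simp add: G_def op_expand)
  have DN: "D \<in> N" and GN: "G \<in> N" unfolding D_def G_def by (intro mem_intros Pd Sd)+
  have DS: "D ((S\<^sup>\<dagger>) x) = 0" for x by (simp add: Dx q' Sd)
  have SD: "S (D x) = 0" for x using Sq[of x] by (simp add: Dx op_expand Sd)
  have Dp: "D \<in> projections N"
  proof (rule projectionI[OF DN])
    show "selfadj D"
      by (rule selfadjI[OF bounded[OF DN]])
        (simp add: Dx inner_diff_left inner_diff_right inner_add_left inner_add_right selfadj_inner[OF Psa] iS)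
    show "D (D x) = D x" for x
    proof -
      have DP: "D (P x) = P x - (S\<^sup>\<dagger>) (S (P x))" by (simp add: Dx Pd(3) SP blinfun.zero_right)
      have DSS: "D (S ((S\<^sup>\<dagger>) x)) = S ((S\<^sup>\<dagger>) x) - (S\<^sup>\<dagger>) (S (S ((S\<^sup>\<dagger>) x)))"
        by (simp add: Dx PS Sd)
      have q2: "(S\<^sup>\<dagger>) (S x) = (S\<^sup>\<dagger>) (S (P x)) + (S\<^sup>\<dagger>) (S (S ((S\<^sup>\<dagger>) x)))"
        using arg_cong[OF Sq[of x], of "blinfun_apply (S\<^sup>\<dagger>)"] by (simp add: blinfun.add_right)
      have "D (D x) = D (P x) + D (S ((S\<^sup>\<dagger>) x)) - D ((S\<^sup>\<dagger>) (S x))"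
        by (subst Dx[of x]) (simp only: blinfun.add_right blinfun.diff_right)
      also have "\<dots> = P x + S ((S\<^sup>\<dagger>) x) - (S\<^sup>\<dagger>) (S x)"
        unfolding DP DSS DS unfolding q2 by simp
      also have "\<dots> = D x" by (rule Dx[symmetric])
      finally show ?thesis .
    qed
  qed
  have Gp: "G \<in> projections N"
  proof (rule projectionI[OF GN])
    show "selfadj G"
      by (rule selfadjI[OF bounded[OF GN]])
        (simp add: Gx inner_diff_left inner_diff_right selfadj_inner[OF Psa] iS)
    show "G (G x) = G x" for x by (simp add: Gx op_expand Pd(3) SP PS Sd blinfun.zero_right)
  qed
  have GD: "G (D x) = 0" for x
    by (simp add: Gx) (simp add: Dx op_expand Pd(3) SP PS Sd blinfun.zero_right, use q[of x] in \<open>simp add: algebra_simps\<close>)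
  have DG: "D (G x) = 0" for x
    by (rule selfadj_mult_zero_commute[OF projection_selfadj[OF Gp] projection_selfadj[OF Dp] GD])
  obtain V where pV: "partial_isometry V" and VD: "\<And>x. V (D x) = V x" and GV: "\<And>x. G (V x) = V x"
    and alt: "(\<forall>x. (V\<^sup>\<dagger>) (V x) = D x) \<or> (\<forall>x. V ((V\<^sup>\<dagger>) x) = G x)"
    using comparison[OF Dp Gp DG] by blast
  note Vd = partial_isometryD[OF pV]
  note iV = adjoint_inner[OF bounded[OF Vd(1)]] adjoint_inner'[OF bounded[OF Vd(1)]]
  have DV: "D ((V\<^sup>\<dagger>) x) = (V\<^sup>\<dagger>) x" for x
    by (rule vector_eqI)
      (simp only: selfadj_inner[OF projection_selfadj[OF Dp], symmetric] iV(1)[symmetric] VD)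
  have trSS: "tr (S\<^sup>\<dagger> o\<^sub>L S) = 0" using tr_commute[OF adjoint_in[OF Sd(1)] Sd(1)] trS by simp
  have trD: "tr D = 0"
    unfolding D_def using P0 trS trSS by (simp add: tr_add tr_diff mem_intros Pd(1) Sd(1))
  have trG: "tr G = 1"
    unfolding G_def using P0 trS by (simp add: tr_diff tr_id mem_intros Pd(1) Sd(1))
  have VV: "(V\<^sup>\<dagger>) (V x) = D x" for x
  proof -
    have False if "\<forall>x. V ((V\<^sup>\<dagger>) x) = G x"
    proof -
      have "V o\<^sub>L V\<^sup>\<dagger> = G" by (rule blinfun_eqI) (simp add: that)
      then have "tr (V\<^sup>\<dagger> o\<^sub>L V) = 1" using tr_commute[OF adjoint_in[OF Vd(1)] Vd(1)] trG by simp
      moreover have "D - (V\<^sup>\<dagger> o\<^sub>L V) \<in> projections N"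
      proof (rule projectionI)
        show m: "D - (V\<^sup>\<dagger> o\<^sub>L V) \<in> N" by (intro mem_intros DN Vd)
        show "selfadj (D - (V\<^sup>\<dagger> o\<^sub>L V))"
          by (rule selfadjI[OF bounded[OF m]])
            (simp add: op_expand inner_diff_left inner_diff_right selfadj_inner[OF projection_selfadj[OF Dp]] iV)
      qed (simp add: op_expand projectionsD[OF Dp] VD DV Vd)
      then have "0 \<le> tr D - tr (V\<^sup>\<dagger> o\<^sub>L V)"
        using tr_projection_nonneg[of "D - (V\<^sup>\<dagger> o\<^sub>L V)"] by (simp add: tr_diff mem_intros DN Vd(1))
      ultimately show False using trD by simp
    qed
    then show ?thesis using alt by blast
  qed
  have VS: "V ((S\<^sup>\<dagger>) x) = 0" for x using VD[of "(S\<^sup>\<dagger>) x"] by (simp add: DS blinfun.zero_right)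
  have SV': "S ((V\<^sup>\<dagger>) x) = 0" for x
    by (rule vector_eqI) (simp add: iS(2)[symmetric] iV(1)[symmetric] VS)
  have SG: "(S\<^sup>\<dagger>) (G x) = 0" for x by (simp add: Gx op_expand SP Sd)
  have SV: "(S\<^sup>\<dagger>) (V x) = 0" for x using SG[of "V x"] by (simp add: GV)
  have VS': "(V\<^sup>\<dagger>) (S x) = 0" for x
  proof (rule vector_eqI)
    show "y \<bullet> (V\<^sup>\<dagger>) (S x) = y \<bullet> 0" for y
      using iS(1)[of x "V y"] by (simp add: iV(1)[symmetric] SV inner_commute)
  qed
  have PG: "P (G x) = 0" for x by (simp add: Gx op_expand Pd(3) PS)
  have PV: "P (V x) = 0" for x using PG[of "V x"] by (simp add: GV)
  have VP: "(V\<^sup>\<dagger>) (P x) = 0" for x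
    by (rule vector_eqI) (simp add: iV(1)[symmetric] selfadj_inner[OF Psa, symmetric] PV)
  define T where "T = S + V"
  have Tx: "T x = S x + V x" for x by (simp add: T_def op_expand)
  have Tadj: "(T\<^sup>\<dagger>) x = (S\<^sup>\<dagger>) x + (V\<^sup>\<dagger>) x" for x
    unfolding T_def adjoint_binary(1)[OF bounded[OF Sd(1)] bounded[OF Vd(1)]] by (simp add: op_expand)
  have TN: "T \<in> N" unfolding T_def by (intro mem_intros Sd Vd)
  have TT: "(T\<^sup>\<dagger>) (T x) = P x + S ((S\<^sup>\<dagger>) x)" for x
    by (simp add: Tx Tadj op_expand SV VS' VV Dx)
  have TT': "T ((T\<^sup>\<dagger>) x) = S ((S\<^sup>\<dagger>) x) + V ((V\<^sup>\<dagger>) x)" for x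
    by (simp add: Tx Tadj op_expand VS SV')
  have pT: "partial_isometry T"
    unfolding partial_isometry_def
    by (intro conjI allI TN) (simp add: Tx Tadj op_expand SV VS' VS SV' Sd Vd)
  have trT: "tr (T o\<^sub>L T\<^sup>\<dagger>) = 0"
  proof -
    have "T\<^sup>\<dagger> o\<^sub>L T = P + (S o\<^sub>L S\<^sup>\<dagger>)" by (rule blinfun_eqI) (simp add: TT op_expand)
    then have "tr (T\<^sup>\<dagger> o\<^sub>L T) = 0" using P0 trS by (simp add: tr_add mem_intros Pd(1) Sd(1))
    then show ?thesis using tr_commute[OF adjoint_in[OF TN] TN] by simp
  qed
  have "P ((T\<^sup>\<dagger>) (T x)) + T ((T\<^sup>\<dagger>) ((T\<^sup>\<dagger>) (T x))) = (T\<^sup>\<dagger>) (T x)" for x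
    unfolding TT' TT by (simp add: op_expand Pd(3) PS SP VP VS' Sd blinfun.zero_right)
  moreover have "P (T x) = 0" for x by (simp add: Tx op_expand PS PV)
  moreover have "extends S T" unfolding extends_def by (simp add: Tx Sd VS)
  ultimately show ?thesis unfolding shift_stage_def using pT trT TT by blast
qed

lemma tr_faithful_projection:
  assumes P: "P \<in> projections N" and P0: "tr P = 0"
  shows "P = 0"
proof -
  note Pd = projectionsD[OF P] and Psa = projection_selfadj[OF P]
  have tr0: "tr 0 = 0" using tr_scaleR[OF mem_zero, of 0] by simp
  have "\<exists>f. \<forall>n. shift_stage P (f n) \<and>
      (extends (f n) (f (Suc n)) \<and> (\<forall>x. ((f (Suc n))\<^sup>\<dagger>) (f (Suc n) x) = P x + f n (((f n)\<^sup>\<dagger>) x)))"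
  proof (rule dependent_nat_choice)
    show "\<exists>S. shift_stage P S"
      by (rule exI[of _ 0])
        (simp add: shift_stage_def partial_isometry_def mem_zero blinfun.zero_right tr0)
    show "\<exists>T. shift_stage P T \<and> (extends S T \<and> (\<forall>x. (T\<^sup>\<dagger>) (T x) = P x + S ((S\<^sup>\<dagger>) x)))"
      if "shift_stage P S" for S and n :: nat
      using shift_stage_step[OF P P0 that] .
  qed
  then obtain f where st: "\<And>n. shift_stage P (f n)" and ex: "\<And>n. extends (f n) (f (Suc n))"
    and init: "\<And>n x. ((f (Suc n))\<^sup>\<dagger>) (f (Suc n) x) = P x + f n (((f n)\<^sup>\<dagger>) x)" by metis
  have pf: "partial_isometry (f n)" and Pf: "P (f n x) = 0" for n x
    using st[of n] by (auto simp: shift_stage_def)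
  have mono: "extends (f m) (f n)" if "m \<le> n" for m n
    using that
  proof (induction n rule: dec_induct)
    case base
    show ?case by (rule extends_refl[OF pf])
  next
    case (step n)
    show ?case by (rule extends_trans[OF pf pf step.IH ex])
  qed
  obtain T where T: "partial_isometry T" "\<And>V. V \<in> range f \<Longrightarrow> extends V T"
    "\<And>x. T x \<in> closure ((\<lambda>V. blinfun_apply V x) ` range f)"
  proof (rule partial_isometry_chain_limit[of "range f"])
    show "partial_isometry V" if "V \<in> range f" for V using that pf by blast
    show "extends V W \<or> extends W V" if VW: "V \<in> range f" "W \<in> range f" for V W
    proof -
      obtain m n where "V = f m" "W = f n" using VW by blast
      then show ?thesis using mono[of m n] mono[of n m] by (cases "m \<le> n") auto
    qed
  qed auto
  note Td = partial_isometryD[OF T(1)]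
  note iT = adjoint_inner[OF bounded[OF Td(1)]] adjoint_inner'[OF bounded[OF Td(1)]]
  have fT: "(T\<^sup>\<dagger>) (T (P x + f n (((f n)\<^sup>\<dagger>) x))) = P x + f n (((f n)\<^sup>\<dagger>) x)" for n x
    using extends_initial(1)[OF pf[of "Suc n"] T(1) T(2)[OF rangeI], of x] unfolding init .
  have qf: "(T\<^sup>\<dagger>) (T (f n y)) = f n y" for n y
    using fT[of "f n y" n] by (simp add: Pf partial_isometryD[OF pf])
  have fP: "((f n)\<^sup>\<dagger>) (P x) = 0" for n x
    by (rule vector_eqI)
      (simp add: adjoint_inner[OF bounded[OF partial_isometryD(1)[OF pf]], symmetric]
        selfadj_inner[OF Psa, symmetric] Pf)
  have qP: "(T\<^sup>\<dagger>) (T (P x)) = P x" for x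
    using fT[of "P x" 0] by (simp add: Pd(3) fP blinfun.zero_right)
  have qT: "(T\<^sup>\<dagger>) (T (T x)) = T x" for x
  proof -
    have "closed {y. (T\<^sup>\<dagger>) (T y) = y}"
      by (intro closed_Collect_eq linear_continuous_on continuous_on_id
          bounded_linear_compose[OF blinfun.bounded_linear_right] blinfun.bounded_linear_right)
    then have "closure ((\<lambda>V. blinfun_apply V x) ` range f) \<subseteq> {y. (T\<^sup>\<dagger>) (T y) = y}"
      by (rule closure_minimal[rotated]) (auto simp: qf)
    then show ?thesis using T(3)[of x] by blast
  qed
  have PT: "P (T x) = 0" for x
  proof -
    have "closed {y. P y = 0}"
      by (intro closed_Collect_eq linear_continuous_on continuous_on_const blinfun.bounded_linear_right)
    then have "closure ((\<lambda>V. blinfun_apply V x) ` range f) \<subseteq> {y. P y = 0}"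
      by (rule closure_minimal[rotated]) (auto simp: Pf)
    then show ?thesis using T(3)[of x] by blast
  qed
  have TP: "(T\<^sup>\<dagger>) (P x) = 0" for x
    by (rule vector_eqI) (simp add: iT(1)[symmetric] selfadj_inner[OF Psa, symmetric] PT)
  have Tq: "(T\<^sup>\<dagger>) ((T\<^sup>\<dagger>) (T x)) = (T\<^sup>\<dagger>) x" for x
    by (rule vector_eqI) (simp only: iT[symmetric] qT)
  define W where "W = T + \<I> - (T\<^sup>\<dagger> o\<^sub>L T)"
  have Wx: "W x = T x + x - (T\<^sup>\<dagger>) (T x)" for x by (simp add: W_def op_expand)
  have WN: "W \<in> N" unfolding W_def by (intro mem_intros Td)
  have Wadj: "(W\<^sup>\<dagger>) x = (T\<^sup>\<dagger>) x + x - (T\<^sup>\<dagger>) (T x)" for x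
  proof -
    have "W\<^sup>\<dagger> = T\<^sup>\<dagger> + \<I> - (T\<^sup>\<dagger> o\<^sub>L T)"
      by (rule adjoint_eqI[OF bounded[OF WN]])
        (simp add: Wx op_expand inner_add_left inner_add_right inner_diff_left inner_diff_right iT)
    then show ?thesis by (simp add: op_expand)
  qed
  have WW: "W\<^sup>\<dagger> o\<^sub>L W = \<I>"
    by (rule blinfun_eqI) (simp add: Wx Wadj op_expand Td qT Tq)
  have WWx: "(W\<^sup>\<dagger>) (W x) = x" for x using op_eqD[OF WW, of x] by simp
  have "W o\<^sub>L W\<^sup>\<dagger> \<in> projections N"
    by (rule partial_isometry_final) (simp add: partial_isometry_def WN WWx)
  then have "W o\<^sub>L W\<^sup>\<dagger> = \<I>"
    using finite WN WW unfolding finite_projection_def mvn_equivalent_def by (metis blinfun_apply_blinfun_compose blinfun_apply_id_blinfun blinfun_eqI)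
  from op_eqD[OF this] have "W ((W\<^sup>\<dagger>) (P x)) = P x" for x by simp
  then have "P x = 0" for x
    by (simp add: Wx Wadj op_expand TP qP blinfun.zero_right)
  then show ?thesis by (intro blinfun_eqI) simp
qed

lemma tr_faithful:
  assumes K: "K \<in> N" and b: "op_between 0 b K" and tr0: "tr K = 0"
  shows "K = 0"
proof -
  have "norm K \<le> \<delta>" if \<delta>: "0 < \<delta>" for \<delta>
  proof -
    define f g where "f = (\<lambda>t::real. max 0 (t - \<delta>))" and "g = (\<lambda>t::real. min t \<delta>)"
    have cf: "continuous_on {0..b} f" and cg: "continuous_on {0..b} g"
      unfolding f_def g_def by (intro continuous_intros)+
    define Kp M where "Kp = op_fun f K" and "M = op_fun g K"
    have KpN: "Kp \<in> N" and MN: "M \<in> N"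
      unfolding Kp_def M_def by (rule mem_op_fun[OF b cf K] mem_op_fun[OF b cg K])+
    have Kpsa: "selfadj Kp" and Msa: "selfadj M"
      unfolding Kp_def M_def by (rule op_fun_selfadj[OF b cf] op_fun_selfadj[OF b cg])+
    have sum: "K = Kp + M"
    proof -
      have "op_fun (\<lambda>t. f t + g t) K = op_fun (\<lambda>t. t) K"
        by (rule op_fun_cong[OF b continuous_on_add[OF cf cg]]) (auto simp: f_def g_def)
      then show ?thesis unfolding op_fun_add[OF b cf cg] op_fun_id[OF b] Kp_def M_def by simp
    qed
    have b0: "0 \<le> b" using op_between_le[OF b] .
    have Mb: "op_between 0 \<delta> M"
      unfolding M_def by (rule op_fun_between[OF b cg]) (use \<delta> in \<open>auto simp: g_def\<close>)
    have Kpb: "op_between 0 b Kp"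
      unfolding Kp_def by (rule op_fun_between[OF b cf]) (use \<delta> b0 in \<open>auto simp: f_def\<close>)
    have trM: "tr M = 0"
      using tr_op_between_nonneg[OF Mb MN] tr_op_between_nonneg[OF Kpb KpN] tr_add[OF KpN MN] tr0
      unfolding sum[symmetric] by simp
    have KpM: "Kp (M x) = \<delta> *\<^sub>R Kp x" for x
    proof -
      have "Kp o\<^sub>L M = op_fun (\<lambda>t. f t * g t) K"
        unfolding Kp_def M_def op_fun_mult[OF b cf cg] ..
      also have "\<dots> = op_fun (\<lambda>t. \<delta> * f t) K"
        by (rule op_fun_cong[OF b continuous_on_mult[OF cf cg]]) (auto simp: f_def g_def max_def min_def)
      also have "\<dots> = \<delta> *\<^sub>R Kp" unfolding Kp_def by (rule op_fun_scaleR[OF b cf])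
      finally have "Kp o\<^sub>L M = \<delta> *\<^sub>R Kp" .
      from op_eqD[OF this, of x] show ?thesis by (simp add: op_expand)
    qed
    obtain E where E: "E \<in> projections N" "\<And>x. Kp (E x) = Kp x" "\<And>x. E (Kp x) = Kp x"
      "\<And>Y :: 'h op. Kp o\<^sub>L Y = 0 \<Longrightarrow> E o\<^sub>L Y = 0"
      using range_projection[OF KpN Kpsa] by blast
    note Ed = projectionsD[OF E(1)] and Esa = projection_selfadj[OF E(1)]
    have EM: "E (M x) = \<delta> *\<^sub>R E x" for x
    proof -
      have "Kp o\<^sub>L (M - \<delta> *\<^sub>R \<I>) = 0" by (rule blinfun_eqI) (simp add: op_expand KpM)
      from op_eqD[OF E(4)[OF this], of x] show ?thesis by (simp add: op_expand)
    qed
    have pos: "0 \<le> (M - \<delta> *\<^sub>R E) x \<bullet> x" for x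
    proof -
      have "0 * ((x - E x) \<bullet> (x - E x)) \<le> M (x - E x) \<bullet> (x - E x)" using Mb unfolding op_between_def by blast
      also have "M (x - E x) \<bullet> (x - E x) = (x - E x) \<bullet> (M x - E (M x))"
      proof -
        have "M (x - E x) \<bullet> (x - E x) = M (x - E x) \<bullet> x - E (M (x - E x)) \<bullet> x"
          by (simp add: inner_diff_right selfadj_inner[OF Esa])
        also have "E (M (x - E x)) = 0" unfolding EM by (simp add: op_expand Ed(3))
        also have "M (x - E x) \<bullet> x - 0 \<bullet> x = (x - E x) \<bullet> M x" by (simp add: selfadj_inner[OF Msa])
        also have "(x - E x) \<bullet> M x = (x - E x) \<bullet> (M x - E (M x))"
          by (simp add: inner_diff_left inner_diff_right selfadj_inner[OF Esa] Ed(3))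
        finally show ?thesis .
      qed
      also have "\<dots> = (M - \<delta> *\<^sub>R E) x \<bullet> x"
        by (simp add: op_expand EM inner_diff_left inner_diff_right selfadj_inner[OF Esa] Ed(3) inner_commute)
      finally show ?thesis by simp
    qed
    have dN: "M - \<delta> *\<^sub>R E \<in> N" by (intro mem_intros MN Ed)
    have "0 \<le> tr (M - \<delta> *\<^sub>R E)"
    proof (rule tr_nonneg[OF dN _ pos])
      show "selfadj (M - \<delta> *\<^sub>R E)"
        by (rule selfadjI[OF bounded[OF dN]])
          (simp add: op_expand inner_diff_left inner_diff_right selfadj_inner[OF Esa] selfadj_inner[OF Msa])
    qed
    then have "\<delta> * tr E \<le> 0" using trM by (simp add: tr_diff tr_scaleR mem_intros MN Ed(1))
    then have "tr E = 0" using \<delta> tr_projection_nonneg[OF E(1)] by (simp add: mult_le_0_iff)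
    then have "E = 0" by (rule tr_faithful_projection[OF E(1)])
    then have "Kp = 0" using E(3) by (intro blinfun_eqI) (metis blinfun.zero_left)
    then have "K = M" using sum by simp
    have M': "op_between (- \<delta>) \<delta> M" unfolding M_def
      by (rule op_fun_between[OF b cg]) (use \<delta> in \<open>auto simp: g_def\<close>)
    show ?thesis unfolding \<open>K = M\<close> by (rule op_between_norm_le[OF M'])
  qed
  then have "norm K \<le> 0" by (rule field_le_epsilon) simp_all
  then show ?thesis by simp
qed

end

subsection \<open>The p-norm of U - 2P + I\<close>

lemma op_between_mono:
  fixes A :: "('h::complex_hilbert) op"
  assumes A: "op_between a b A" and "a' \<le> a" "b \<le> b'"
  shows "op_between a' b' A"
  unfolding op_between_def
proof (intro conjI allI)
  show "selfadj A" "a' \<le> b'" using assms by (auto simp: op_between_def)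
  fix x :: 'h
  have "a' * (x \<bullet> x) \<le> a * (x \<bullet> x)" "b * (x \<bullet> x) \<le> b' * (x \<bullet> x)"
    using assms(2,3) by (auto intro: mult_right_mono)
  moreover have "a * (x \<bullet> x) \<le> A x \<bullet> x" "A x \<bullet> x \<le> b * (x \<bullet> x)"
    using A by (auto simp: op_between_def)
  ultimately show "a' * (x \<bullet> x) \<le> A x \<bullet> x" "A x \<bullet> x \<le> b' * (x \<bullet> x)" by linarith+
qed

context tracial_vn_algebra
begin

lemma pnorm_powr_eq:
  assumes A: "A \<in> N" and p: "0 < p"
  shows "pnorm \<tau> p A powr p = tr (op_fun (\<lambda>t. t powr (p / 2)) (A\<^sup>\<dagger> o\<^sub>L A))"
proof -
  note H = selfadj_adjoint_compose[OF bounded[OF A]]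
  let ?B = "op_fun (\<lambda>t. t powr (p / 2)) (A\<^sup>\<dagger> o\<^sub>L A)"
  have c: "continuous_on {0..(norm A)\<^sup>2} (\<lambda>t. t powr (p / 2))"
    using p by (intro continuous_on_powr_const) simp
  have "op_between 0 (((norm A)\<^sup>2) powr (p / 2)) ?B"
    by (rule op_fun_between[OF H c]) (use p in \<open>auto intro: powr_mono2\<close>)
  moreover have "?B \<in> N" by (rule mem_op_fun[OF H c]) (intro mem_intros A)
  ultimately have "0 \<le> tr ?B" by (rule tr_op_between_nonneg)
  then show ?thesis
    unfolding pnorm_def op_powr_op_abs[OF bounded[OF A] p] tr_def[symmetric]
    using p by (simp add: powr_powr)
qed

end

locale unitary_in_vn_algebra = tracial_vn_algebra N \<tau>
  for N :: "('h::complex_hilbert) op set" and \<tau> +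
  fixes U :: "'h op"
  assumes U: "U \<in> unitaries N"
begin

lemma UN: "U \<in> N" and UU: "(U\<^sup>\<dagger>) (U x) = x" "U ((U\<^sup>\<dagger>) x) = x"
proof -
  show "U \<in> N" using U by (simp add: unitaries_def)
  have "U\<^sup>\<dagger> o\<^sub>L U = \<I>" "U o\<^sub>L U\<^sup>\<dagger> = \<I>" using U by (simp_all add: unitaries_def)
  from op_eqD[OF this(1), of x] op_eqD[OF this(2), of x]
  show "(U\<^sup>\<dagger>) (U x) = x" "U ((U\<^sup>\<dagger>) x) = x" by simp_all
qed

lemmas iU = adjoint_inner[OF bounded[OF UN]] adjoint_inner'[OF bounded[OF UN]]

definition Re_U :: "'h op" where "Re_U = (1/2) *\<^sub>R (U + U\<^sup>\<dagger>)"

lemma Re_U_apply: "Re_U x = (1/2) *\<^sub>R (U x + (U\<^sup>\<dagger>) x)"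
  by (simp add: Re_U_def op_expand)

lemma Re_U_mem: "Re_U \<in> N"
  unfolding Re_U_def by (intro mem_intros UN)

lemma Re_U_between: "op_between (- 1) 1 Re_U"
  unfolding op_between_def
proof (intro conjI allI)
  show "selfadj Re_U"
    by (rule selfadjI[OF bounded[OF Re_U_mem]]) (simp add: Re_U_apply inner_add_left inner_add_right iU)
  fix x
  have "U x \<bullet> U x = x \<bullet> x" by (simp add: iU UU)
  then have n: "norm (U x) = norm x" by (simp add: norm_eq_sqrt_inner)
  have "Re_U x \<bullet> x = U x \<bullet> x" using inner_commute[of x "U x"] by (simp add: Re_U_apply inner_add_left iU(2))
  moreover have "\<bar>U x \<bullet> x\<bar> \<le> x \<bullet> x"
    using Cauchy_Schwarz_ineq2[of "U x" x] by (simp add: n dot_square_norm power2_eq_square)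
  ultimately show "- 1 * (x \<bullet> x) \<le> Re_U x \<bullet> x" "Re_U x \<bullet> x \<le> 1 * (x \<bullet> x)" by auto
qed simp

lemma pnorm_commuting_projection:
  assumes P: "P \<in> projections N" and PU: "\<And>x. P (U x) = U (P x)" and p: "0 < p"
  shows "pnorm \<tau> p (U - 2 *\<^sub>R P + \<I>) powr p =
    tr (P o\<^sub>L op_fun (\<lambda>t. (2 - 2 * t) powr (p / 2)) Re_U)
    + tr ((\<I> - P) o\<^sub>L op_fun (\<lambda>t. (2 + 2 * t) powr (p / 2)) Re_U)"
proof -
  note Pd = projectionsD[OF P] and Psa = projection_selfadj[OF P]
  define f where "f = (\<lambda>t::real. t powr (p / 2))"
  have cf: "continuous_on {0..b} f" for b unfolding f_def using p by (intro continuous_on_powr_const) simp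
  have PU': "P ((U\<^sup>\<dagger>) x) = (U\<^sup>\<dagger>) (P x)" for x
  proof -
    have "U (P ((U\<^sup>\<dagger>) x)) = P x" by (simp add: PU[symmetric] UU)
    then show ?thesis using UU(1)[of "P ((U\<^sup>\<dagger>) x)"] by simp
  qed
  define A where "A = U - 2 *\<^sub>R P + \<I>"
  have AN: "A \<in> N" unfolding A_def by (intro mem_intros UN Pd)
  have Ax: "A x = U x - 2 *\<^sub>R P x + x" for x by (simp add: A_def op_expand)
  have Aadj: "(A\<^sup>\<dagger>) x = (U\<^sup>\<dagger>) x - 2 *\<^sub>R P x + x" for x
  proof -
    have "A\<^sup>\<dagger> = U\<^sup>\<dagger> - 2 *\<^sub>R P + \<I>"
      by (rule adjoint_eqI[OF bounded[OF AN]])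
        (simp add: Ax op_expand inner_add_left inner_add_right inner_diff_left inner_diff_right iU
          selfadj_inner[OF Psa])
    then show ?thesis by (simp add: op_expand)
  qed
  define H where "H = A\<^sup>\<dagger> o\<^sub>L A"
  define R where "R = max 4 ((norm A)\<^sup>2)"
  have H: "op_between 0 R H"
    unfolding H_def R_def by (rule op_between_mono[OF selfadj_adjoint_compose[OF bounded[OF AN]]]) auto
  have two: "op_between 0 R (2 *\<^sub>R \<I> + d *\<^sub>R Re_U)"
      "op_fun f (2 *\<^sub>R \<I> + d *\<^sub>R Re_U) = op_fun (\<lambda>t. f (2 + d * t)) Re_U" if "d = 2 \<or> d = - 2" for d
  proof -
    have c: "continuous_on {- 1..1} (\<lambda>t::real. 2 + d * t)" by (intro continuous_intros)
    have range: "0 \<le> 2 + d * t \<and> 2 + d * t \<le> 4" if "t \<in> {- 1..1}" for t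
      using that \<open>d = 2 \<or> d = - 2\<close> by auto
    have "op_between 0 4 (2 *\<^sub>R \<I> + d *\<^sub>R Re_U)"
      using op_fun_between[OF Re_U_between c range] unfolding op_fun_affine[OF Re_U_between] .
    then show "op_between 0 R (2 *\<^sub>R \<I> + d *\<^sub>R Re_U)" by (rule op_between_mono) (auto simp: R_def)
    show "op_fun f (2 *\<^sub>R \<I> + d *\<^sub>R Re_U) = op_fun (\<lambda>t. f (2 + d * t)) Re_U"
      using op_fun_compose[OF Re_U_between c range cf] unfolding op_fun_affine[OF Re_U_between] .
  qed
  have half: "U x + (U\<^sup>\<dagger>) x = 2 *\<^sub>R Re_U x" for x by (simp add: Re_U_apply)
  have Hx: "H x = 2 *\<^sub>R x + 2 *\<^sub>R Re_U x - 4 *\<^sub>R P (Re_U x)" for x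
    by (simp add: H_def Ax Aadj Re_U_apply op_expand PU PU' Pd(3) UU algebra_simps scaleR_2)
  have PT: "P (Re_U x) = Re_U (P x)" for x by (simp add: Re_U_apply op_expand PU PU')
  have HP: "H o\<^sub>L P = P o\<^sub>L (2 *\<^sub>R \<I> + (- 2) *\<^sub>R Re_U)"
  proof (rule blinfun_eqI)
    fix x
    have "H (P x) = 2 *\<^sub>R P x + 2 *\<^sub>R P (Re_U x) - 4 *\<^sub>R P (Re_U x)" by (simp add: Hx PT Pd(3))
    also have "\<dots> = 2 *\<^sub>R P x + (2 - 4) *\<^sub>R P (Re_U x)" unfolding scaleR_diff_left by simp
    finally show "(H o\<^sub>L P) x = (P o\<^sub>L (2 *\<^sub>R \<I> + (- 2) *\<^sub>R Re_U)) x" by (simp add: op_expand)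
  qed
  have HQ: "H o\<^sub>L (\<I> - P) = (\<I> - P) o\<^sub>L (2 *\<^sub>R \<I> + 2 *\<^sub>R Re_U)"
  proof (rule blinfun_eqI)
    fix x
    have "H (x - P x) = 2 *\<^sub>R (x - P x) + 2 *\<^sub>R (Re_U x - P (Re_U x))"
      unfolding Hx by (simp add: op_expand PT Pd(3))
    then show "(H o\<^sub>L (\<I> - P)) x = ((\<I> - P) o\<^sub>L (2 *\<^sub>R \<I> + 2 *\<^sub>R Re_U)) x" by (simp add: op_expand algebra_simps)
  qed
  have fHN: "op_fun f H \<in> N" by (rule mem_op_fun[OF H cf]) (unfold H_def, intro mem_intros AN)
  have "tr (op_fun f H) = tr ((op_fun f H o\<^sub>L P) + (op_fun f H o\<^sub>L (\<I> - P)))"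
    by (rule arg_cong[of _ _ tr], rule blinfun_eqI) (simp add: op_expand)
  also have "\<dots> = tr (op_fun f H o\<^sub>L P) + tr (op_fun f H o\<^sub>L (\<I> - P))"
    by (intro tr_add mem_intros fHN Pd)
  also have "op_fun f H o\<^sub>L P = P o\<^sub>L op_fun (\<lambda>t. f (2 + (- 2) * t)) Re_U"
    using op_fun_intertwine[OF H two(1) cf HP] two(2)[of "- 2"] by simp
  also have "op_fun f H o\<^sub>L (\<I> - P) = (\<I> - P) o\<^sub>L op_fun (\<lambda>t. f (2 + 2 * t)) Re_U"
    using op_fun_intertwine[OF H two(1) cf HQ] two(2)[of 2] by simp
  finally show ?thesis
    unfolding pnorm_powr_eq[OF AN[unfolded A_def] p] H_def A_def f_def by simp
qed

end

context tracial_II1_factor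
begin

lemma selfadj_eq_0_if_trace_vanishes:
  assumes D: "D \<in> N" "selfadj D"
    and tr0: "\<And>E. E \<in> projections N \<Longrightarrow>
      (\<And>B. B \<in> bounded_operators \<Longrightarrow> D o\<^sub>L B = B o\<^sub>L D \<Longrightarrow> D o\<^sub>L B\<^sup>\<dagger> = B\<^sup>\<dagger> o\<^sub>L D \<Longrightarrow> E o\<^sub>L B = B o\<^sub>L E)
      \<Longrightarrow> tr (E o\<^sub>L D) = 0"
  shows "D = 0"
proof -
  define b where "b = norm D"
  have b: "op_between (- b) b D" unfolding b_def by (rule selfadj_op_between_norm[OF D(2)])
  have b0: "0 \<le> b" by (simp add: b_def)
  have part: "op_fun h D = 0" if ch: "continuous_on {- b..b} h"
    and h0: "\<And>t. t \<in> {- b..b} \<Longrightarrow> 0 \<le> h t \<and> h t \<le> b"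
    and hs: "\<And>t. t \<in> {- b..b} \<Longrightarrow> h t * t = s * (h t * h t)" and s: "s \<noteq> 0" for h s
  proof -
    define K where "K = op_fun h D"
    have Kb: "op_between 0 b K" unfolding K_def by (rule op_fun_between[OF b ch h0])
    have Ksa: "selfadj K" by (rule op_between_selfadj[OF Kb])
    have KN: "K \<in> N" unfolding K_def by (rule mem_op_fun[OF b ch D(1)])
    have "K o\<^sub>L D = op_fun (\<lambda>t. h t * t) D"
      unfolding K_def op_fun_mult[OF b ch continuous_on_id] op_fun_id[OF b] ..
    also have "\<dots> = op_fun (\<lambda>t. s * (h t * h t)) D"
      by (rule op_fun_cong[OF b continuous_on_mult[OF ch continuous_on_id] hs])
    also have "\<dots> = s *\<^sub>R (K o\<^sub>L K)"
      unfolding op_fun_scaleR[OF b continuous_on_mult[OF ch ch]] op_fun_mult[OF b ch ch] K_def ..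
    finally have KD: "K o\<^sub>L (D - s *\<^sub>R K) = 0"
    proof (intro blinfun_eqI)
      fix x assume "K o\<^sub>L D = s *\<^sub>R (K o\<^sub>L K)"
      from op_eqD[OF this, of x] show "(K o\<^sub>L (D - s *\<^sub>R K)) x = blinfun_apply 0 x" by (simp add: op_expand)
    qed
    obtain E where E: "E \<in> projections N" "\<And>x. K (E x) = K x" "\<And>x. E (K x) = K x"
      "\<And>Y :: 'h op. K o\<^sub>L Y = 0 \<Longrightarrow> E o\<^sub>L Y = 0"
      using range_projection[OF KN Ksa] by blast
    note Esa = projection_selfadj[OF E(1)]
    have ED: "E o\<^sub>L D = s *\<^sub>R K"
    proof (rule blinfun_eqI)
      show "(E o\<^sub>L D) x = (s *\<^sub>R K) x" for x
        using op_eqD[OF E(4)[OF KD], of x] by (simp add: op_expand E(3))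
    qed
    have EB: "E (B x) = E (B (E x))" if "D o\<^sub>L B = B o\<^sub>L D" for B x
    proof -
      have KB: "K (B y) = B (K y)" for y
        using op_eqD[OF op_fun_commute[OF b ch that], of y] by (simp add: K_def)
      have "K o\<^sub>L (B o\<^sub>L (\<I> - E)) = 0" by (rule blinfun_eqI) (simp add: op_expand KB E(2))
      from op_eqD[OF E(4)[OF this], of x] show ?thesis by (simp add: op_expand)
    qed
    have "tr (E o\<^sub>L D) = 0"
    proof (rule tr0[OF E(1)])
      fix B :: "'h op"
      assume B: "B \<in> bounded_operators" and 1: "D o\<^sub>L B = B o\<^sub>L D" and 2: "D o\<^sub>L B\<^sup>\<dagger> = B\<^sup>\<dagger> o\<^sub>L D"
      note iB = adjoint_inner[OF B] adjoint_inner'[OF B]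
      have "B (E x) = E (B (E x))" for x
      proof (rule vector_eqI)
        fix y
        have "y \<bullet> B (E x) = E ((B\<^sup>\<dagger>) y) \<bullet> x" by (simp only: iB(2)[symmetric] selfadj_inner[OF Esa])
        also have "\<dots> = E ((B\<^sup>\<dagger>) (E y)) \<bullet> x" by (simp only: EB[OF 2, of y])
        also have "\<dots> = y \<bullet> E (B (E x))" by (simp only: iB(2) selfadj_inner[OF Esa])
        finally show "y \<bullet> B (E x) = y \<bullet> E (B (E x))" .
      qed
      then show "E o\<^sub>L B = B o\<^sub>L E" using EB[OF 1] by (intro blinfun_eqI) simp
    qed
    then have "s * tr K = 0" unfolding ED tr_scaleR[OF KN] .
    then have "tr K = 0" using s by simp
    then show ?thesis using tr_faithful[OF KN Kb] by (simp add: K_def)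
  qed
  define fp fm :: "real \<Rightarrow> real" where "fp t = max 0 t" and "fm t = max 0 (- t)" for t
  have cont: "continuous_on S fp" "continuous_on S fm" for S
    unfolding fp_def fm_def by (intro continuous_intros)+
  have "op_fun fp D = 0"
    by (rule part[OF cont(1), where s = 1]) (use b0 in \<open>auto simp: fp_def max_def\<close>)
  moreover have "op_fun fm D = 0"
    by (rule part[OF cont(2), where s = "- 1"]) (use b0 in \<open>auto simp: fm_def max_def\<close>)
  moreover have "D = op_fun (\<lambda>t. fp t - fm t) D"
    using op_fun_id[OF b] op_fun_cong[OF b continuous_on_id, of "\<lambda>t. fp t - fm t"]
    by (simp add: fp_def fm_def)
  ultimately show ?thesis unfolding op_fun_diff[OF b cont] by simp
qed

end

lemma op_fun_injective_eq_scalar: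
  assumes A: "op_between a b A" and g: "continuous_on {a..b} g"
    and anti: "\<And>s t. s \<in> {a..b} \<Longrightarrow> t \<in> {a..b} \<Longrightarrow> s < t \<Longrightarrow> g t < g s"
    and c: "c \<in> {a..b}" and eq: "op_fun g A = g c *\<^sub>R \<I>"
  shows "A = c *\<^sub>R \<I>"
proof -
  define k where "k = inv_into {a..b} g"
  have inj: "inj_on g {a..b}"
    by (rule inj_onI) (metis anti less_irrefl linorder_neqE_linordered_idom)
  have kg: "k (g t) = t" if "t \<in> {a..b}" for t unfolding k_def by (rule inv_into_f_f[OF inj that])
  have ab: "a \<le> b" by (rule op_between_le[OF A])
  have mono: "g t \<le> g s" if "s \<in> {a..b}" "t \<in> {a..b}" "s \<le> t" for s t
    using anti[OF that(1,2)] that(3) by (cases "s = t") auto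
  have range: "g b \<le> g t \<and> g t \<le> g a" if "t \<in> {a..b}" for t
    using mono[of a t] mono[of t b] that ab by auto
  have img: "g ` {a..b} = {g b..g a}"
  proof
    show "g ` {a..b} \<subseteq> {g b..g a}" using range by auto
    show "{g b..g a} \<subseteq> g ` {a..b}"
    proof
      fix y assume "y \<in> {g b..g a}"
      then obtain x where "a \<le> x" "x \<le> b" "g x = y" using IVT2'[of g b y a] ab g by auto
      then show "y \<in> g ` {a..b}" by auto
    qed
  qed
  have ck: "continuous_on {g b..g a} k"
    unfolding img[symmetric] by (rule continuous_on_inv[OF g compact_Icc]) (simp add: kg)
  have "op_fun k (op_fun g A) = op_fun (\<lambda>t. k (g t)) A"
    by (rule op_fun_compose[OF A g range ck])
  also have "\<dots> = op_fun (\<lambda>t. t) A"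
    by (rule op_fun_cong[OF A continuous_on_id, symmetric]) (simp add: kg)
  also have "\<dots> = A" by (rule op_fun_id[OF A])
  finally have "A = op_fun k (g c *\<^sub>R \<I>)" unfolding eq by simp
  also have "\<dots> = k (g c) *\<^sub>R \<I>" by (rule op_fun_scaleR_id[OF _ _ ck]) (use range[OF c] in auto)
  finally show ?thesis by (simp add: kg[OF c])
qed

lemma powr_add_complementary_neq_1:
  fixes x q :: real
  assumes "0 < x" "x < 1" "q \<noteq> 1"
  shows "x powr q + (1 - x) powr q \<noteq> 1"
proof (cases "q < 1")
  case True
  then have "x powr 1 < x powr q" "(1 - x) powr 1 < (1 - x) powr q"
    using assms by (intro powr_less_mono'; simp)+
  then show ?thesis using assms by simp
next
  case False
  then have "x powr q < x powr 1" "(1 - x) powr q < (1 - x) powr 1"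
    using assms by (intro powr_less_mono'; simp)+
  then show ?thesis using assms by simp
qed

lemma continuous_on_powr_affine:
  assumes "0 < p"
  shows "continuous_on {- 1..1} (\<lambda>t::real. (2 - 2 * t) powr (p / 2))"
    "continuous_on {- 1..1} (\<lambda>t::real. (2 + 2 * t) powr (p / 2))"
  by (rule continuous_on_powr'; use assms in \<open>auto intro!: continuous_intros\<close>)+

context unitary_in_vn_algebra
begin

lemma pnorm_scalar:
  assumes T: "Re_U = k *\<^sub>R \<I>" and k: "- 1 \<le> k" "k \<le> 1"
    and P: "P \<in> projections N" and PU: "\<And>x. P (U x) = U (P x)" and p: "0 < p"
  shows "pnorm \<tau> p (U - 2 *\<^sub>R P + \<I>) powr p =
    tr P * (2 - 2 * k) powr (p / 2) + tr (\<I> - P) * (2 + 2 * k) powr (p / 2)"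
proof -
  note PN = projectionsD(1)[OF P]
  note c = continuous_on_powr_affine[OF p]
  have sc: "X o\<^sub>L (r *\<^sub>R \<I>) = r *\<^sub>R X" for X :: "'h op" and r
    by (rule blinfun_eqI) (simp add: op_expand)
  show ?thesis
    unfolding pnorm_commuting_projection[OF P PU p] T op_fun_scaleR_id[OF k c(1)]
      op_fun_scaleR_id[OF k c(2)] sc
    by (simp add: tr_scaleR mem_intros PN)
qed

end

locale unitary_in_II1_factor = tracial_II1_factor N \<tau> + unitary_in_vn_algebra N \<tau> U
  for N :: "('h::complex_hilbert) op set" and \<tau> and U +
  fixes p c :: real
  assumes p: "0 < p" and c: "- 1 \<le> c" "c \<le> 1"
    and pnorm_eq: "\<And>P. P \<in> projections N \<Longrightarrow> pnorm \<tau> p (U - 2 *\<^sub>R P + \<I>) powr p =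
      tr P * (2 - 2 * c) powr (p / 2) + tr (\<I> - P) * (2 + 2 * c) powr (p / 2)"
begin

lemma Re_U_eq: "Re_U = c *\<^sub>R \<I>"
proof -
  define \<phi> \<psi> where "\<phi> = (\<lambda>t. (2 - 2 * t) powr (p / 2))" and "\<psi> = (\<lambda>t. (2 + 2 * t) powr (p / 2))"
  have cont: "continuous_on {- 1..1} \<phi>" "continuous_on {- 1..1} \<psi>"
    unfolding \<phi>_def \<psi>_def by (rule continuous_on_powr_affine[OF p])+
  define g where "g = (\<lambda>t. \<phi> t - \<psi> t)"
  have cg: "continuous_on {- 1..1} g" unfolding g_def by (intro continuous_on_diff cont)
  have anti: "g t < g s" if "s \<in> {- 1..1}" "t \<in> {- 1..1}" "s < t" for s t
  proof -
    have "\<phi> t < \<phi> s" unfolding \<phi>_def using that p by (intro powr_less_mono2) auto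
    moreover have "\<psi> s < \<psi> t" unfolding \<psi>_def using that p by (intro powr_less_mono2) auto
    ultimately show ?thesis by (simp add: g_def)
  qed
  define A B where "A = op_fun \<phi> Re_U" and "B = op_fun \<psi> Re_U"
  have AN: "A \<in> N" and BN: "B \<in> N"
    unfolding A_def B_def
    by (rule mem_op_fun[OF Re_U_between cont(1) Re_U_mem] mem_op_fun[OF Re_U_between cont(2) Re_U_mem])+
  have gT: "op_fun g Re_U = A - B"
    unfolding g_def A_def B_def by (rule op_fun_diff[OF Re_U_between cont])
  have id_minus: "(\<I> - P) o\<^sub>L B = B - (P o\<^sub>L B)" for P
    by (rule blinfun_eqI) (simp add: op_expand)
  have eq: "tr (P o\<^sub>L A) + (tr B - tr (P o\<^sub>L B)) = tr P * \<phi> c + (1 - tr P) * \<psi> c"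
    if P: "P \<in> projections N" and PU: "\<And>x. P (U x) = U (P x)" for P
  proof -
    note PN = projectionsD(1)[OF P]
    show ?thesis
      using pnorm_commuting_projection[OF P PU p] pnorm_eq[OF P]
      unfolding \<phi>_def[symmetric] \<psi>_def[symmetric] A_def[symmetric] B_def[symmetric] id_minus
      by (simp add: tr_diff tr_id mem_intros PN BN \<phi>_def \<psi>_def)
  qed
  have z: "0 \<in> projections N" by (simp add: projections_def mem_zero)
  have tr0: "tr 0 = 0" using tr_scaleR[OF mem_zero, of 0] by simp
  have trB: "tr B = \<psi> c" using eq[OF z] by (simp add: tr0 blinfun.zero_right)
  define D where "D = A - B - g c *\<^sub>R \<I>"
  have D_fun: "D = op_fun (\<lambda>t. g t - g c) Re_U"
    unfolding D_def gT[symmetric] op_fun_diff[OF Re_U_between cg continuous_on_const]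
      op_fun_const[OF Re_U_between] ..
  have cD: "continuous_on {- 1..1} (\<lambda>t. g t - g c)" by (intro continuous_on_diff cg continuous_on_const)
  have DN: "D \<in> N" unfolding D_def by (intro mem_intros AN BN)
  have Dsa: "selfadj D" unfolding D_fun by (rule op_fun_selfadj[OF Re_U_between cD])
  have "Re_U o\<^sub>L U = U o\<^sub>L Re_U" "Re_U o\<^sub>L U\<^sup>\<dagger> = U\<^sup>\<dagger> o\<^sub>L Re_U"
    by (rule blinfun_eqI; simp add: Re_U_apply op_expand UU)+
  note com = this[THEN op_fun_commute[OF Re_U_between cD], folded D_fun]
  have "D = 0"
  proof (rule selfadj_eq_0_if_trace_vanishes[OF DN Dsa])
    fix P assume P: "P \<in> projections N"
      and comm: "\<And>B. B \<in> bounded_operators \<Longrightarrow> D o\<^sub>L B = B o\<^sub>L D \<Longrightarrow> D o\<^sub>L B\<^sup>\<dagger> = B\<^sup>\<dagger> o\<^sub>L D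
        \<Longrightarrow> P o\<^sub>L B = B o\<^sub>L P"
    note PN = projectionsD(1)[OF P]
    have PU: "P (U x) = U (P x)" for x
      using op_eqD[OF comm[OF bounded[OF UN] com], of x] by simp
    have "P o\<^sub>L D = (P o\<^sub>L A) - (P o\<^sub>L B) - g c *\<^sub>R P"
      by (rule blinfun_eqI) (simp add: D_def op_expand)
    then have "tr (P o\<^sub>L D) = tr (P o\<^sub>L A) - tr (P o\<^sub>L B) - g c * tr P"
      by (simp add: tr_diff tr_scaleR mem_intros PN AN BN)
    also have "\<dots> = 0" using eq[OF P PU] trB by (simp add: g_def algebra_simps)
    finally show "tr (P o\<^sub>L D) = 0" .
  qed
  then have "op_fun g Re_U = g c *\<^sub>R \<I>" unfolding gT by (simp add: D_def)
  then show ?thesis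
    by (intro op_fun_injective_eq_scalar[OF Re_U_between cg anti]) (use c in auto)
qed

text \<open>For \<open>A = U - 2E + I\<close>, the spectrum of \<open>A\<^sup>\<dagger>A\<close> is contained in \<open>{0, 4, 2 + 2c}\<close>, and \<open>0\<close> and \<open>4\<close> have equal multiplicity.\<close>
lemma swapped_projection_trace:
  assumes W: "W \<in> N" "selfadj W" "\<And>x. W (W x) = x"
    and UW: "\<And>x. U x = c *\<^sub>R x + (\<i> * complex_of_real s) *\<^sub>C W x"
    and cs: "c\<^sup>2 + s\<^sup>2 = 1"
    and E: "E \<in> projections N" and F: "F \<in> projections N"
    and EF: "\<And>x. E (F x) = 0" and FE: "\<And>x. F (E x) = 0"
    and EW: "\<And>x. E (W x) = W (F x)" and FW: "\<And>x. F (W x) = W (E x)"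
  shows "tr E * (4 powr (p / 2) - (2 - 2 * c) powr (p / 2) - (2 + 2 * c) powr (p / 2)) = 0"
proof -
  note Ed = projectionsD[OF E] and Fd = projectionsD[OF F]
  note Esa = projection_selfadj[OF E] and Fsa = projection_selfadj[OF F]
  define J where "J = (\<i> * complex_of_real s) \<cdot>\<^sub>C W"
  have JN: "J \<in> N" unfolding J_def by (intro mem_intros W)
  have Jx: "J x = (\<i> * complex_of_real s) *\<^sub>C W x" for x by (simp add: J_def op_expand)
  note lin = bounded_operatorsD[OF bounded]
  have EJ: "E (J x) = J (F x)" for x by (simp add: Jx lin[OF Ed(1)] EW)
  have FJ: "F (J x) = J (E x)" for x by (simp add: Jx lin[OF Fd(1)] FW)
  have JJ: "J (J x) = - (s\<^sup>2 *\<^sub>R x)" for x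
  proof -
    have "J (J x) = ((\<i> * complex_of_real s) * (\<i> * complex_of_real s)) *\<^sub>C x"
      by (simp only: Jx lin[OF W(1)] W(3) scaleC_scaleC)
    also have "(\<i> * complex_of_real s) * (\<i> * complex_of_real s) = complex_of_real (- (s\<^sup>2))"
      by (simp add: power2_eq_square complex_eq_iff)
    finally show ?thesis by (simp only: scaleC_of_real) simp
  qed
  have Jadj: "J x \<bullet> y = - (x \<bullet> J y)" for x y
  proof -
    have "J x \<bullet> y = W x \<bullet> (cnj (\<i> * complex_of_real s) *\<^sub>C y)" unfolding Jx by (rule inner_scaleC_left)
    also have "\<dots> = x \<bullet> (cnj (\<i> * complex_of_real s) *\<^sub>C W y)"
      by (simp only: selfadj_inner[OF W(2)] lin[OF W(1)])
    also have "cnj (\<i> * complex_of_real s) *\<^sub>C W y = - J y"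
      by (simp add: Jx scaleC_minus_left)
    finally show ?thesis by simp
  qed
  define A where "A = U - 2 *\<^sub>R E + \<I>"
  have AN: "A \<in> N" unfolding A_def by (intro mem_intros UN Ed)
  have Ax: "A x = c *\<^sub>R x + J x - 2 *\<^sub>R E x + x" for x by (simp add: A_def op_expand UW Jx)
  have Aadj: "(A\<^sup>\<dagger>) x = c *\<^sub>R x - J x - 2 *\<^sub>R E x + x" for x
  proof -
    have "A\<^sup>\<dagger> = c *\<^sub>R \<I> - J - 2 *\<^sub>R E + \<I>"
      by (rule adjoint_eqI[OF bounded[OF AN]])
        (simp add: Ax op_expand inner_add_left inner_add_right inner_diff_left inner_diff_right Jadj
          selfadj_inner[OF Esa])
    then show ?thesis by (simp add: op_expand)
  qed
  define H where "H = A\<^sup>\<dagger> o\<^sub>L A"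
  have double: "4 *\<^sub>R v = 2 *\<^sub>R v + 2 *\<^sub>R v" "(c * 4) *\<^sub>R v = (c * 2) *\<^sub>R v + (c * 2) *\<^sub>R v"
    "(c * 2) *\<^sub>R v = c *\<^sub>R v + c *\<^sub>R v" for v :: 'h
    by (simp_all flip: scaleR_add_left)
  have Hx: "H x = (2 + 2 * c) *\<^sub>R x - (4 * c) *\<^sub>R E x + 2 *\<^sub>R F (J x) - 2 *\<^sub>R E (J x)" for x
  proof -
    have "H x = (c * c + 1 + s\<^sup>2) *\<^sub>R x + (2 * c) *\<^sub>R x - (4 * c) *\<^sub>R E x + 2 *\<^sub>R J (E x) - 2 *\<^sub>R J (F x)"
      by (simp add: H_def Ax Aadj op_expand EJ FJ JJ Ed(3) algebra_simps double)
    also have "c * c + 1 + s\<^sup>2 = 2" using cs by (simp add: power2_eq_square)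
    finally show ?thesis by (simp add: EJ FJ scaleR_add_left)
  qed
  define Y where "Y = c *\<^sub>R (E - F) + (E o\<^sub>L J) - (F o\<^sub>L J)"
  have Yx: "Y x = c *\<^sub>R (E x - F x) + E (J x) - F (J x)" for x by (simp add: Y_def op_expand)
  have YN: "Y \<in> N" unfolding Y_def by (intro mem_intros Ed Fd JN)
  define e where "e = E + F"
  have ex: "e x = E x + F x" for x by (simp add: e_def op_expand)
  have eN: "e \<in> N" unfolding e_def by (intro mem_intros Ed Fd)
  note rules = op_expand EJ FJ JJ Ed(3) Fd(3) EF FE blinfun.zero_right
  have YY: "Y (Y x) = e x" for x
  proof -
    have "Y (Y x) = (c\<^sup>2 + s\<^sup>2) *\<^sub>R (E x + F x)"
      by (simp add: Yx rules algebra_simps power2_eq_square)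
    then show ?thesis by (simp add: cs ex)
  qed
  have eY: "e (Y x) = Y x" "Y (e x) = Y x" for x by (simp_all add: Yx ex rules algebra_simps)
  have ee: "e (e x) = e x" for x by (simp add: ex rules)
  have He: "H (e x) = 2 *\<^sub>R e x - 2 *\<^sub>R Y x" for x
    by (simp add: Hx Yx ex rules algebra_simps scaleR_2)
      (simp add: scaleR_add_left[symmetric] algebra_simps)
  have HY: "H (Y x) = 2 *\<^sub>R Y x - 2 *\<^sub>R e x" for x using He[of "Y x"] by (simp add: eY YY)
  have He': "H (x - e x) = (2 + 2 * c) *\<^sub>R (x - e x)" for x
    by (simp add: Hx ex rules algebra_simps)
  define G1 G2 where "G1 = (1/2) *\<^sub>R (e - Y)" and "G2 = (1/2) *\<^sub>R (e + Y)"
  have GN: "G1 \<in> N" "G2 \<in> N" unfolding G1_def G2_def by (intro mem_intros eN YN)+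
  have H4: "H (e x - Y x) = 4 *\<^sub>R (e x - Y x)" for x
    by (simp add: blinfun.diff_right He HY algebra_simps double)
  have I1: "H o\<^sub>L G1 = G1 o\<^sub>L (4 *\<^sub>R \<I>)"
    by (rule blinfun_eqI) (simp add: G1_def blinfun.scaleR_left blinfun.diff_left blinfun.scaleR_right H4)
  have I2: "H o\<^sub>L G2 = G2 o\<^sub>L (0 *\<^sub>R \<I>)"
    by (rule blinfun_eqI) (simp add: G2_def op_expand He HY)
  have I3: "H o\<^sub>L (\<I> - e) = (\<I> - e) o\<^sub>L ((2 + 2 * c) *\<^sub>R \<I>)"
    by (rule blinfun_eqI) (use He' in \<open>simp add: op_expand\<close>)
  define f where "f = (\<lambda>t::real. t powr (p / 2))"
  have cf: "continuous_on {0..b} f" for b unfolding f_def using p by (intro continuous_on_powr_const) simp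
  define R where "R = max 4 ((norm A)\<^sup>2)"
  have H: "op_between 0 R H"
    unfolding H_def R_def by (rule op_between_mono[OF selfadj_adjoint_compose[OF bounded[OF AN]]]) auto
  have fHN: "op_fun f H \<in> N" by (rule mem_op_fun[OF H cf]) (unfold H_def, intro mem_intros AN)
  have f_on: "op_fun f H o\<^sub>L X = f r *\<^sub>R X" if "H o\<^sub>L X = X o\<^sub>L (r *\<^sub>R \<I>)" "0 \<le> r" "r \<le> 4" for X r
  proof -
    have rR: "r \<le> R" using that(3) by (simp add: R_def)
    have "op_fun f H o\<^sub>L X = X o\<^sub>L op_fun f (r *\<^sub>R \<I>)"
      by (rule op_fun_intertwine[OF H op_between_scaleR_id[OF that(2) rR] cf that(1)])
    also have "\<dots> = X o\<^sub>L (f r *\<^sub>R \<I>)" unfolding op_fun_scaleR_id[OF that(2) rR cf] ..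
    also have "\<dots> = f r *\<^sub>R X" by (rule blinfun_eqI) (simp add: op_expand)
    finally show ?thesis .
  qed
  have f1: "op_fun f H o\<^sub>L G1 = f 4 *\<^sub>R G1" by (rule f_on[OF I1]) simp_all
  have f2: "op_fun f H o\<^sub>L G2 = f 0 *\<^sub>R G2" by (rule f_on[OF I2]) simp_all
  have f3: "op_fun f H o\<^sub>L (\<I> - e) = f (2 + 2 * c) *\<^sub>R (\<I> - e)"
    by (rule f_on[OF I3]) (use c in simp_all)
  have f0: "f 0 = 0" by (simp add: f_def)
  have "op_fun f H = (op_fun f H o\<^sub>L G1) + (op_fun f H o\<^sub>L G2) + (op_fun f H o\<^sub>L (\<I> - e))"
  proof (rule blinfun_eqI)
    fix x
    have "G1 x + G2 x + (x - e x) = x"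
      by (simp add: G1_def G2_def op_expand algebra_simps flip: scaleR_add_left)
    then show "op_fun f H x = ((op_fun f H o\<^sub>L G1) + (op_fun f H o\<^sub>L G2) + (op_fun f H o\<^sub>L (\<I> - e))) x"
      by (simp add: op_expand flip: blinfun.add_right blinfun.diff_right)
  qed
  also have "\<dots> = f 4 *\<^sub>R G1 + f (2 + 2 * c) *\<^sub>R (\<I> - e)"
    unfolding f1 f2 f3 f0 by simp
  finally have trH: "tr (op_fun f H) = f 4 * tr G1 + f (2 + 2 * c) * (1 - tr e)"
    by (simp add: tr_add tr_diff tr_scaleR tr_id mem_intros GN eN)
  have trEF: "tr F = tr E"
  proof -
    have "E = W o\<^sub>L (F o\<^sub>L W)" by (rule blinfun_eqI) (simp add: FW W(3))
    then have "tr E = tr ((F o\<^sub>L W) o\<^sub>L W)" using tr_commute[OF W(1) mem_compose[OF Fd(1) W(1)]] by simp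
    also have "(F o\<^sub>L W) o\<^sub>L W = F" by (rule blinfun_eqI) (simp add: W(3))
    finally show ?thesis by simp
  qed
  have trEJ: "tr (E o\<^sub>L J) = tr (F o\<^sub>L J)"
  proof -
    have "F o\<^sub>L J = J o\<^sub>L E" by (rule blinfun_eqI) (simp add: FJ)
    then show ?thesis using tr_commute[OF Ed(1) JN] by simp
  qed
  have tre: "tr e = 2 * tr E" unfolding e_def using trEF by (simp add: tr_add Ed(1) Fd(1))
  have "tr Y = 0" unfolding Y_def using trEF trEJ by (simp add: tr_add tr_diff tr_scaleR mem_intros Ed(1) Fd(1) JN)
  then have "tr G1 = tr E" unfolding G1_def using tre by (simp add: tr_diff tr_scaleR mem_intros eN YN)
  then have "f 4 * tr E + f (2 + 2 * c) * (1 - 2 * tr E)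
      = tr E * f (2 - 2 * c) + (1 - tr E) * f (2 + 2 * c)"
    using trH pnorm_eq[OF E] pnorm_powr_eq[OF AN p] tre
    unfolding A_def[symmetric] H_def[symmetric] f_def[symmetric]
    by (simp add: tr_diff tr_id mem_id Ed(1) f_def)
  then show ?thesis by (simp add: f_def algebra_simps)
qed

lemma U_scalar:
  assumes p2: "p \<noteq> 2" and cs: "c\<^sup>2 + s\<^sup>2 = 1"
  shows "U = Complex c s \<cdot>\<^sub>C \<I> \<or> U = Complex c (- s) \<cdot>\<^sub>C \<I>"
proof -
  have scalarI: "U = Complex c r \<cdot>\<^sub>C \<I>" if "\<And>x. U x = c *\<^sub>R x + (\<i> * complex_of_real r) *\<^sub>C x" for r
  proof (rule blinfun_eqI)
    fix x
    have "Complex c r = complex_of_real c + \<i> * complex_of_real r" by (simp add: complex_eq_iff)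
    then show "U x = (Complex c r \<cdot>\<^sub>C \<I>) x"
      by (simp add: op_expand that scaleC_add_left scaleC_of_real)
  qed
  have half: "U x + (U\<^sup>\<dagger>) x = (2 * c) *\<^sub>R x" for x
  proof -
    have "(1/2) *\<^sub>R (U x + (U\<^sup>\<dagger>) x) = c *\<^sub>R x" using op_eqD[OF Re_U_eq, of x] by (simp add: Re_U_apply op_expand)
    then have "2 *\<^sub>R ((1/2) *\<^sub>R (U x + (U\<^sup>\<dagger>) x)) = 2 *\<^sub>R (c *\<^sub>R x)" by simp
    then show ?thesis by simp
  qed
  define K where "K = (- \<i>) \<cdot>\<^sub>C (U - c *\<^sub>R \<I>)"
  have Kx: "K x = (- \<i>) *\<^sub>C (U x - c *\<^sub>R x)" for x by (simp add: K_def op_expand)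
  have KN: "K \<in> N" unfolding K_def by (intro mem_intros UN)
  have UK: "U x = c *\<^sub>R x + \<i> *\<^sub>C K x" for x
    by (simp add: Kx scaleC_scaleC scaleC_one)
  have U': "(U\<^sup>\<dagger>) x = c *\<^sub>R x - \<i> *\<^sub>C K x" for x
  proof -
    have "(U\<^sup>\<dagger>) x = (2 * c) *\<^sub>R x - U x" using half[of x] by (simp add: algebra_simps)
    then show ?thesis unfolding UK by (simp add: scaleR_2 flip: scaleR_scaleR)
  qed
  have ii: "\<i> *\<^sub>C (\<i> *\<^sub>C x) = - x" for x :: 'h
    using scaleC_of_real[of "- 1" x] by (simp add: scaleC_scaleC)
  have KK: "K (K x) = s\<^sup>2 *\<^sub>R x" for x
  proof -
    have "x = c *\<^sub>R (c *\<^sub>R x + \<i> *\<^sub>C K x) - \<i> *\<^sub>C K (c *\<^sub>R x + \<i> *\<^sub>C K x)"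
      using UU(1)[of x] unfolding U' unfolding UK by simp
    also have "\<dots> = (c * c) *\<^sub>R x + K (K x)"
      by (simp add: op_expand scaleC_add_right scaleR_add_right scaleC_scaleR_commute
          bounded_operatorsD[OF bounded[OF KN]] ii)
    finally have "K (K x) = x - (c * c) *\<^sub>R x" by (simp add: algebra_simps)
    also have "\<dots> = (1 - c * c) *\<^sub>R x" by (simp add: scaleR_diff_left)
    also have "1 - c * c = s\<^sup>2" using cs by (simp add: power2_eq_square)
    finally show ?thesis .
  qed
  have Ksa: "selfadj K"
  proof (rule selfadjI[OF bounded[OF KN]])
    fix x y
    have K': "K y = \<i> *\<^sub>C ((U\<^sup>\<dagger>) y - c *\<^sub>R y)" by (simp add: U' scaleC_minus_right ii)
    have "K x \<bullet> y = (U x - c *\<^sub>R x) \<bullet> (\<i> *\<^sub>C y)" unfolding Kx inner_scaleC_left by simp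
    also have "\<dots> = x \<bullet> ((U\<^sup>\<dagger>) (\<i> *\<^sub>C y) - c *\<^sub>R (\<i> *\<^sub>C y))"
      by (simp add: inner_diff_left inner_diff_right iU)
    also have "(U\<^sup>\<dagger>) (\<i> *\<^sub>C y) - c *\<^sub>R (\<i> *\<^sub>C y) = K y"
      unfolding K' by (simp add: bounded_operatorsD[OF bounded[OF adjoint_in[OF UN]]] scaleC_diff_right scaleC_scaleR_commute)
    finally show "K x \<bullet> y = x \<bullet> K y" .
  qed
  show ?thesis
  proof (cases "s = 0")
    case True
    have "K x = 0" for x
    proof -
      have "K x \<bullet> K x = x \<bullet> K (K x)" by (rule selfadj_inner[OF Ksa])
      then show ?thesis by (simp add: KK True)
    qed
    then have "U = Complex c s \<cdot>\<^sub>C \<I>"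
      using scaleC_of_real[of 0] by (intro scalarI) (simp add: UK True scaleC_zero_right)
    then show ?thesis ..
  next
    case False
    define W where "W = (1 / s) *\<^sub>R K"
    have Wx: "W x = (1 / s) *\<^sub>R K x" for x by (simp add: W_def op_expand)
    have WN: "W \<in> N" unfolding W_def by (intro mem_intros KN)
    have Wsa: "selfadj W"
      by (rule selfadjI[OF bounded[OF WN]]) (simp add: Wx selfadj_inner[OF Ksa])
    have WW: "W (W x) = x" for x using False by (simp add: Wx op_expand KK power2_eq_square)
    have UW: "U x = c *\<^sub>R x + (\<i> * complex_of_real s) *\<^sub>C W x" for x
    proof -
      have "(\<i> * complex_of_real s) *\<^sub>C W x = \<i> *\<^sub>C (s *\<^sub>R W x)"
        by (simp add: scaleC_scaleC flip: scaleC_of_real)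
      then show ?thesis using False by (simp add: UK Wx)
    qed
    define Q R where "Q = (1/2) *\<^sub>R (\<I> + W)" and "R = (1/2) *\<^sub>R (\<I> - W)"
    have Qx: "Q x = (1/2) *\<^sub>R (x + W x)" and Rx: "R x = (1/2) *\<^sub>R (x - W x)" for x
      by (simp_all add: Q_def R_def op_expand)
    have QN: "Q \<in> N" and RN: "R \<in> N" unfolding Q_def R_def by (intro mem_intros WN)+
    have Qp: "Q \<in> projections N"
    proof (rule projectionI[OF QN])
      show "selfadj Q"
        by (rule selfadjI[OF bounded[OF QN]]) (simp add: Qx inner_add_left inner_add_right selfadj_inner[OF Wsa])
      show "Q (Q x) = Q x" for x
      proof -
        have "W (Q x) = Q x" by (simp add: Qx op_expand WW add.commute)
        then show ?thesis unfolding Qx[of "Q x"] by simp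
      qed
    qed
    have Rp: "R \<in> projections N"
    proof (rule projectionI[OF RN])
      show "selfadj R"
        by (rule selfadjI[OF bounded[OF RN]]) (simp add: Rx inner_diff_left inner_diff_right selfadj_inner[OF Wsa])
      show "R (R x) = R x" for x
        by (simp add: Rx op_expand WW algebra_simps) (simp flip: scaleR_add_left)
    qed
    have QR: "Q (R x) = 0" for x by (simp add: Qx Rx op_expand WW algebra_simps)
    show ?thesis
    proof (cases "Q = 0 \<or> R = 0")
      case True
      then show ?thesis
      proof
        assume "Q = 0"
        then have "(1/2) *\<^sub>R (x + W x) = 0" for x using Qx[of x] by simp
        then have "W x = - x" for x by (simp add: add_eq_0_iff)
        then have "U = Complex c (- s) \<cdot>\<^sub>C \<I>"
          by (intro scalarI) (simp add: UW scaleC_minus_right scaleC_minus_left)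
        then show ?thesis ..
      next
        assume "R = 0"
        then have "(1/2) *\<^sub>R (x - W x) = 0" for x using Rx[of x] by simp
        then have "W x = x" for x by simp
        then have "U = Complex c s \<cdot>\<^sub>C \<I>" by (intro scalarI) (simp add: UW)
        then show ?thesis ..
      qed
    next
      case False
      have W_R: "W x = x - 2 *\<^sub>R R x" for x by (simp add: Rx)
      obtain E F where EF: "E \<in> projections N" "F \<in> projections N" "E \<noteq> 0"
        "\<And>x. E (F x) = 0" "\<And>x. F (E x) = 0"
        "\<And>x. E (x - 2 *\<^sub>R R x) = F x - 2 *\<^sub>R R (F x)" "\<And>x. F (x - 2 *\<^sub>R R x) = E x - 2 *\<^sub>R R (E x)"
        "\<And>x. E (Q x + R x) = E x" "\<And>x. F (Q x + R x) = F x"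
        using swapped_projections[OF Qp _ Rp _ QR] False by blast
      note zero = swapped_projection_trace[OF WN Wsa WW UW cs EF(1,2,4,5) EF(6,7)[folded W_R]]
      have "tr E \<noteq> 0" using tr_faithful_projection[OF EF(1)] EF(3) by blast
      then have eq: "4 powr (p / 2) = (2 - 2 * c) powr (p / 2) + (2 + 2 * c) powr (p / 2)" using zero by simp
      have "0 < s\<^sup>2" using \<open>s \<noteq> 0\<close> by simp
      then have "c\<^sup>2 < 1" using cs by linarith
      then have c1: "- 1 < c" "c < 1" by (auto simp: abs_square_less_1)
      have "2 - 2 * c = 4 * ((1 - c) / 2)" "2 + 2 * c = 4 * (1 - (1 - c) / 2)" by (simp_all add: field_simps)
      then have "4 powr (p / 2) = 4 powr (p / 2) * (((1 - c) / 2) powr (p / 2) + (1 - (1 - c) / 2) powr (p / 2))"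
        using eq c1 by (simp only: powr_mult distrib_left)
      then have "((1 - c) / 2) powr (p / 2) + (1 - (1 - c) / 2) powr (p / 2) = 1" by simp
      moreover have "((1 - c) / 2) powr (p / 2) + (1 - (1 - c) / 2) powr (p / 2) \<noteq> 1"
        by (rule powr_add_complementary_neq_1) (use c1 p2 in auto)
      ultimately show ?thesis by blast
    qed
  qed
qed

end

theorem lemma2p5:
  fixes p \<theta> :: real
    and N :: "('h::complex_hilbert) op set"
    and \<tau> :: "'h op \<Rightarrow> complex"
    and U :: "'h op"
  assumes "0 < p" and "p \<noteq> 2"
    and "II1_factor N"
    and "tracial_state N \<tau>"
    and "U \<in> unitaries N"
    and "- pi < \<theta>" and "\<theta> \<le> pi"
  shows "(\<forall>P\<in>projections N.
            pnorm \<tau> p (U - 2 *\<^sub>R P + \<I>) powr p =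
              Re (\<tau> P) * (2 - 2 * cos \<theta>) powr (p / 2)
              + Re (\<tau> (\<I> - P)) * (2 + 2 * cos \<theta>) powr (p / 2))
         \<longleftrightarrow> U = exp (\<i> * complex_of_real \<theta>) \<cdot>\<^sub>C \<I> \<or> U = exp (- (\<i> * complex_of_real \<theta>)) \<cdot>\<^sub>C \<I>"
    (is "?L \<longleftrightarrow> ?R")
proof -
  interpret tracial_II1_factor N \<tau>
    using assms(3,4) unfolding II1_factor_def factor_def
    by unfold_locales blast+
  interpret unitary_in_vn_algebra N \<tau> U
    by unfold_locales (rule assms(5))
  have e1: "exp (\<i> * complex_of_real \<theta>) = Complex (cos \<theta>) (sin \<theta>)"
    by (simp add: cis_conv_exp[symmetric] complex_eq_iff)
  have "exp (- (\<i> * complex_of_real \<theta>)) = cis (- \<theta>)" by (simp add: cis_conv_exp)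
  then have e2: "exp (- (\<i> * complex_of_real \<theta>)) = Complex (cos \<theta>) (- sin \<theta>)"
    by (simp add: complex_eq_iff)
  show ?thesis
  proof
    assume ?L
    interpret unitary_in_II1_factor N \<tau> U p "cos \<theta>"
      by unfold_locales (use \<open>?L\<close> assms(1) in \<open>simp_all add: tr_def\<close>)
    show ?R unfolding e1 e2 by (rule U_scalar[OF assms(2)]) simp
  next
    assume ?R
    then obtain z where z: "U = z \<cdot>\<^sub>C \<I>" and Re_z: "Re z = cos \<theta>" unfolding e1 e2 by force
    have Ux: "U x = z *\<^sub>C x" for x by (simp add: z op_expand)
    have "U\<^sup>\<dagger> = cnj z \<cdot>\<^sub>C \<I>" unfolding z adjoint_unary(2)[OF bounded_operators_id] by simp
    then have U'x: "(U\<^sup>\<dagger>) x = cnj z *\<^sub>C x" for x by (simp add: op_expand)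
    have T: "Re_U = cos \<theta> *\<^sub>R \<I>"
    proof (rule blinfun_eqI)
      fix x :: 'h
      have "z *\<^sub>C x + cnj z *\<^sub>C x = (2 * cos \<theta>) *\<^sub>R x"
        unfolding scaleC_add_left[symmetric] complex_add_cnj Re_z by (rule scaleC_of_real)
      then show "Re_U x = (cos \<theta> *\<^sub>R \<I>) x" by (simp add: Re_U_apply Ux U'x op_expand)
    qed
    show ?L
    proof
      fix P assume P: "P \<in> projections N"
      have "P (U x) = U (P x)" for x
        by (simp add: Ux bounded_operatorsD[OF bounded[OF projectionsD(1)[OF P]]])
      from pnorm_scalar[OF T _ _ P this assms(1)]
      show "pnorm \<tau> p (U - 2 *\<^sub>R P + \<I>) powr p =
          Re (\<tau> P) * (2 - 2 * cos \<theta>) powr (p / 2) + Re (\<tau> (\<I> - P)) * (2 + 2 * cos \<theta>) powr (p / 2)"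
        by (simp add: tr_def)
    qed
  qed
qed

end
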